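(* Let $\mathcal E_1$ and $\mathcal E_2$ be two ellipses in $\mathbb{R}^2$ (circles allowed), and let $\beta_{\mathcal E_1},\beta_{\mathcal E_2}$ be Mather's $\beta$-functions of the billiards in the domains they bound. If $\beta_{\mathcal E_1}\equiv\beta_{\mathcal E_2}$, then $\mathcal E_1$ and $\mathcal E_2$ are the same ellipse, i.e. they have the same major and minor semi-axes. More generally, writing $\beta_{\mathcal E_i}(\omega)\sim\sum_{k=0}^\infty\beta_{\mathcal E_i,k}\frac{\omega^k}{k!}$ for the formal Taylor expansion at $\omega=0$, if $\beta_{\mathcal E_1,1}=\beta_{\mathcal E_2,1}$ and $\beta_{\mathcal E_1,3}=\beta_{\mathcal E_2,3}$, then the same conclusion holds.
   Context: Billiard. Let $\Omega$ be a strictly convex planar domain with $C^\infty$ boundary of length $\ell_0$ (here, the domain bounded by an ellipse with semi-axes $0<b\le a$), and $\gamma$ a positively oriented arc-length parametrization of $\partial\Omega$, extended $\ell_0$-periodically to $\mathbb{R}$. A point mass moves with unit speed along straight segments in $\Omega$ and reflects at the boundary with angle of incidence equal to angle of reflection. The billiard map is a twist map with generating function $h(s,s')=-\|\gamma(s)-\gamma(s')\|$ (minus the Euclidean distance), for lifts $s\le s'\le s+\ell_0$ of consecutive impact points. Rotation number. A billiard orbit with lifted impact points $(s_i)_{i\in\mathbb{Z}}$ has rotation number $\omega=\lim_{i\to\pm\infty}\frac{s_i}{i\,\ell_0}$ if the limit exists; for a periodic orbit this is $p/q$ with $p$ the winding number around $\partial\Omega$ and $q$ the number of reflections. $\beta$-function.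 An orbit $(s_i)$ is minimal if every finite segment of it minimizes $\sum h(s_i,s_{i+1})$ among sequences with the same endpoints. Minimal orbits exist for every rotation number, and $$\beta(\omega):=\lim_{N\to\infty}\frac1{2N}\sum_{i=-N}^{N-1}h(s_i,s_{i+1})$$ for any minimal orbit of rotation number $\omega$ (the value does not depend on the choice). Thus, for $p/q\in(0,1/2]$ in lowest terms, $\beta(p/q)=-\frac1q\max\{\text{length of periodic billiard orbits of rotation number }p/q\}$, and $\beta(0)=0$. Formal Taylor expansion. A caustic is a smooth convex closed curve in $\Omega$ such that a trajectory tangent to it remains tangent to it after each reflection; its rotation number is that of the trajectories tangent to it. "$\beta(\omega)\sim\sum_k\beta_k\omega^k/k!$" means that for every $n$, $\beta(\omega)=\sum_{k=0}^n\beta_k\frac{\omega^k}{k!}+O(\omega^{n+1})$ as $\omega\to0^+$ along rotation numbers $\omega$ for which a caustic exists. (For an ellipse, the confocal ellipses inside it are caustics and a neighbourhood of the boundary is foliated by them.) *)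

theory Defs
  imports "HOL-Analysis.Analysis" "HOL-Library.Landau_Symbols"
begin

definition cross2 :: "real^2 \<Rightarrow> real^2 \<Rightarrow> real" where
  "cross2 u v = u $ 1 * v $ 2 - u $ 2 * v $ 1"

text \<open>An ellipse in arbitrary position: centre \<open>c\<close>, orthonormal axis directions \<open>u\<close>, \<open>v\<close>.\<close>

definition is_ellipse :: "real \<Rightarrow> real \<Rightarrow> (real^2) set \<Rightarrow> bool" where
  "is_ellipse a b E \<longleftrightarrow> 0 < b \<and> b \<le> a \<and>
     (\<exists>c u v. norm u = 1 \<and> norm v = 1 \<and> u \<bullet> v = 0 \<and>
        E = {c + x *\<^sub>R u + y *\<^sub>R v | x y. (x / a)\<^sup>2 + (y / b)\<^sup>2 = 1})"

definition smooth_curve :: "(real \<Rightarrow> real^2) \<Rightarrow> bool" where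
  "smooth_curve c \<longleftrightarrow>
     (\<exists>D. D 0 = c \<and> (\<forall>(k::nat) t. (D k has_vector_derivative D (Suc k) t) (at t)))"

text \<open>\<open>c\<close> is a regular smooth parametrization, with least period \<open>L\<close>, of the simple closed curve \<open>C\<close>.\<close>

definition closed_curve_param :: "(real \<Rightarrow> real^2) \<Rightarrow> real \<Rightarrow> (real^2) set \<Rightarrow> bool" where
  "closed_curve_param c L C \<longleftrightarrow>
     smooth_curve c \<and> 0 < L \<and> (\<forall>t. c (t + L) = c t) \<and> inj_on c {0..<L} \<and> range c = C \<and>
     (\<forall>t. vector_derivative c (at t) \<noteq> 0)"

text \<open>Positive orientation is expressed by the bounded domain lying to the left of every tangent line;
  this is adequate for the boundary of a strictly convex domain.\<close>

definition arclength_param :: "(real \<Rightarrow> real^2) \<Rightarrow> real \<Rightarrow> (real^2) set \<Rightarrow> bool" where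
  "arclength_param \<gamma> l E \<longleftrightarrow>
     closed_curve_param \<gamma> l E \<and>
     (\<forall>t. norm (vector_derivative \<gamma> (at t)) = 1) \<and>
     (\<forall>t. \<forall>z\<in>inside E. 0 < cross2 (vector_derivative \<gamma> (at t)) (z - \<gamma> t))"

definition gen_fun :: "(real \<Rightarrow> real^2) \<Rightarrow> real \<Rightarrow> real \<Rightarrow> real" where
  "gen_fun \<gamma> s s' = - norm (\<gamma> s - \<gamma> s')"

text \<open>Angle of incidence equals angle of reflection: the unit velocities before and after the impact
  at \<open>\<gamma> y\<close> have the same component along the boundary.\<close>

definition reflection_law :: "(real \<Rightarrow> real^2) \<Rightarrow> real \<Rightarrow> real \<Rightarrow> real \<Rightarrow> bool" where
  "reflection_law \<gamma> x y z \<longleftrightarrow>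
     sgn (\<gamma> y - \<gamma> x) \<bullet> vector_derivative \<gamma> (at y) =
     sgn (\<gamma> z - \<gamma> y) \<bullet> vector_derivative \<gamma> (at y)"

text \<open>Lifted impact points of an orbit of the billiard map. The last two cases are the orbits on the
  boundary of the phase space (outgoing angle \<open>0\<close> or \<open>\<pi>\<close> with the boundary), all of whose points are
  fixed by the billiard map; they carry the rotation numbers \<open>0\<close> and \<open>1\<close>.\<close>

definition billiard_orbit :: "(real \<Rightarrow> real^2) \<Rightarrow> real \<Rightarrow> (int \<Rightarrow> real) \<Rightarrow> bool" where
  "billiard_orbit \<gamma> l s \<longleftrightarrow>
     (\<forall>i. s i < s (i + 1) \<and> s (i + 1) < s i + l \<and>
          reflection_law \<gamma> (s (i - 1)) (s i) (s (i + 1))) \<or>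
     (\<forall>i. s (i + 1) = s i) \<or>
     (\<forall>i. s (i + 1) = s i + l)"

definition has_rotation_number :: "real \<Rightarrow> (int \<Rightarrow> real) \<Rightarrow> real \<Rightarrow> bool" where
  "has_rotation_number l s \<omega> \<longleftrightarrow>
     ((\<lambda>i. s i / (of_int i * l)) \<longlongrightarrow> \<omega>) at_top \<and>
     ((\<lambda>i. s i / (of_int i * l)) \<longlongrightarrow> \<omega>) at_bot"

text \<open>The competitors \<open>t\<close> must have steps in the domain \<open>s \<le> s' \<le> s + l\<close> of the generating function.
  Without this constraint the lift, and hence the rotation number, would play no role.\<close>

definition minimal_orbit :: "(real \<Rightarrow> real^2) \<Rightarrow> real \<Rightarrow> (int \<Rightarrow> real) \<Rightarrow> bool" where
  "minimal_orbit \<gamma> l s \<longleftrightarrow>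
     billiard_orbit \<gamma> l s \<and>
     (\<forall>m n t. m < n \<and> t m = s m \<and> t n = s n \<and>
        (\<forall>i\<in>{m..<n}. t i \<le> t (i + 1) \<and> t (i + 1) \<le> t i + l) \<longrightarrow>
        (\<Sum>i\<in>{m..<n}. gen_fun \<gamma> (s i) (s (i + 1))) \<le>
        (\<Sum>i\<in>{m..<n}. gen_fun \<gamma> (t i) (t (i + 1))))"

definition mather_beta :: "(real \<Rightarrow> real^2) \<Rightarrow> real \<Rightarrow> real \<Rightarrow> real" where
  "mather_beta \<gamma> l \<omega> =
     (THE v. \<exists>s. minimal_orbit \<gamma> l s \<and> has_rotation_number l s \<omega> \<and>
        (\<lambda>N. (\<Sum>i\<in>{- int N..int N - 1}. gen_fun \<gamma> (s i) (s (i + 1))) / (2 * real N))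
          \<longlonglongrightarrow> v)"

definition tangent_chord :: "(real \<Rightarrow> real^2) \<Rightarrow> real^2 \<Rightarrow> real^2 \<Rightarrow> bool" where
  "tangent_chord c p q \<longleftrightarrow>
     (\<exists>t. c t \<in> open_segment p q \<and> cross2 (vector_derivative c (at t)) (q - p) = 0)"

definition is_caustic :: "(real \<Rightarrow> real^2) \<Rightarrow> real \<Rightarrow> (real \<Rightarrow> real^2) \<Rightarrow> bool" where
  "is_caustic \<gamma> l c \<longleftrightarrow>
     (\<exists>L. closed_curve_param c L (range c)) \<and>
     range c = frontier (convex hull (range c)) \<and>
     range c \<subseteq> inside (range \<gamma>) \<and>
     (\<forall>s. billiard_orbit \<gamma> l s \<and> tangent_chord c (\<gamma> (s 0)) (\<gamma> (s 1)) \<longrightarrow>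
        (\<forall>i\<ge>0. tangent_chord c (\<gamma> (s i)) (\<gamma> (s (i + 1)))))"

text \<open>A tangent trajectory may run around the caustic in either sense, and lifts with
  \<open>s \<le> s' \<le> s + l\<close> assign rotation numbers \<open>\<omega>\<close> and \<open>1 - \<omega>\<close> to the two senses. The rotation number of the
  caustic is that of the trajectories running in the positive sense, with the caustic on their left.\<close>

definition positive_tangent_orbit ::
    "(real \<Rightarrow> real^2) \<Rightarrow> real \<Rightarrow> (real \<Rightarrow> real^2) \<Rightarrow> (int \<Rightarrow> real) \<Rightarrow> bool" where
  "positive_tangent_orbit \<gamma> l c s \<longleftrightarrow>
     billiard_orbit \<gamma> l s \<and>
     (\<forall>i. tangent_chord c (\<gamma> (s i)) (\<gamma> (s (i + 1))) \<and>
          (\<forall>z\<in>range c. 0 \<le> cross2 (\<gamma> (s (i + 1)) - \<gamma> (s i)) (z - \<gamma> (s i))))"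

definition caustic_rotation_number ::
    "(real \<Rightarrow> real^2) \<Rightarrow> real \<Rightarrow> (real \<Rightarrow> real^2) \<Rightarrow> real \<Rightarrow> bool" where
  "caustic_rotation_number \<gamma> l c \<omega> \<longleftrightarrow>
     (\<exists>s. positive_tangent_orbit \<gamma> l c s) \<and>
     (\<forall>s. positive_tangent_orbit \<gamma> l c s \<longrightarrow> has_rotation_number l s \<omega>)"

text \<open>\<open>B k\<close> is the coefficient of \<open>\<omega> ^ k / k!\<close>.\<close>

definition beta_taylor_expansion ::
    "(real \<Rightarrow> real^2) \<Rightarrow> real \<Rightarrow> (nat \<Rightarrow> real) \<Rightarrow> bool" where
  "beta_taylor_expansion \<gamma> l B \<longleftrightarrow>
     (\<forall>n. (\<lambda>\<omega>. mather_beta \<gamma> l \<omega> - (\<Sum>k\<le>n. B k * \<omega> ^ k / fact k))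
        \<in> O[at 0 within {\<omega>. 0 < \<omega> \<and> (\<exists>c. is_caustic \<gamma> l c \<and>
              caustic_rotation_number \<gamma> l c \<omega>)}](\<lambda>\<omega>. \<omega> ^ (n + 1)))"

end

(* With x, d half the sum and half the difference of the eccentric angles of two points of the ellipse,
   their distance is 2 sin d * f(x), where f = sqrt(a^2 sin^2 + b^2 cos^2) is the speed of the
   parametrization, and the chord is tangent to the confocal ellipse with parameter lam (semi-axes
   sqrt(a^2 - lam^2), sqrt(b^2 - lam^2)) iff sin d = lam f(x) / (a b).
   Let G and U be primitives of w = sqrt(f^2 - lam^2) and 1 / w. The length of a chord from t to t' is at
   most G t' - G t - M for a constant M, with equality on the tangent chords, and along these U grows by a
   constant rho. So tangent orbits are minimal, their rotation number is omega = rho / P with P the increment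
   of U over a period, and beta(omega) = M - C omega with C the increment of G.

   Expanding in lam, beta(omega) = - l omega + (a b)^2 K^3 / 24 * omega^3 + o(omega^3), where l is the
   perimeter and K the integral of 1 / f. As omega takes all small positive values, l and (a b)^2 K^3 are
   determined by beta and by its Taylor coefficients. Finally (a b)^2 K^3 / l depends only on r = b / a and
   increases strictly with r. *)

theory Submission
  imports Defs
begin

text \<open>The calibration rests on Joachimsthal's integral. Differentiating the length of a chord
  in its two ends gives, up to sign, speed times the cosine of the angle with the boundary; by
  Lagrange's identity both squares have the form f^2 - mu^2 with the same mu. On the level mu = lam
  each derivative is a function w of that end alone, so G t' - G t has the same derivatives as the
  length there. Other chords are handled by comparing squares, hence the care about signs. The
  density 1 / w is invariant because the two ends of a moving tangent chord have velocities
  proportional to w.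

  Since beta is defined by a definite description, every minimal orbit of rotation number omega must
  be controlled, not only the tangent ones. Calibration bounds its average action from below; a
  competitor with equal steps in U bounds it from above.

  As lam tends to 0, M and rho are integrals over a shrinking interval. The substitution sin t = lam
  x / a fixes the interval, and rationalizing differences of square roots exposes the factor lam^3
  of M.

  Monotonicity in r uses that the derivatives in r of the two integrals are combinations of these
  integrals, together with two elementary bounds on their ratio.\<close>

definition antideriv :: "(real \<Rightarrow> real) \<Rightarrow> real \<Rightarrow> real" where
  "antideriv g = (SOME F. \<forall>x. (F has_real_derivative g x) (at x))"

text \<open>The primitive lives on the whole line, so negative and arbitrarily large angles need no
  case distinction. The additive constant left open by the choice cancels in every
  increment.\<close>

lemma antideriv_deriv:
  assumes "continuous_on UNIV g"
  shows "(antideriv g has_real_derivative g x) (at x)"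
proof -
  obtain F where "\<And>x. (F has_real_derivative g x) (at x)"
    using einterval_antiderivative[of "-\<infinity>" "\<infinity>" g] assms
    by (auto simp: has_real_derivative_iff_has_vector_derivative continuous_on_eq_continuous_at)
  then have "\<exists>F. \<forall>x. (F has_real_derivative g x) (at x)" by blast
  from someI_ex[OF this] show ?thesis unfolding antideriv_def by blast
qed

lemma quasi_periodic_if_deriv_periodic:
  fixes F g :: "real \<Rightarrow> real"
  assumes "\<And>x. (F has_real_derivative g x) (at x)" "\<And>x. g (x + T) = g x"
  shows "F (x + T) = F x + (F T - F 0)"
proof -
  have "((\<lambda>x. F (x + T) - F x) has_real_derivative 0) (at x)" for x
    using DERIV_diff[OF DERIV_shift[THEN iffD1, OF assms(1)[of "x + T"]] assms(1)[of x]]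
    by (simp add: assms(2))
  from DERIV_isconst_all[of "\<lambda>x. F (x + T) - F x" x 0] this show ?thesis by auto
qed

lemma periodic_continuous_bounded:
  fixes g :: "real \<Rightarrow> real"
  assumes "continuous_on UNIV g" "\<And>x. g (x + T) = g x" "T > 0"
  shows "\<exists>B. \<forall>x. \<bar>g x\<bar> \<le> B"
proof -
  have "compact (g ` {0..T})"
    by (rule compact_continuous_image) (use assms continuous_on_subset[OF assms(1)] in auto)
  then obtain B where B: "\<And>x. x \<in> {0..T} \<Longrightarrow> \<bar>g x\<bar> \<le> B"
    using compact_imp_bounded[of "g ` {0..T}"] by (fastforce simp: bounded_iff)
  have gn: "g (x + real n * T) = g x" for x n
    by (induction n) (simp_all add: algebra_simps assms(2)[of "x + _", simplified algebra_simps])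
  have gi: "g (x + of_int k * T) = g x" for x k
  proof (cases "k \<ge> 0")
    case True then show ?thesis using gn[of x "nat k"] by simp
  next
    case False then show ?thesis using gn[of "x + of_int k * T" "nat (-k)"] by simp
  qed
  have "\<bar>g x\<bar> \<le> B" for x
  proof -
    define k where "k = \<lfloor>x / T\<rfloor>"
    have "of_int k \<le> x / T" "x / T < of_int k + 1" unfolding k_def by linarith+
    then have "of_int k * T \<le> x" "x < (of_int k + 1) * T" using \<open>T > 0\<close> by (auto simp: field_simps)
    then have "x + of_int (-k) * T \<in> {0..T}" by (auto simp: algebra_simps)
    then show ?thesis using B gi[of x "-k"] by metis
  qed
  then show ?thesis by blast
qed

text \<open>Subtracting the mean slope leaves a continuous periodic function. This is how a rotation
  number, a statement about impact points, is transferred to \<open>G\<close> and \<open>U\<close>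
  along an orbit.\<close>

lemma quasi_periodic_linear_bound:
  fixes F :: "real \<Rightarrow> real"
  assumes "continuous_on UNIV F" "\<And>x. F (x + T) = F x + C" "T > 0"
  shows "\<exists>B. \<forall>x. \<bar>F x - C / T * x\<bar> \<le> B"
proof (rule periodic_continuous_bounded[where T = T])
  show "continuous_on UNIV (\<lambda>x. F x - C / T * x)" by (intro continuous_intros assms)
  show "F (x + T) - C / T * (x + T) = F x - C / T * x" for x
    using \<open>T > 0\<close> unfolding assms(2) by (simp add: field_simps)
qed fact

text \<open>A uniform positive lower bound on the slope forces \<open>F\<close> to be unbounded in
  both directions, so the intermediate value theorem gives surjectivity.\<close>

lemma bij_if_deriv_ge_pos:
  fixes F g :: "real \<Rightarrow> real"
  assumes "\<And>x. (F has_real_derivative g x) (at x)" "\<And>x. g x \<ge> c" "c > 0"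
  shows "bij F" "strict_mono F" "x \<le> y \<Longrightarrow> c * (y - x) \<le> F y - F x"
proof -
  show 1: "c * (y - x) \<le> F y - F x" if "x \<le> y" for x y
  proof -
    have "((\<lambda>x. F x - c * x) has_real_derivative (g x - c)) (at x)" for x
      by (auto intro!: derivative_eq_intros assms(1))
    then have "F x - c * x \<le> F y - c * y"
      by (intro DERIV_nonneg_imp_nondecreasing[OF that]) (use assms(2) in force)
    then show ?thesis by (simp add: algebra_simps)
  qed
  show 2: "strict_mono F"
  proof (rule strict_monoI)
    fix x y :: real assume "x < y"
    then have "0 < c * (y - x)" using \<open>c > 0\<close> by simp
    then show "F x < F y" using 1[of x y] \<open>x < y\<close> by linarith
  qed
  have "\<exists>x. F x = y" for y
  proof -
    define d where "d = \<bar>y - F 0\<bar> / c"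
    have d: "d \<ge> 0" "c * d = \<bar>y - F 0\<bar>" using \<open>c > 0\<close> by (auto simp: d_def)
    have "F (-d) \<le> y" "y \<le> F d" using 1[of "-d" 0] 1[of 0 d] d by auto
    moreover have "continuous_on {-d..d} F"
      using assms(1) by (meson DERIV_isCont continuous_at_imp_continuous_on)
    ultimately show ?thesis using IVT'[of F "-d" y d] d by auto
  qed
  then show "bij F" using 2 by (metis bij_betw_def strict_mono_imp_inj_on surj_def)
qed

section \<open>Speed in the eccentric angle and derivatives of chord lengths\<close>

definition ellipse_speed :: "real \<Rightarrow> real \<Rightarrow> real \<Rightarrow> real" where
  "ellipse_speed a b t = sqrt (a\<^sup>2 * (sin t)\<^sup>2 + b\<^sup>2 * (cos t)\<^sup>2)"

locale ellipse_axes =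
  fixes a b :: real
  assumes b_pos: "0 < b" and b_le_a: "b \<le> a"
begin

lemma a_pos: "0 < a" using b_pos b_le_a by linarith

abbreviation speed :: "real \<Rightarrow> real" where "speed \<equiv> ellipse_speed a b"

lemmas speed_def = ellipse_speed_def[of a b]

definition speed' :: "real \<Rightarrow> real" where
  "speed' t = (a\<^sup>2 - b\<^sup>2) * sin t * cos t / speed t"

text \<open>The formula carries no absolute value: it is smooth everywhere, and equals the distance
  exactly when the sine is nonnegative, in particular for \<open>t \<le> t'\<close> and
  \<open>t' \<le> t + 2 * pi\<close>.\<close>

definition chord_len :: "real \<Rightarrow> real \<Rightarrow> real" where
  "chord_len t t' = 2 * sin ((t' - t) / 2) * speed ((t + t') / 2)"

lemma speed_sq: "(speed t)\<^sup>2 = a\<^sup>2 * (sin t)\<^sup>2 + b\<^sup>2 * (cos t)\<^sup>2"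
  by (simp add: speed_def)

lemma speed_bounds: "b \<le> speed t" "speed t \<le> a"
proof -
  have 1: "(a\<^sup>2 - b\<^sup>2) \<ge> 0" using b_pos b_le_a by (simp add: power_mono)
  have "(speed t)\<^sup>2 = b\<^sup>2 + (a\<^sup>2 - b\<^sup>2) * (sin t)\<^sup>2"
    unfolding speed_sq cos_squared_eq by (simp add: algebra_simps)
  then have "b\<^sup>2 \<le> (speed t)\<^sup>2" using 1 by simp
  then show "b \<le> speed t" by (rule power2_le_imp_le) (simp add: speed_def)
  have "(speed t)\<^sup>2 = a\<^sup>2 - (a\<^sup>2 - b\<^sup>2) * (cos t)\<^sup>2"
    unfolding speed_sq sin_squared_eq by (simp add: algebra_simps)
  then have "(speed t)\<^sup>2 \<le> a\<^sup>2" using 1 by simp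
  then show "speed t \<le> a" by (rule power2_le_imp_le) (use a_pos in simp)
qed

lemma speed_pos: "0 < speed t" using speed_bounds(1)[of t] b_pos by linarith

lemma speed_periodic: "speed (t + 2 * pi) = speed t"
  by (simp add: speed_def)

lemma speed_deriv: "(speed has_real_derivative speed' t) (at t)"
proof -
  have "0 < a\<^sup>2 * (sin t)\<^sup>2 + b\<^sup>2 * (cos t)\<^sup>2"
    using speed_pos[of t] by (simp add: speed_def)
  then show ?thesis
    unfolding ellipse_speed_def[abs_def] speed'_def
    by (auto intro!: derivative_eq_intros simp: field_simps)
qed

lemma speed_continuous: "continuous_on A speed"
  by (meson speed_deriv DERIV_isCont continuous_at_imp_continuous_on)

lemmas speed_derivs [derivative_intros] = DERIV_chain2[OF speed_deriv]
lemmas speed_conts [continuous_intros] = continuous_on_compose2[OF speed_continuous[of UNIV], simplified]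

text \<open>The bracket is the derivative of the chord length in the end \<open>x + d\<close>, the
  other end being \<open>x - d\<close>. The right side is the inner product of
  \<open>(-a sin x, b cos x)\<close>, the direction of the chord, with the velocity of the
  parametrization at \<open>x + d\<close>.\<close>

lemma speed_chord_in:
  "speed x * (cos d * speed x + sin d * speed' x) = a\<^sup>2 * sin x * sin (x + d) + b\<^sup>2 * cos x * cos (x + d)"
proof -
  have "speed x * (cos d * speed x + sin d * speed' x) = cos d * (speed x)\<^sup>2 + sin d * ((a\<^sup>2 - b\<^sup>2) * sin x * cos x)"
    using speed_pos[of x] by (simp add: speed'_def field_simps power2_eq_square)
  also have "\<dots> = a\<^sup>2 * sin x * sin (x + d) + b\<^sup>2 * cos x * cos (x + d)"
    unfolding speed_sq sin_add cos_add by (simp add: algebra_simps power2_eq_square)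
  finally show ?thesis .
qed

text \<open>With \<open>p = (a sin x, b cos x)\<close> and \<open>q = (a sin (x + d), b cos (x + d))\<close> this is
  Lagrange's identity \<open>(p \<bullet> q)\<^sup>2 = |p|\<^sup>2 |q|\<^sup>2 - det(p, q)\<^sup>2\<close>.\<close>

lemma chord_deriv_sq:
  "(cos d * speed x + sin d * speed' x)\<^sup>2 = (speed (x + d))\<^sup>2 - (a * b * sin d / speed x)\<^sup>2"
proof -
  have s: "speed x \<noteq> 0" using speed_pos[of x] by simp
  have 1: "speed x * (cos d * speed x + sin d * speed' x) = (a * sin x) * (a * sin (x + d)) + (b * cos x) * (b * cos (x + d))"
    unfolding speed_chord_in by (simp add: power2_eq_square mult_ac)
  have det: "(a * sin x) * (b * cos (x + d)) - (b * cos x) * (a * sin (x + d)) = - (a * b * sin d)"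
  proof -
    have "(a * sin x) * (b * cos (x + d)) - (b * cos x) * (a * sin (x + d)) = a * b * sin (x - (x + d))"
      unfolding sin_diff by (simp add: algebra_simps)
    then show ?thesis by simp
  qed
  have lag: "(p * q + r * s)\<^sup>2 = (p\<^sup>2 + r\<^sup>2) * (q\<^sup>2 + s\<^sup>2) - (p * s - r * q)\<^sup>2" for p q r s :: real
    by algebra
  have "(speed x)\<^sup>2 * (cos d * speed x + sin d * speed' x)\<^sup>2
      = (speed x * (cos d * speed x + sin d * speed' x))\<^sup>2" by (simp add: power_mult_distrib)
  also have "\<dots> = (speed x)\<^sup>2 * (speed (x + d))\<^sup>2 - (a * b * sin d)\<^sup>2"
    unfolding 1 lag det by (simp add: power_mult_distrib speed_sq)
  finally have "(speed x)\<^sup>2 * (cos d * speed x + sin d * speed' x)\<^sup>2 = \<dots>" .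
  then show ?thesis using s by (simp add: field_simps power_divide)
qed

lemma chord_deriv_sq':
  "(cos d * speed x - sin d * speed' x)\<^sup>2 = (speed (x - d))\<^sup>2 - (a * b * sin d / speed x)\<^sup>2"
  using chord_deriv_sq[of "-d" x] by simp

lemma speed_gradient_sq: "(speed t)\<^sup>2 + (speed' t)\<^sup>2 = (a^4 * (sin t)\<^sup>2 + b^4 * (cos t)\<^sup>2) / (speed t)\<^sup>2"
proof -
  have s: "speed t \<noteq> 0" using speed_pos[of t] by simp
  have "((speed t)\<^sup>2 + (speed' t)\<^sup>2) * (speed t)\<^sup>2 = ((speed t)\<^sup>2)\<^sup>2 + ((a\<^sup>2 - b\<^sup>2) * sin t * cos t)\<^sup>2"
    using s by (simp add: speed'_def field_simps power2_eq_square)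
  \<comment> \<open>The factor \<open>(sin t)\<^sup>2 + (cos t)\<^sup>2\<close> makes both sides
    forms of degree 4 in sine and cosine, so that this is a polynomial identity.\<close>
  also have "\<dots> = (a^4 * (sin t)\<^sup>2 + b^4 * (cos t)\<^sup>2) * ((sin t)\<^sup>2 + (cos t)\<^sup>2)"
    unfolding speed_sq by algebra
  finally show ?thesis using s by (simp add: field_simps)
qed

end

subsection \<open>Calibration by the confocal caustic\<close>

locale ellipse_caustic = ellipse_axes +
  fixes lam :: real
  assumes lam_pos: "0 < lam" and lam_less_b: "lam < b"
begin

text \<open>Along a tangent chord from \<open>t\<close> to \<open>t'\<close> the length has
  derivative \<open>w t'\<close> in \<open>t'\<close> and \<open>- w t\<close> in \<open>t\<close>
  (\<open>w_eq_chord_deriv\<close>). A primitive of \<open>w\<close> is therefore the natural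
  calibration.\<close>

definition w :: "real \<Rightarrow> real" where "w t = sqrt ((speed t)\<^sup>2 - lam\<^sup>2)"

definition G :: "real \<Rightarrow> real" where "G = antideriv w"

text \<open>\<open>1 / w\<close> is the invariant density of the map that sends the start of a
  tangent chord to its end; in the coordinate \<open>U\<close> this map is the translation by
  \<open>rho\<close>.\<close>

definition U :: "real \<Rightarrow> real" where "U = antideriv (\<lambda>t. 1 / w t)"

definition C :: real where "C = G (2 * pi) - G 0"

definition P :: real where "P = U (2 * pi) - U 0"

definition d0 :: "real \<Rightarrow> real" where "d0 x = arcsin (lam * speed x / (a * b))"

definition d0' :: "real \<Rightarrow> real" where "d0' x = lam * speed' x / (a * b * cos (d0 x))"

text \<open>The excess of the increment of \<open>G\<close> over the length of the chord from
  \<open>x - d\<close> to \<open>x + d\<close>. For fixed \<open>x\<close> it decreases in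
  \<open>d\<close> up to \<open>d0 x\<close> and then increases.\<close>

definition Phi :: "real \<Rightarrow> real \<Rightarrow> real" where
  "Phi x d = G (x + d) - G (x - d) - 2 * sin d * speed x"

text \<open>\<open>M\<close> and \<open>rho\<close> are read off at \<open>x = 0\<close>, from the
  chord perpendicular to the major axis that touches the caustic at its vertex.
  \<open>Phi_d0\<close> and \<open>U_d0\<close> show that every tangent chord gives the same
  values.\<close>

definition M :: real where "M = Phi 0 (d0 0)"

definition rho :: real where "rho = U (d0 0) - U (- d0 0)"

lemma w_arg: "lam\<^sup>2 + (b\<^sup>2 - lam\<^sup>2) \<le> (speed t)\<^sup>2" "0 < b\<^sup>2 - lam\<^sup>2" "0 < (speed t)\<^sup>2 - lam\<^sup>2"
proof -
  show 1: "0 < b\<^sup>2 - lam\<^sup>2" using lam_pos lam_less_b by (simp add: power_strict_mono)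
  show 2: "lam\<^sup>2 + (b\<^sup>2 - lam\<^sup>2) \<le> (speed t)\<^sup>2" using speed_bounds(1)[of t] b_pos by (simp add: power_mono)
  show "0 < (speed t)\<^sup>2 - lam\<^sup>2" using 1 2 by linarith
qed

lemma w_sq: "(w t)\<^sup>2 = (speed t)\<^sup>2 - lam\<^sup>2" using w_arg(3)[of t] by (simp add: w_def)

lemma w_pos: "0 < w t" using w_arg(3)[of t] by (simp add: w_def)

lemma w_le_a: "w t \<le> a"
proof (rule power2_le_imp_le)
  have "(speed t)\<^sup>2 \<le> a\<^sup>2" using speed_bounds(2)[of t] speed_pos[of t] by (simp add: power_mono less_imp_le)
  then show "(w t)\<^sup>2 \<le> a\<^sup>2" using lam_pos unfolding w_sq by (smt (verit) zero_le_power2)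
qed (use a_pos in simp)

lemma w_periodic: "w (t + 2 * pi) = w t" by (simp add: w_def speed_periodic)

lemma w_continuous: "continuous_on A w"
  unfolding w_def[abs_def] by (intro continuous_intros)

lemma G_deriv: "(G has_real_derivative w t) (at t)"
  unfolding G_def by (rule antideriv_deriv[OF w_continuous])

lemma U_deriv: "(U has_real_derivative 1 / w t) (at t)"
  unfolding U_def
  by (rule antideriv_deriv) (use w_pos in \<open>auto intro!: continuous_intros w_continuous simp: less_imp_neq[THEN not_sym]\<close>)

lemmas G_derivs [derivative_intros] = DERIV_chain2[OF G_deriv]
lemmas U_derivs [derivative_intros] = DERIV_chain2[OF U_deriv]

lemma G_quasi_periodic: "G (t + 2 * pi) = G t + C"
  unfolding C_def by (rule quasi_periodic_if_deriv_periodic[OF G_deriv w_periodic])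

lemma U_quasi_periodic: "U (t + 2 * pi) = U t + P"
  unfolding P_def by (rule quasi_periodic_if_deriv_periodic[OF U_deriv]) (simp add: w_periodic)

lemma U_bij: "bij U" and U_strict_mono: "strict_mono U" and U_growth: "x \<le> y \<Longrightarrow> 1 / a * (y - x) \<le> U y - U x"
proof -
  have *: "1 / w x \<ge> 1 / a" for x using w_pos[of x] w_le_a[of x] by (intro divide_left_mono) auto
  note bij_if_deriv_ge_pos[OF U_deriv *]
  then show "bij U" "strict_mono U" "x \<le> y \<Longrightarrow> 1 / a * (y - x) \<le> U y - U x" using a_pos by auto
qed

lemma U_less_iff: "U x < U y \<longleftrightarrow> x < y" using U_strict_mono by (simp add: strict_mono_less)
lemma U_eq_iff: "U x = U y \<longleftrightarrow> x = y" using U_strict_mono by (simp add: strict_mono_eq)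

lemma d0_arg: "0 < lam * speed x / (a * b)" "lam * speed x / (a * b) < 1"
proof -
  show "0 < lam * speed x / (a * b)" using lam_pos speed_pos[of x] a_pos b_pos by simp
  have "lam * speed x < b * a"
    using lam_pos lam_less_b speed_bounds[of x] speed_pos[of x] by (intro mult_less_le_imp_less) auto
  then show "lam * speed x / (a * b) < 1" using a_pos b_pos by (simp add: mult.commute)
qed

lemma sin_d0: "sin (d0 x) = lam * speed x / (a * b)"
  using d0_arg[of x] by (simp add: d0_def)

lemma d0_bounds: "0 < d0 x" "d0 x < pi / 2"
proof -
  show "0 < d0 x" using d0_arg[of x] arcsin_less_arcsin[of 0 "lam * speed x / (a * b)"] by (simp add: d0_def)
  show "d0 x < pi / 2" using d0_arg[of x] arcsin_lt_bounded[of "lam * speed x / (a * b)"] by (simp add: d0_def)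
qed

lemma cos_d0_pos: "0 < cos (d0 x)"
  using d0_bounds[of x] by (intro cos_gt_zero) auto

lemma d0_deriv: "(d0 has_real_derivative d0' x) (at x)"
proof -
  have "cos (d0 x) = sqrt (1 - (lam * speed x / (a * b))\<^sup>2)"
    using d0_arg[of x] by (simp add: d0_def cos_arcsin)
  then show ?thesis
    unfolding d0_def[abs_def] d0'_def using d0_arg[of x]
    by (auto intro!: derivative_eq_intros simp: divide_simps)
qed

lemmas d0_derivs [derivative_intros] = DERIV_chain2[OF d0_deriv]

lemma lam_eq_if_sin: "a * b * sin (d0 x) / speed x = lam"
  using speed_pos[of x] a_pos b_pos by (simp add: sin_d0)

text \<open>At a chord with \<open>a b sin d / speed x \<le> lam\<close> the two one-sided derivatives of the length
  are positive: their sum is \<open>2 cos d * speed x\<close>, and their product is positive by the gradient identity.\<close>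

lemma chord_deriv_pos:
  assumes "0 \<le> d" "d \<le> d0 x"
  shows "0 < cos d * speed x + sin d * speed' x" "0 < cos d * speed x - sin d * speed' x"
proof -
  let ?X = "cos d * speed x + sin d * speed' x" and ?Y = "cos d * speed x - sin d * speed' x"
  have cpos: "0 < cos d" using assms d0_bounds[of x] by (intro cos_gt_zero_pi) auto
  have sl: "0 \<le> sin d" "sin d \<le> lam * speed x / (a * b)"
    using assms d0_bounds[of x] sin_d0[of x] sin_monotone_2pi_le[of d "d0 x"] by (auto intro!: sin_ge_zero)
  have "?X * ?Y = (cos d)\<^sup>2 * (speed x)\<^sup>2 - (sin d)\<^sup>2 * (speed' x)\<^sup>2" by algebra
  also have "\<dots> = (speed x)\<^sup>2 - (sin d)\<^sup>2 * ((speed x)\<^sup>2 + (speed' x)\<^sup>2)"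
    unfolding cos_squared_eq by algebra
  also have "\<dots> \<ge> (speed x)\<^sup>2 - (lam * speed x / (a * b))\<^sup>2 * ((speed x)\<^sup>2 + (speed' x)\<^sup>2)"
    using sl by (intro diff_left_mono mult_right_mono power_mono) auto
  also have "(lam * speed x / (a * b))\<^sup>2 * ((speed x)\<^sup>2 + (speed' x)\<^sup>2)
      = lam\<^sup>2 / (a * b)\<^sup>2 * (a^4 * (sin x)\<^sup>2 + b^4 * (cos x)\<^sup>2)"
    unfolding speed_gradient_sq using speed_pos[of x] by (simp add: power_divide power_mult_distrib)
  also have "\<dots> = lam\<^sup>2 * a\<^sup>2 / b\<^sup>2 * (sin x)\<^sup>2 + lam\<^sup>2 * b\<^sup>2 / a\<^sup>2 * (cos x)\<^sup>2"
    using a_pos b_pos by (simp add: field_simps) 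
  also have "(speed x)\<^sup>2 - \<dots> = a\<^sup>2 * (1 - lam\<^sup>2 / b\<^sup>2) * (sin x)\<^sup>2 + b\<^sup>2 * (1 - lam\<^sup>2 / a\<^sup>2) * (cos x)\<^sup>2"
    unfolding speed_sq by (simp add: algebra_simps)
  finally have XY: "?X * ?Y \<ge> a\<^sup>2 * (1 - lam\<^sup>2 / b\<^sup>2) * (sin x)\<^sup>2 + b\<^sup>2 * (1 - lam\<^sup>2 / a\<^sup>2) * (cos x)\<^sup>2" .
  have "lam\<^sup>2 < b\<^sup>2" "lam\<^sup>2 < a\<^sup>2"
    using lam_pos lam_less_b b_le_a by (auto intro!: power_strict_mono)
  then have A: "0 < a\<^sup>2 * (1 - lam\<^sup>2 / b\<^sup>2)" "0 < b\<^sup>2 * (1 - lam\<^sup>2 / a\<^sup>2)"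
    using a_pos b_pos by (auto intro!: mult_pos_pos)
  have "sin x \<noteq> 0 \<or> cos x \<noteq> 0" by (metis sin_zero_abs_cos_one abs_zero zero_neq_one)
  then have "0 < a\<^sup>2 * (1 - lam\<^sup>2 / b\<^sup>2) * (sin x)\<^sup>2 + b\<^sup>2 * (1 - lam\<^sup>2 / a\<^sup>2) * (cos x)\<^sup>2"
    using A by (auto intro: add_pos_nonneg add_nonneg_pos)
  then have "0 < ?X * ?Y" using XY by linarith
  moreover have "0 < cos d * speed x" using cpos speed_pos[of x] by simp
  ultimately show "0 < ?X" "0 < ?Y" by (auto simp: zero_less_mult_iff[of ?X ?Y])
qed

text \<open>The squares agree by \<open>chord_deriv_sq\<close>, whose correction term is
  \<open>lam\<^sup>2\<close> at \<open>d0 x\<close>. Positivity from \<open>chord_deriv_pos\<close>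
  excludes the other sign.\<close>

lemma w_eq_chord_deriv:
  "w (x + d0 x) = cos (d0 x) * speed x + sin (d0 x) * speed' x"
  "w (x - d0 x) = cos (d0 x) * speed x - sin (d0 x) * speed' x"
proof -
  note p = chord_deriv_pos[of "d0 x" x] d0_bounds[of x]
  have "(w (x + d0 x))\<^sup>2 = (cos (d0 x) * speed x + sin (d0 x) * speed' x)\<^sup>2"
    unfolding w_sq chord_deriv_sq lam_eq_if_sin ..
  then show "w (x + d0 x) = cos (d0 x) * speed x + sin (d0 x) * speed' x"
    using p w_pos[of "x + d0 x"] by (simp add: power2_eq_iff_nonneg)
  have "(w (x - d0 x))\<^sup>2 = (cos (d0 x) * speed x - sin (d0 x) * speed' x)\<^sup>2"
    unfolding w_sq chord_deriv_sq' lam_eq_if_sin ..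
  then show "w (x - d0 x) = cos (d0 x) * speed x - sin (d0 x) * speed' x"
    using p w_pos[of "x - d0 x"] by (simp add: power2_eq_iff_nonneg)
qed

lemma Phi_deriv: "(Phi x has_real_derivative w (x + d) + w (x - d) - 2 * cos d * speed x) (at d)"
  unfolding Phi_def[abs_def] by (auto intro!: derivative_eq_intros)

text \<open>A chord shorter than the tangent one has
  \<open>a * b * sin d / speed x \<le> lam\<close>, so the squared derivatives of its length are at
  least the values of \<open>w\<close> squared. Roots may be compared because these derivatives are
  positive here.\<close>

lemma Phi_deriv_nonpos:
  assumes "0 \<le> d" "d \<le> d0 x"
  shows "w (x + d) + w (x - d) - 2 * cos d * speed x \<le> 0"
proof -
  let ?mu = "a * b * sin d / speed x"
  have "sin d \<le> sin (d0 x)"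
    using assms d0_bounds[of x] by (intro sin_monotone_2pi_le) auto
  then have "?mu \<le> lam"
    using lam_eq_if_sin[of x] speed_pos[of x] a_pos b_pos
    by (metis divide_right_mono less_imp_le mult_left_mono mult_pos_pos)
  moreover have "0 \<le> ?mu"
    using assms d0_bounds[of x] speed_pos[of x] a_pos b_pos by (auto intro!: divide_nonneg_pos mult_nonneg_nonneg sin_ge_zero)
  ultimately have mu: "?mu\<^sup>2 \<le> lam\<^sup>2" by (intro power_mono)
  have "w (x + d) \<le> cos d * speed x + sin d * speed' x"
    by (rule power2_le_imp_le) (use mu chord_deriv_pos[OF assms] in \<open>simp_all only: w_sq chord_deriv_sq less_imp_le diff_left_mono\<close>)
  moreover have "w (x - d) \<le> cos d * speed x - sin d * speed' x"
    by (rule power2_le_imp_le) (use mu chord_deriv_pos[OF assms] in \<open>simp_all only: w_sq chord_deriv_sq' less_imp_le diff_left_mono\<close>)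
  ultimately show ?thesis by simp
qed

text \<open>Beyond \<open>d0 x\<close> the inequality between the squares is reversed, and now it is
  \<open>w\<close> whose sign is known. The sine comparison needs \<open>d \<le> pi / 2\<close>;
  when \<open>cos d \<le> 0\<close> the subtracted term is itself nonpositive.\<close>

lemma Phi_deriv_nonneg:
  assumes "d0 x \<le> d" "d \<le> pi"
  shows "w (x + d) + w (x - d) - 2 * cos d * speed x \<ge> 0"
proof (cases "cos d \<le> 0")
  case True
  then have "2 * cos d * speed x \<le> 0" using speed_pos[of x] by (auto simp: mult_le_0_iff)
  then show ?thesis using w_pos[of "x + d"] w_pos[of "x - d"] by linarith
next
  case False
  let ?mu = "a * b * sin d / speed x"
  have "d \<le> pi / 2"
  proof (rule ccontr)
    assume "\<not> d \<le> pi / 2"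
    then have "cos d \<le> 0" using assms cos_monotone_0_pi_le[of "pi / 2" d] by simp
    then show False using False by simp
  qed
  then have "sin (d0 x) \<le> sin d"
    using assms d0_bounds[of x] by (intro sin_monotone_2pi_le) auto
  then have "lam \<le> ?mu"
    using lam_eq_if_sin[of x] speed_pos[of x] a_pos b_pos
    by (metis divide_right_mono less_imp_le mult_left_mono mult_pos_pos)
  then have mu: "lam\<^sup>2 \<le> ?mu\<^sup>2" using lam_pos by (intro power_mono) auto
  have "cos d * speed x + sin d * speed' x \<le> w (x + d)"
    by (rule power2_le_imp_le) (use mu w_pos[of "x + d"] in \<open>simp_all only: w_sq chord_deriv_sq less_imp_le diff_left_mono\<close>)
  moreover have "cos d * speed x - sin d * speed' x \<le> w (x - d)"
    by (rule power2_le_imp_le) (use mu w_pos[of "x - d"] in \<open>simp_all only: w_sq chord_deriv_sq' less_imp_le diff_left_mono\<close>)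
  ultimately show ?thesis by simp
qed

text \<open>Both partial derivatives of \<open>Phi\<close> vanish on the curve
  \<open>d = d0 x\<close>: by \<open>w_eq_chord_deriv\<close> the sum and the difference of the two
  values of \<open>w\<close> are \<open>2 * cos d * speed x\<close> and
  \<open>2 * sin d * speed' x\<close>.\<close>

lemma Phi_d0: "Phi x (d0 x) = M"
proof -
  have "((\<lambda>x. Phi x (d0 x)) has_real_derivative 0) (at x)" for x
  proof -
    have "((\<lambda>x. Phi x (d0 x)) has_real_derivative
       (w (x + d0 x) * (1 + d0' x) - w (x - d0 x) * (1 - d0' x) - (2 * (cos (d0 x) * d0' x) * speed x + 2 * sin (d0 x) * speed' x))) (at x)"
      unfolding Phi_def by (auto intro!: derivative_eq_intros)
    then show ?thesis unfolding w_eq_chord_deriv by (simp add: algebra_simps)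
  qed
  from DERIV_isconst_all[of "\<lambda>x. Phi x (d0 x)" x 0] this show ?thesis by (auto simp: M_def)
qed

lemma Phi_ge_M:
  assumes "0 \<le> d" "d \<le> pi"
  shows "Phi x d \<ge> M"
proof (cases "d \<le> d0 x")
  case True
  have "Phi x (d0 x) \<le> Phi x d"
  proof (rule DERIV_nonpos_imp_nonincreasing[of d "d0 x" "Phi x", OF True])
    fix e assume "d \<le> e" "e \<le> d0 x"
    then show "\<exists>y. (Phi x has_real_derivative y) (at e) \<and> y \<le> 0"
      using Phi_deriv[of x e] Phi_deriv_nonpos[of e x] assms by force
  qed
  then show ?thesis by (simp add: Phi_d0)
next
  case False
  have "Phi x (d0 x) \<le> Phi x d"
  proof (rule DERIV_nonneg_imp_nondecreasing[of "d0 x" d "Phi x"])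
    show "d0 x \<le> d" using False by simp
    fix e assume "d0 x \<le> e" "e \<le> d"
    then show "\<exists>y. (Phi x has_real_derivative y) (at e) \<and> 0 \<le> y"
      using Phi_deriv[of x e] Phi_deriv_nonneg[of x e] assms by force
  qed
  then show ?thesis by (simp add: Phi_d0)
qed

lemma chord_len_le:
  assumes "t \<le> t'" "t' \<le> t + 2 * pi"
  shows "chord_len t t' \<le> G t' - G t - M"
  using Phi_ge_M[of "(t' - t) / 2" "(t + t') / 2"] assms
  unfolding Phi_def chord_len_def by (simp add: field_simps)

text \<open>As \<open>x\<close> varies, the ends \<open>x + d0 x\<close> and \<open>x - d0 x\<close>
  move with velocities \<open>w (x + d0 x)\<close> and \<open>w (x - d0 x)\<close> times the common
  factor \<open>1 / (speed x * cos (d0 x))\<close>. Hence \<open>U\<close> grows equally at both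
  ends.\<close>

lemma U_d0: "U (x + d0 x) - U (x - d0 x) = rho"
proof -
  have "((\<lambda>x. U (x + d0 x) - U (x - d0 x)) has_real_derivative 0) (at x)" for x
  proof -
    have s: "sin (d0 x) \<noteq> 0" using d0_arg(1)[of x] unfolding sin_d0 by linarith
    have ab: "a * b = lam * speed x / sin (d0 x)"
      using a_pos b_pos lam_pos speed_pos[of x] unfolding sin_d0 by (simp add: field_simps)
    \<comment> \<open>Eliminating \<open>a * b\<close> by \<open>sin_d0\<close> turns
      \<open>d0'\<close> into the logarithmic derivative of the speed times the tangent of
      \<open>d0 x\<close>.\<close>
    have d': "d0' x = speed' x * sin (d0 x) / (speed x * cos (d0 x))"
      unfolding d0'_def ab using lam_pos s by (simp add: field_simps)
    have "1 + d0' x = w (x + d0 x) / (speed x * cos (d0 x))" "1 - d0' x = w (x - d0 x) / (speed x * cos (d0 x))"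
      unfolding w_eq_chord_deriv d' using cos_d0_pos[of x] speed_pos[of x] by (simp_all add: field_simps)
    then have "(1 + d0' x) / w (x + d0 x) - (1 - d0' x) / w (x - d0 x) = 0"
      using w_pos[of "x + d0 x"] w_pos[of "x - d0 x"] by simp
    moreover have "((\<lambda>x. U (x + d0 x) - U (x - d0 x)) has_real_derivative
        ((1 + d0' x) / w (x + d0 x) - (1 - d0' x) / w (x - d0 x))) (at x)"
      by (auto intro!: derivative_eq_intros)
    ultimately show ?thesis by simp
  qed
  from DERIV_isconst_all[of "\<lambda>x. U (x + d0 x) - U (x - d0 x)" x 0] this show ?thesis by (auto simp: rho_def)
qed

text \<open>Since \<open>d0\<close> lies between 0 and \<open>pi / 2\<close>, the function
  \<open>x - d0 x\<close> is below \<open>t\<close> at \<open>x = t\<close> and above it at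
  \<open>x = t + pi\<close>.\<close>

lemma tangent_chord_from: "\<exists>x. t = x - d0 x"
proof -
  have "continuous_on A (\<lambda>x. x - d0 x)" for A
    by (intro continuous_intros) (meson d0_deriv DERIV_isCont continuous_at_imp_continuous_on)
  moreover have "t - d0 t \<le> t" "t \<le> t + pi - d0 (t + pi)" "t \<le> t + pi"
    using d0_bounds[of t] d0_bounds[of "t + pi"] by auto
  ultimately show ?thesis using IVT'[of "\<lambda>x. x - d0 x" t t "t + pi"] by metis
qed

lemma U_step_iff: "U t' - U t = rho \<longleftrightarrow> (\<exists>x. t = x - d0 x \<and> t' = x + d0 x)"
proof
  assume *: "U t' - U t = rho"
  obtain x where x: "t = x - d0 x" using tangent_chord_from by blast
  then have "U t' = U (x + d0 x)" using U_d0[of x] * by simp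
  then show "\<exists>x. t = x - d0 x \<and> t' = x + d0 x" using x U_eq_iff by blast
qed (auto simp: U_d0)

lemma chord_len_eq:
  assumes "U t' - U t = rho"
  shows "chord_len t t' = G t' - G t - M"
proof -
  obtain x where "t = x - d0 x" "t' = x + d0 x" using assms U_step_iff by blast
  then show ?thesis using Phi_d0[of x] by (simp add: Phi_def chord_len_def)
qed

lemma rho_pos: "0 < rho"
  using U_less_iff[of "- d0 0" "d0 0"] d0_bounds[of 0] by (simp add: rho_def)

lemma rho_less_P: "rho < P"
proof -
  have "U (d0 0) < U (- d0 0 + 2 * pi)" using d0_bounds[of 0] by (subst U_less_iff) auto
  then show ?thesis unfolding U_quasi_periodic rho_def by simp
qed

end

subsection \<open>Two elliptic integrals determine the ellipse\<close>

text \<open>With eccentricity e, this is 4 a times the complete elliptic integral of the second kind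
  at e; the next one is 4 / a times that of the first kind.\<close>

definition ellipse_perim :: "real \<Rightarrow> real \<Rightarrow> real" where
  "ellipse_perim a b = integral {0..2 * pi} (ellipse_speed a b)"

definition ellipse_inv_speed :: "real \<Rightarrow> real \<Rightarrow> real" where
  "ellipse_inv_speed a b = integral {0..2 * pi} (\<lambda>t. 1 / ellipse_speed a b t)"

context ellipse_axes
begin

abbreviation perim :: real where "perim \<equiv> ellipse_perim a b"

abbreviation inv_speed_int :: real where "inv_speed_int \<equiv> ellipse_inv_speed a b"

lemma speed_neq_0 [simp]: "speed t \<noteq> 0" using speed_pos[of t] by simp

lemma perim_has_integral: "(speed has_integral perim) {0..2 * pi}"
  unfolding ellipse_perim_def by (intro integrable_integral integrable_continuous_interval continuous_intros)

lemma inv_speed_has_integral: "((\<lambda>t. 1 / speed t) has_integral inv_speed_int) {0..2 * pi}"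
  unfolding ellipse_inv_speed_def
  by (intro integrable_integral integrable_continuous_interval continuous_intros) simp

lemma perim_pos: "0 < perim"
proof -
  have "((\<lambda>t. b) has_integral (2 * pi * b)) {0..2 * pi}"
    using has_integral_const_real[of b 0 "2 * pi"] by simp
  then have "2 * pi * b \<le> perim"
    by (rule has_integral_le[OF _ perim_has_integral]) (use speed_bounds in auto)
  moreover have "0 < 2 * pi * b" using b_pos by simp
  ultimately show ?thesis by linarith
qed

lemma inv_speed_int_pos: "0 < inv_speed_int"
proof -
  have "((\<lambda>t. 1 / a) has_integral (2 * pi * (1 / a))) {0..2 * pi}"
    using has_integral_const_real[of "1 / a" 0 "2 * pi"] by simp
  then have "2 * pi * (1 / a) \<le> inv_speed_int"
    by (rule has_integral_le[OF _ inv_speed_has_integral]) (use speed_bounds speed_pos a_pos in \<open>auto intro!: divide_left_mono\<close>)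
  moreover have "0 < 2 * pi * (1 / a)" using a_pos by simp
  ultimately show ?thesis by linarith
qed

text \<open>\<open>a\<^sup>2 * b\<^sup>2 / speed t ^ 3 - speed t\<close> is the derivative of a
  periodic function, so its integral over a period is zero. This reduction keeps derivatives in the
  aspect ratio within the span of the two elliptic integrals.\<close>

lemma inv_speed_cube_has_integral:
  "((\<lambda>t. 1 / speed t ^ 3) has_integral (perim / (a\<^sup>2 * b\<^sup>2))) {0..2 * pi}"
proof -
  have "((\<lambda>t. (a\<^sup>2 - b\<^sup>2) * (sin t * cos t / speed t)) has_real_derivative
      (a\<^sup>2 * b\<^sup>2 / speed t ^ 3 - speed t)) (at t within {0..2 * pi})" for t
  proof -
    let ?s = "sin t" and ?c = "cos t" and ?f = "speed t"
    have "((\<lambda>t. (a\<^sup>2 - b\<^sup>2) * (sin t * cos t / speed t)) has_real_derivative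
        (a\<^sup>2 - b\<^sup>2) * (((?c * ?c + ?s * - ?s) * ?f - ?s * ?c * speed' t) / (?f * ?f))) (at t within {0..2 * pi})"
      by (rule derivative_eq_intros refl speed_deriv has_field_derivative_at_within | simp)+
    moreover have "(a\<^sup>2 - b\<^sup>2) * (((?c * ?c + ?s * - ?s) * ?f - ?s * ?c * speed' t) / (?f * ?f))
        = a\<^sup>2 * b\<^sup>2 / ?f ^ 3 - ?f"
    proof -
      have "(a\<^sup>2 - b\<^sup>2) * (((?c * ?c + ?s * - ?s) * ?f - ?s * ?c * speed' t) / (?f * ?f))
          = (a\<^sup>2 - b\<^sup>2) * ((?c\<^sup>2 - ?s\<^sup>2) * ?f\<^sup>2 - (a\<^sup>2 - b\<^sup>2) * ?s\<^sup>2 * ?c\<^sup>2) / ?f ^ 3"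
        by (simp add: speed'_def field_simps power2_eq_square power3_eq_cube)
      also have "(a\<^sup>2 - b\<^sup>2) * ((?c\<^sup>2 - ?s\<^sup>2) * ?f\<^sup>2 - (a\<^sup>2 - b\<^sup>2) * ?s\<^sup>2 * ?c\<^sup>2)
          = a\<^sup>2 * b\<^sup>2 * (?s\<^sup>2 + ?c\<^sup>2)\<^sup>2 - (?f\<^sup>2)\<^sup>2"
        unfolding speed_sq by algebra
      finally show ?thesis by (simp add: field_simps power_numeral_reduce)
    qed
    ultimately show ?thesis by simp
  qed
  then have "((\<lambda>t. a\<^sup>2 * b\<^sup>2 / speed t ^ 3 - speed t) has_integral 0) {0..2 * pi}"
    using fundamental_theorem_of_calculus[of 0 "2 * pi" "\<lambda>t. (a\<^sup>2 - b\<^sup>2) * (sin t * cos t / speed t)" "\<lambda>t. a\<^sup>2 * b\<^sup>2 / speed t ^ 3 - speed t"]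
    by (simp add: has_real_derivative_iff_has_vector_derivative)
  from has_integral_mult_right[OF has_integral_add[OF this perim_has_integral], of "1 / (a\<^sup>2 * b\<^sup>2)"]
  show ?thesis using a_pos b_pos by simp
qed

text \<open>Integrate the nonnegative function
  \<open>speed t * (1 - a * b / (speed t)\<^sup>2)\<^sup>2\<close>. The cubic term contributes a
  second copy of the perimeter.\<close>

lemma perim_ge: "a * b * inv_speed_int \<le> perim"
proof -
  have *: "((\<lambda>t. speed t - 2 * (a * b) * (1 / speed t) + (a * b)\<^sup>2 * (1 / speed t ^ 3)) has_integral
     (perim - 2 * (a * b) * inv_speed_int + (a * b)\<^sup>2 * (perim / (a\<^sup>2 * b\<^sup>2)))) {0..2 * pi}"
    by (intro has_integral_add has_integral_diff has_integral_mult_right perim_has_integral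
        inv_speed_has_integral inv_speed_cube_has_integral)
  have "speed t - 2 * (a * b) * (1 / speed t) + (a * b)\<^sup>2 * (1 / speed t ^ 3) = speed t * (1 - a * b / (speed t)\<^sup>2)\<^sup>2" for t
    by (simp add: field_simps power_numeral_reduce power2_eq_square)
  then have "0 \<le> speed t - 2 * (a * b) * (1 / speed t) + (a * b)\<^sup>2 * (1 / speed t ^ 3)" for t
    using speed_pos[of t] by simp
  from has_integral_nonneg[OF * this]
  show ?thesis using a_pos b_pos by (simp add: power_mult_distrib)
qed

text \<open>Let \<open>f0\<close> be the root mean square of the speed. For every positive f,
  \<open>f - f0\<^sup>2 / f \<le> (f\<^sup>2 - f0\<^sup>2) / f0\<close>, and at the speed the right
  side has integral zero by the choice of \<open>f0\<close>.\<close>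

lemma perim_le: "perim \<le> (a\<^sup>2 + b\<^sup>2) / 2 * inv_speed_int"
proof -
  define f0 where "f0 = sqrt ((a\<^sup>2 + b\<^sup>2) / 2)"
  have f0: "f0\<^sup>2 = (a\<^sup>2 + b\<^sup>2) / 2" "0 < f0" using a_pos by (auto simp: f0_def add_pos_nonneg)
  have sq: "(speed t)\<^sup>2 - f0\<^sup>2 = - (a\<^sup>2 - b\<^sup>2) / 2 * cos (2 * t)" for t
    unfolding speed_sq f0 cos_double sin_squared_eq by algebra
  have "((\<lambda>t. (speed t)\<^sup>2 - f0\<^sup>2) has_integral 0) {0..2 * pi}"
  proof -
    have "((\<lambda>t. - (a\<^sup>2 - b\<^sup>2) / 4 * sin (2 * t)) has_real_derivative ((speed t)\<^sup>2 - f0\<^sup>2)) (at t within {0..2 * pi})" for t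
      unfolding sq by (auto intro!: derivative_eq_intros)
    then show ?thesis
      using fundamental_theorem_of_calculus[of 0 "2 * pi" "\<lambda>t. - (a\<^sup>2 - b\<^sup>2) / 4 * sin (2 * t)" "\<lambda>t. (speed t)\<^sup>2 - f0\<^sup>2"]
        sin_npi[of 4]
      by (simp add: has_real_derivative_iff_has_vector_derivative del: sin_npi)
  qed
  from has_integral_diff[OF has_integral_mult_right[OF this, of "1 / f0"]
     has_integral_diff[OF perim_has_integral has_integral_mult_right[OF inv_speed_has_integral, of "f0\<^sup>2"]]]
  have *: "((\<lambda>t. 1 / f0 * ((speed t)\<^sup>2 - f0\<^sup>2) - (speed t - f0\<^sup>2 * (1 / speed t))) has_integral
     (1 / f0 * 0 - (perim - f0\<^sup>2 * inv_speed_int))) {0..2 * pi}" .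
  have "1 / f0 * ((speed t)\<^sup>2 - f0\<^sup>2) - (speed t - f0\<^sup>2 * (1 / speed t)) = (speed t - f0)\<^sup>2 * (speed t + f0) / (f0 * speed t)" for t
    using f0 by (simp add: field_simps power2_eq_square)
  moreover have "0 \<le> (speed t - f0)\<^sup>2 * (speed t + f0) / (f0 * speed t)" for t
    using speed_pos[of t] f0(2) by (intro divide_nonneg_nonneg mult_nonneg_nonneg) auto
  ultimately have "0 \<le> 1 / f0 * ((speed t)\<^sup>2 - f0\<^sup>2) - (speed t - f0\<^sup>2 * (1 / speed t))" for t
    by simp
  from has_integral_nonneg[OF * this] show ?thesis by (simp add: f0)
qed

end

section \<open>Dependence of the normalized integrals on the aspect ratio\<close>

lemma unit_speed_sq_pos: "0 < r \<Longrightarrow> 0 < (sin t)\<^sup>2 + r\<^sup>2 * (cos t)\<^sup>2" for r t :: real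
  using sin_zero_abs_cos_one[of t] by (cases "sin t = 0") (auto intro: add_pos_nonneg add_nonneg_pos)

lemma unit_speed_neq_0: "0 < r \<Longrightarrow> ellipse_speed 1 r t \<noteq> 0"
  using unit_speed_sq_pos[of r t] by (simp add: ellipse_speed_def)

lemma unit_speed_continuous: "continuous_on A (\<lambda>z. ellipse_speed 1 (fst z) (snd z))"
  unfolding ellipse_speed_def by (intro continuous_intros)

text \<open>Differentiation under the integral sign on the open set of all positive
  \<open>r\<close>, so that the circle \<open>r = 1\<close> is an interior point.\<close>

lemma ellipse_perim_deriv:
  assumes "0 < r"
  shows "(ellipse_perim 1 has_real_derivative integral {0..2*pi} (\<lambda>t. r * (cos t)\<^sup>2 / ellipse_speed 1 r t)) (at r)"
proof -
  note p = unit_speed_sq_pos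
  have "((\<lambda>r. integral (cbox 0 (2*pi)) (ellipse_speed 1 r)) has_real_derivative integral (cbox 0 (2*pi)) (\<lambda>t. r * (cos t)\<^sup>2 / ellipse_speed 1 r t)) (at r within {0<..})"
  proof (rule leibniz_rule_field_derivative[where f = "ellipse_speed 1" and fx = "\<lambda>r t. r * (cos t)\<^sup>2 / ellipse_speed 1 r t"])
    fix x t :: real assume "x \<in> {0<..}"
    then show "((\<lambda>x. ellipse_speed 1 x t) has_real_derivative x * (cos t)\<^sup>2 / ellipse_speed 1 x t) (at x within {0<..})"
      unfolding ellipse_speed_def using p[of x t]
      by (auto intro!: derivative_eq_intros simp: field_simps)
  next
    fix x :: real assume "x \<in> {0<..}"
    show "(ellipse_speed 1 x) integrable_on cbox 0 (2 * pi)"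
      unfolding ellipse_speed_def[abs_def] by (intro integrable_continuous continuous_intros)
  next
    show "continuous_on ({0<..} \<times> cbox 0 (2*pi)) (\<lambda>(x, t). x * (cos t)\<^sup>2 / ellipse_speed 1 x t)"
      unfolding split_beta
      by (intro continuous_intros unit_speed_continuous) (auto simp: unit_speed_neq_0)
  qed (use assms in auto)
  then show ?thesis using assms at_within_open[of r "{0<..}"]
    by (simp add: ellipse_perim_def[abs_def])
qed

lemma ellipse_inv_speed_deriv:
  assumes "0 < r"
  shows "(ellipse_inv_speed 1 has_real_derivative integral {0..2*pi} (\<lambda>t. - r * (cos t)\<^sup>2 / ellipse_speed 1 r t ^ 3)) (at r)"
proof -
  note p = unit_speed_sq_pos
  have "((\<lambda>r. integral (cbox 0 (2*pi)) (\<lambda>t. 1 / ellipse_speed 1 r t)) has_real_derivative integral (cbox 0 (2*pi)) (\<lambda>t. - r * (cos t)\<^sup>2 / ellipse_speed 1 r t ^ 3)) (at r within {0<..})"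
  proof (rule leibniz_rule_field_derivative)
    fix x t :: real assume "x \<in> {0<..}"
    then show "((\<lambda>x. 1 / ellipse_speed 1 x t) has_real_derivative - x * (cos t)\<^sup>2 / ellipse_speed 1 x t ^ 3) (at x within {0<..})"
      unfolding ellipse_speed_def using p[of x t]
      by (auto intro!: derivative_eq_intros simp: field_simps power_numeral_reduce)
  next
    fix x :: real assume "x \<in> {0<..}"
    then show "(\<lambda>t. 1 / ellipse_speed 1 x t) integrable_on cbox 0 (2 * pi)"
      by (intro integrable_continuous continuous_intros)
        (use unit_speed_neq_0 in \<open>auto simp: ellipse_speed_def intro!: continuous_intros\<close>)
  next
    show "continuous_on ({0<..} \<times> cbox 0 (2*pi)) (\<lambda>(x, t). - x * (cos t)\<^sup>2 / ellipse_speed 1 x t ^ 3)"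
      unfolding split_beta
      by (intro continuous_intros unit_speed_continuous) (auto simp: unit_speed_neq_0)
  qed (use assms in auto)
  then show ?thesis using assms at_within_open[of r "{0<..}"]
    by (simp add: ellipse_inv_speed_def[abs_def])
qed

text \<open>Up to a positive factor, the difference of the two sides is the derivative of the scale invariant
  quantity \<open>r\<^sup>2 k\<^sup>3 / e\<close>. The quadratic form is negative at both ends of the range \<open>[r, (1 + r\<^sup>2) / 2]\<close>
  of \<open>e / k\<close>.\<close>

lemma elliptic_quadratic_neg:
  fixes e k r :: real
  assumes "0 < k" "0 < r" "r < 1" "r * k \<le> e" "e \<le> (1 + r\<^sup>2) / 2 * k"
  shows "3 * e\<^sup>2 + r\<^sup>2 * k\<^sup>2 < 2 * (1 + r\<^sup>2) * k * e"
proof -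
  define x where "x = e / k"
  have e: "e = x * k" using assms by (simp add: x_def)
  have x: "r \<le> x" "x \<le> (1 + r\<^sup>2) / 2" using assms by (simp_all add: x_def field_simps)
  have "(x - r) * (x - (1 + r\<^sup>2) / 2) \<le> 0" using x by (intro mult_nonneg_nonpos) auto
  \<comment> \<open>Minus the form is a nonnegative multiple of the product above, with its sign
    changed, plus the linear interpolation of its end values. These are
    \<open>2 * r * (1 - r)\<^sup>2\<close> and \<open>(1 - r\<^sup>2)\<^sup>2 / 4\<close>; the sign
    of the slope decides which is the smaller.\<close>
  moreover have "2 * (1 + r\<^sup>2) * x - 3 * x\<^sup>2 - r\<^sup>2
     = - 3 * ((x - r) * (x - (1 + r\<^sup>2) / 2)) + ((1 + r\<^sup>2) / 2 - 3 * r) * x + (3 * r * (1 + r\<^sup>2) / 2 - r\<^sup>2)"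
    by (simp add: field_simps power2_eq_square)
  moreover have "0 < ((1 + r\<^sup>2) / 2 - 3 * r) * x + (3 * r * (1 + r\<^sup>2) / 2 - r\<^sup>2)"
  proof (cases "(1 + r\<^sup>2) / 2 - 3 * r \<ge> 0")
    case True
    have "0 < 2 * r * (1 - r)\<^sup>2" using assms by simp
    also have "\<dots> = ((1 + r\<^sup>2) / 2 - 3 * r) * r + (3 * r * (1 + r\<^sup>2) / 2 - r\<^sup>2)" by (simp add: field_simps power2_eq_square)
    also have "\<dots> \<le> ((1 + r\<^sup>2) / 2 - 3 * r) * x + (3 * r * (1 + r\<^sup>2) / 2 - r\<^sup>2)"
      using True x by (intro add_right_mono mult_left_mono) auto
    finally show ?thesis .
  next
    case False
    have "r\<^sup>2 < 1" using assms by (simp add: power_less_one_iff)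
    then have "0 < (1 - r\<^sup>2)\<^sup>2 / 4" by simp
    also have "\<dots> = ((1 + r\<^sup>2) / 2 - 3 * r) * ((1 + r\<^sup>2) / 2) + (3 * r * (1 + r\<^sup>2) / 2 - r\<^sup>2)" by (simp add: field_simps power2_eq_square)
    also have "\<dots> \<le> ((1 + r\<^sup>2) / 2 - 3 * r) * x + (3 * r * (1 + r\<^sup>2) / 2 - r\<^sup>2)"
      using False x by (intro add_right_mono mult_left_mono_neg) auto
    finally show ?thesis .
  qed
  ultimately have "0 < 2 * (1 + r\<^sup>2) * x - 3 * x\<^sup>2 - r\<^sup>2" by linarith
  then have "0 < (2 * (1 + r\<^sup>2) * x - 3 * x\<^sup>2 - r\<^sup>2) * k\<^sup>2" using assms by simp
  then show ?thesis by (simp add: e power2_eq_square algebra_simps)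
qed

text \<open>For \<open>r < 1\<close> the square of the cosine is an affine function of the squared
  speed, so both derivatives are combinations of the two integrals themselves. The derivative of the
  quotient is then a positive factor times the quadratic form of
  \<open>elliptic_quadratic_neg\<close>, whose hypotheses are \<open>perim_ge\<close> and
  \<open>perim_le\<close>.\<close>

lemma elliptic_invariant_deriv_pos:
  assumes "0 < r" "r < 1"
  shows "\<exists>D. ((\<lambda>r. r\<^sup>2 * ellipse_inv_speed 1 r ^ 3 / ellipse_perim 1 r) has_real_derivative D) (at r) \<and> D > 0"
proof -
  interpret ellipse_axes 1 r by unfold_locales (use assms in auto)
  have r2: "r\<^sup>2 < 1" using assms by (simp add: power_less_one_iff)
  have c: "(cos t)\<^sup>2 = (1 - (speed t)\<^sup>2) / (1 - r\<^sup>2)" for t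
    using r2 by (simp add: speed_sq sin_squared_eq field_simps)
  have i1: "((\<lambda>t. r / (1 - r\<^sup>2) * (1 / speed t - speed t)) has_integral (r / (1 - r\<^sup>2) * (inv_speed_int - perim))) {0..2*pi}"
    by (intro has_integral_mult_right has_integral_diff perim_has_integral inv_speed_has_integral)
  have j1: "r / (1 - r\<^sup>2) * (1 / speed t - speed t) = r * (cos t)\<^sup>2 / speed t" for t
  proof -
    have "1 / speed t - speed t = (1 - (speed t)\<^sup>2) / speed t" by (simp add: field_simps power2_eq_square)
    then show ?thesis unfolding c by simp
  qed
  have e': "(ellipse_perim 1 has_real_derivative (r / (1 - r\<^sup>2) * (inv_speed_int - perim))) (at r)"
    using ellipse_perim_deriv[OF assms(1)] unfolding i1[unfolded j1, THEN integral_unique] .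
  have i2: "((\<lambda>t. - r / (1 - r\<^sup>2) * (1 / speed t ^ 3 - 1 / speed t)) has_integral (- r / (1 - r\<^sup>2) * (perim / r\<^sup>2 - inv_speed_int))) {0..2*pi}"
    using inv_speed_cube_has_integral
    by (intro has_integral_mult_right has_integral_diff inv_speed_has_integral) simp
  have j2: "- r / (1 - r\<^sup>2) * (1 / speed t ^ 3 - 1 / speed t) = - r * (cos t)\<^sup>2 / speed t ^ 3" for t
  proof -
    have "1 / speed t ^ 3 - 1 / speed t = (1 - (speed t)\<^sup>2) / speed t ^ 3"
      by (simp add: divide_simps power2_eq_square power3_eq_cube)
    then show ?thesis unfolding c by simp
  qed
  have k': "(ellipse_inv_speed 1 has_real_derivative (- r / (1 - r\<^sup>2) * (perim / r\<^sup>2 - inv_speed_int))) (at r)"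
    using ellipse_inv_speed_deriv[OF assms(1)] unfolding i2[unfolded j2, THEN integral_unique] .
  let ?e = perim and ?k = inv_speed_int
  let ?e' = "r / (1 - r\<^sup>2) * (?k - ?e)" and ?k' = "- r / (1 - r\<^sup>2) * (?e / r\<^sup>2 - ?k)"
  let ?D = "((2 * r * ?k ^ 3 + 3 * ?k\<^sup>2 * ?k' * r\<^sup>2) * ?e - r\<^sup>2 * ?k ^ 3 * ?e') / (?e * ?e)"
  have "((\<lambda>r. r\<^sup>2 * ellipse_inv_speed 1 r ^ 3 / ellipse_perim 1 r) has_real_derivative ?D) (at r)"
    using perim_pos by (auto intro!: derivative_eq_intros e' k')
  moreover have "?D > 0"
  proof -
    have "?D = r * ?k\<^sup>2 / (?e\<^sup>2 * (1 - r\<^sup>2)) * (2 * (1 + r\<^sup>2) * ?k * ?e - (3 * ?e\<^sup>2 + r\<^sup>2 * ?k\<^sup>2))"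
  proof -
    have "(1 - r\<^sup>2) \<noteq> 0" "r \<noteq> 0" "?e \<noteq> 0" using r2 assms perim_pos by auto
    then show ?thesis by (simp add: divide_simps) algebra
  qed
    also have "\<dots> > 0"
      using elliptic_quadratic_neg[OF inv_speed_int_pos assms] perim_ge perim_le r2 assms perim_pos inv_speed_int_pos
      by (intro mult_pos_pos divide_pos_pos) auto
    finally show ?thesis .
  qed
  ultimately show ?thesis by blast
qed

text \<open>The formula for the derivative has \<open>1 - r\<^sup>2\<close> in a denominator;
  positivity in the open interval together with continuity at its ends still reaches the circle
  \<open>s = 1\<close>.\<close>

lemma elliptic_invariant_strict_mono:
  assumes "0 < r" "r < s" "s \<le> 1"
  shows "r\<^sup>2 * ellipse_inv_speed 1 r ^ 3 / ellipse_perim 1 r < s\<^sup>2 * ellipse_inv_speed 1 s ^ 3 / ellipse_perim 1 s"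
proof (rule DERIV_pos_imp_increasing_open[OF assms(2)])
  show "continuous_on {r..s} (\<lambda>r. r\<^sup>2 * ellipse_inv_speed 1 r ^ 3 / ellipse_perim 1 r)"
  proof -
    have "isCont (ellipse_inv_speed 1) x" "isCont (ellipse_perim 1) x" "ellipse_perim 1 x \<noteq> 0"
      if "x \<in> {r..s}" for x
    proof -
      have x: "0 < x" "x \<le> 1" using that assms by auto
      then interpret ellipse_axes 1 x by unfold_locales
      show "isCont (ellipse_inv_speed 1) x" "isCont (ellipse_perim 1) x"
        by (rule DERIV_isCont[OF ellipse_inv_speed_deriv[OF x(1)]] DERIV_isCont[OF ellipse_perim_deriv[OF x(1)]])+
      show "perim \<noteq> 0" using perim_pos by simp
    qed
    then show ?thesis
      by (intro continuous_intros continuous_at_imp_continuous_on ballI) auto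
  qed
qed (use assms elliptic_invariant_deriv_pos in auto)

lemma (in ellipse_axes) speed_scale: "speed t = a * ellipse_speed 1 (b / a) t"
proof -
  have "a\<^sup>2 * (sin t)\<^sup>2 + b\<^sup>2 * (cos t)\<^sup>2 = a\<^sup>2 * ((sin t)\<^sup>2 + (b / a)\<^sup>2 * (cos t)\<^sup>2)"
    using a_pos by (simp add: field_simps)
  then show ?thesis using a_pos unfolding ellipse_speed_def by (simp add: real_sqrt_mult)
qed

lemma (in ellipse_axes) elliptic_scale:
  "perim = a * ellipse_perim 1 (b / a)" "inv_speed_int = ellipse_inv_speed 1 (b / a) / a"
proof -
  have "integral {0..2*pi} (\<lambda>t. a * ellipse_speed 1 (b / a) t) = a * ellipse_perim 1 (b / a)"
    by (simp add: ellipse_perim_def)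
  then show "perim = a * ellipse_perim 1 (b / a)" by (simp add: ellipse_perim_def speed_scale[abs_def])
  have "integral {0..2*pi} (\<lambda>t. 1 / a * (1 / ellipse_speed 1 (b / a) t)) = 1 / a * ellipse_inv_speed 1 (b / a)"
    unfolding ellipse_inv_speed_def integral_mult_right ..
  then show "inv_speed_int = ellipse_inv_speed 1 (b / a) / a" by (simp add: ellipse_inv_speed_def speed_scale[abs_def])
qed

text \<open>Both given quantities scale like a length. Their quotient yields the aspect ratio, and
  the perimeter then yields the size.\<close>

lemma ellipse_determined:
  assumes "ellipse_axes a1 b1" "ellipse_axes a2 b2"
    and p: "ellipse_perim a1 b1 = ellipse_perim a2 b2"
    and k: "(a1 * b1)\<^sup>2 * ellipse_inv_speed a1 b1 ^ 3 = (a2 * b2)\<^sup>2 * ellipse_inv_speed a2 b2 ^ 3"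
  shows "a1 = a2 \<and> b1 = b2"
proof -
  interpret e1: ellipse_axes a1 b1 by fact
  interpret e2: ellipse_axes a2 b2 by fact
  note pos = e1.a_pos e2.a_pos e1.b_pos e2.b_pos
  define r1 r2 where "r1 = b1 / a1" and "r2 = b2 / a2"
  have r: "0 < r1" "r1 \<le> 1" "0 < r2" "r2 \<le> 1"
    using pos e1.b_le_a e2.b_le_a by (auto simp: r1_def r2_def)
  have b: "b1 = r1 * a1" "b2 = r2 * a2" using pos by (auto simp: r1_def r2_def)
  have ep: "0 < ellipse_perim 1 r1" "0 < ellipse_perim 1 r2"
    using r ellipse_axes.perim_pos[of 1 r1] ellipse_axes.perim_pos[of 1 r2] by (auto simp: ellipse_axes_def)
  have s: "a1 * ellipse_perim 1 r1 = a2 * ellipse_perim 1 r2" using p by (simp add: e1.elliptic_scale e2.elliptic_scale r1_def r2_def)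
  have "a1 * (r1\<^sup>2 * ellipse_inv_speed 1 r1 ^ 3) = a2 * (r2\<^sup>2 * ellipse_inv_speed 1 r2 ^ 3)"
    using k pos unfolding e1.elliptic_scale e2.elliptic_scale r1_def[symmetric] r2_def[symmetric]
    by (simp add: b power_divide power_mult_distrib power2_eq_square power3_eq_cube mult_ac)
  then have "(a1 * (r1\<^sup>2 * ellipse_inv_speed 1 r1 ^ 3)) / (a1 * ellipse_perim 1 r1) = (a2 * (r2\<^sup>2 * ellipse_inv_speed 1 r2 ^ 3)) / (a2 * ellipse_perim 1 r2)"
    using s by simp
  then have "r1\<^sup>2 * ellipse_inv_speed 1 r1 ^ 3 / ellipse_perim 1 r1 = r2\<^sup>2 * ellipse_inv_speed 1 r2 ^ 3 / ellipse_perim 1 r2" using pos by simp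
  then have "r1 = r2"
    using elliptic_invariant_strict_mono[of r1 r2] elliptic_invariant_strict_mono[of r2 r1] r
    by (cases r1 r2 rule: linorder_cases) auto
  moreover from this have "a1 = a2" using s ep by simp
  ultimately show ?thesis using b by simp
qed

subsection \<open>Expansion at small caustic parameter\<close>

text \<open>By the intermediate value theorem the values of \<open>om\<close> on a short interval
  cover a right neighbourhood of 0. This replaces an inverse function of \<open>om\<close>.\<close>

lemma tendsto_at_right_reparametrize:
  fixes om :: "real \<Rightarrow> real"
  assumes "0 < d" "continuous_on {0..d} om" "om 0 = 0" "\<And>l. 0 < l \<Longrightarrow> l \<le> d \<Longrightarrow> 0 < om l"
    and lim: "((\<lambda>l. H (om l)) \<longlongrightarrow> (L :: real)) (at_right 0)"
  shows "(H \<longlongrightarrow> L) (at_right 0)"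
proof (rule tendstoI)
  fix e :: real assume "0 < e"
  obtain d0 where d0: "0 < d0" "\<And>l. 0 < l \<Longrightarrow> l < d0 \<Longrightarrow> dist (H (om l)) L < e"
    using tendstoD[OF lim \<open>0 < e\<close>] by (auto simp: eventually_at_right[of 0 1])
  define d1 where "d1 = min d (d0 / 2)"
  have d1: "0 < d1" "d1 \<le> d" "d1 < d0" using assms(1) d0 by (auto simp: d1_def)
  have "dist (H x) L < e" if "0 < x" "x < om d1" for x
  proof -
    have "continuous_on {0..d1} om" using assms(2) d1 by (auto intro: continuous_on_subset)
    then have "\<exists>l\<ge>0. l \<le> d1 \<and> om l = x"
      using IVT'[of om 0 x d1] assms(3) that d1 by auto
    then obtain l where "0 \<le> l" "l \<le> d1" "om l = x" by blast
    then show ?thesis using d0(2)[of l] d1 that assms(3) by (cases "l = 0") auto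
  qed
  then show "\<forall>\<^sub>F x in at_right 0. dist (H x) L < e"
    using assms(4)[OF d1(1,2)] by (auto simp: eventually_at_right[of 0 1])
qed

context ellipse_axes
begin

text \<open>Under the substitution sin t = l x / a, \<open>vertex_num\<close> is the squared speed
  minus \<open>l\<^sup>2\<close>, and \<open>vertex_den\<close> is the squared cosine.\<close>

definition vertex_num :: "real \<Rightarrow> real \<Rightarrow> real" where
  "vertex_num l x = b\<^sup>2 - l\<^sup>2 + (a\<^sup>2 - b\<^sup>2) * l\<^sup>2 * x\<^sup>2 / a\<^sup>2"

definition vertex_den :: "real \<Rightarrow> real \<Rightarrow> real" where
  "vertex_den l x = 1 - l\<^sup>2 * x\<^sup>2 / a\<^sup>2"

text \<open>Here begin integral forms of the constants of \<open>ellipse_caustic\<close>. Unlike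
  those constants, they make sense at \<open>l = 0\<close> and are continuous there.\<close>

definition P_int :: "real \<Rightarrow> real" where
  "P_int l = integral {0..2 * pi} (\<lambda>t. 1 / sqrt ((speed t)\<^sup>2 - l\<^sup>2))"

definition C_int :: "real \<Rightarrow> real" where
  "C_int l = integral {0..2 * pi} (\<lambda>t. sqrt ((speed t)\<^sup>2 - l\<^sup>2))"

text \<open>The difference of perimeter and \<open>C_int l\<close>, divided by
  \<open>l\<^sup>2\<close> and rationalized so that \<open>l = 0\<close> is no longer
  singular.\<close>

definition E_int :: "real \<Rightarrow> real" where
  "E_int l = integral {0..2 * pi} (\<lambda>t. 1 / (speed t + sqrt ((speed t)\<^sup>2 - l\<^sup>2)))"

definition rho_int :: "real \<Rightarrow> real" where
  "rho_int l = integral {-1..1} (\<lambda>x. 1 / (sqrt (vertex_num l x) * sqrt (vertex_den l x)))"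

text \<open>Rationalized form of the difference of
  \<open>sqrt (vertex_num l x / vertex_den l x)\<close> and \<open>b\<close>, the factor
  \<open>l\<^sup>2\<close> having been taken out.\<close>

definition M_int :: "real \<Rightarrow> real" where
  "M_int l = integral {-1..1} (\<lambda>x. (x\<^sup>2 - 1) / (vertex_den l x * (sqrt (vertex_num l x / vertex_den l x) + b)))"

definition omega :: "real \<Rightarrow> real" where
  "omega l = l * rho_int l / (a * P_int l)"

definition beta_val :: "real \<Rightarrow> real" where
  "beta_val l = - C_int l * omega l + l ^ 3 / a * M_int l"

lemma speed_sq_gt: "0 \<le> l \<Longrightarrow> l < b \<Longrightarrow> l\<^sup>2 < (speed t)\<^sup>2"
  using speed_bounds(1)[of t] by (intro power_strict_mono) auto

lemma sqrt_speed_neq_0: "0 \<le> l \<Longrightarrow> l < b \<Longrightarrow> sqrt ((speed t)\<^sup>2 - l\<^sup>2) \<noteq> 0"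
  using speed_sq_gt[of l t] by simp

lemma vertex_num_pos: "0 \<le> l \<Longrightarrow> l < b \<Longrightarrow> 0 < vertex_num l x"
proof -
  assume l: "0 \<le> l" "l < b"
  have "0 \<le> a\<^sup>2 - b\<^sup>2" "l\<^sup>2 < b\<^sup>2" using l b_le_a b_pos by (auto intro: power_mono power_strict_mono)
  then show ?thesis unfolding vertex_num_def by (smt (verit) mult_nonneg_nonneg zero_le_divide_iff zero_le_power2)
qed

lemma vertex_den_pos: "0 \<le> l \<Longrightarrow> l < b \<Longrightarrow> x \<in> {-1..1} \<Longrightarrow> 0 < vertex_den l x"
proof -
  assume l: "0 \<le> l" "l < b" "x \<in> {-1..1}"
  have "x\<^sup>2 \<le> 1" using l by (simp add: abs_square_le_1 abs_le_iff)
  then have "l\<^sup>2 * x\<^sup>2 \<le> l\<^sup>2" by (simp add: mult_left_le)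
  also have "l\<^sup>2 < a\<^sup>2" using l b_le_a by (intro power_strict_mono) auto
  finally show ?thesis using a_pos by (simp add: vertex_den_def)
qed

lemma vertex_num_cont [continuous_intros]: "continuous_on A (\<lambda>z. vertex_num (fst z) (snd z))"
  unfolding vertex_num_def using a_pos by (intro continuous_intros) auto
lemma vertex_den_cont [continuous_intros]: "continuous_on A (\<lambda>z. vertex_den (fst z) (snd z))"
  unfolding vertex_den_def using a_pos by (intro continuous_intros) auto

lemma P_int_cont: "continuous_on {0..<b} P_int"
proof -
  have "continuous_on {0..<b} (\<lambda>l. integral (cbox 0 (2 * pi)) (\<lambda>t. 1 / sqrt ((speed t)\<^sup>2 - l\<^sup>2)))"
    by (rule integral_continuous_on_param, unfold split_beta, intro continuous_intros)
       (use sqrt_speed_neq_0 in force)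
  then show ?thesis by (simp add: P_int_def[abs_def])
qed

lemma E_int_cont: "continuous_on {0..<b} E_int"
proof -
  have "0 < speed t + sqrt ((speed t)\<^sup>2 - l\<^sup>2)" if "l \<in> {0..<b}" for l t
    using speed_bounds(1)[of t] speed_pos[of t] that by (intro add_pos_nonneg) auto
  then have *: "speed t + sqrt ((speed t)\<^sup>2 - l\<^sup>2) \<noteq> 0" if "l \<in> {0..<b}" for l t
    using that less_numeral_extra(3) by metis
  have "continuous_on {0..<b} (\<lambda>l. integral (cbox 0 (2 * pi)) (\<lambda>t. 1 / (speed t + sqrt ((speed t)\<^sup>2 - l\<^sup>2))))"
    by (rule integral_continuous_on_param, unfold split_beta, intro continuous_intros) (use * in force)
  then show ?thesis by (simp add: E_int_def[abs_def])
qed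

lemma rho_int_cont: "continuous_on {0..<b} rho_int"
proof -
  have *: "sqrt (vertex_num l x) * sqrt (vertex_den l x) \<noteq> 0" if "l \<in> {0..<b}" "x \<in> cbox (-1) 1" for l x
    using vertex_num_pos[of l x] vertex_den_pos[of l x] that by simp
  have "continuous_on {0..<b} (\<lambda>l. integral (cbox (-1) 1) (\<lambda>x. 1 / (sqrt (vertex_num l x) * sqrt (vertex_den l x))))"
    by (rule integral_continuous_on_param, unfold split_beta, intro continuous_intros) (use * in force)
  then show ?thesis by (simp add: rho_int_def[abs_def])
qed

lemma M_int_cont: "continuous_on {0..<b} M_int"
proof -
  have *: "vertex_den l x * (sqrt (vertex_num l x / vertex_den l x) + b) \<noteq> 0" "vertex_den l x \<noteq> 0" if "l \<in> {0..<b}" "x \<in> cbox (-1) 1" for l x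
  proof -
    have "0 < sqrt (vertex_num l x / vertex_den l x) + b"
      using vertex_num_pos[of l x] vertex_den_pos[of l x] that b_pos by (intro add_nonneg_pos) auto
    then show "vertex_den l x * (sqrt (vertex_num l x / vertex_den l x) + b) \<noteq> 0" "vertex_den l x \<noteq> 0" using vertex_den_pos[of l x] that by auto
  qed
  have "continuous_on {0..<b} (\<lambda>l. integral (cbox (-1) 1) (\<lambda>x. (x\<^sup>2 - 1) / (vertex_den l x * (sqrt (vertex_num l x / vertex_den l x) + b))))"
    by (rule integral_continuous_on_param, unfold split_beta, intro continuous_intros) (use * in force)+
  then show ?thesis by (simp add: M_int_def[abs_def])
qed

lemma P_int_0: "P_int 0 = inv_speed_int"
  using speed_pos by (simp add: P_int_def ellipse_inv_speed_def less_imp_le)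

lemma E_int_0: "E_int 0 = inv_speed_int / 2"
proof -
  have "1 / (speed t + sqrt ((speed t)\<^sup>2 - 0\<^sup>2)) = 1 / 2 * (1 / speed t)" for t
    using speed_pos[of t] by simp
  then have "E_int 0 = integral {0..2 * pi} (\<lambda>t. 1 / 2 * (1 / speed t))" by (simp add: E_int_def)
  then show ?thesis unfolding integral_mult_right by (simp add: ellipse_inv_speed_def)
qed

lemma rho_int_0: "rho_int 0 = 2 / b"
  using b_pos by (simp add: rho_int_def vertex_num_def vertex_den_def)

lemma M_int_0: "M_int 0 = - 2 / (3 * b)"
proof -
  have "((\<lambda>x::real. (x\<^sup>2 - 1) / (2 * b)) has_integral
     ((1 ^ 3 / 3 - 1) / (2 * b) - ((-1) ^ 3 / 3 - (-1)) / (2 * b))) {-1..1}"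
    by (rule fundamental_theorem_of_calculus)
       (use b_pos in \<open>auto intro!: derivative_eq_intros simp: has_real_derivative_iff_has_vector_derivative[symmetric] field_simps\<close>)
  moreover have "(x\<^sup>2 - 1) / (vertex_den 0 x * (sqrt (vertex_num 0 x / vertex_den 0 x) + b)) = (x\<^sup>2 - 1) / (2 * b)" for x
    using b_pos by (simp add: vertex_num_def vertex_den_def)
  ultimately have "M_int 0 = (1 ^ 3 / 3 - 1) / (2 * b) - ((-1) ^ 3 / 3 - (-1)) / (2 * b)"
    unfolding M_int_def by (simp only: integral_unique)
  then show ?thesis using b_pos by (simp add: field_simps)
qed

lemma P_int_pos:
  assumes "0 \<le> l" "l < b"
  shows "0 < P_int l"
proof -
  have *: "(\<lambda>t. 1 / sqrt ((speed t)\<^sup>2 - l\<^sup>2)) integrable_on {0..2 * pi}"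
    by (intro integrable_continuous_interval continuous_intros) (use sqrt_speed_neq_0[OF assms] in blast)
  have "1 / a \<le> 1 / sqrt ((speed t)\<^sup>2 - l\<^sup>2)" for t
  proof (intro divide_left_mono)
    show "sqrt ((speed t)\<^sup>2 - l\<^sup>2) \<le> a"
    proof (rule real_le_lsqrt)
      have "(speed t)\<^sup>2 \<le> a\<^sup>2" using speed_bounds(2)[of t] speed_pos[of t] by (intro power_mono) auto
      then show "(speed t)\<^sup>2 - l\<^sup>2 \<le> a\<^sup>2" by (smt (verit) zero_le_power2)
    qed (use a_pos in simp)
    show "0 < a * sqrt ((speed t)\<^sup>2 - l\<^sup>2)" using a_pos speed_sq_gt[OF assms, of t] by simp
  qed simp
  then have "integral {0..2 * pi} (\<lambda>t. 1 / a) \<le> P_int l"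
    unfolding P_int_def by (intro integral_le *) auto
  moreover have "0 < integral {0..2 * pi} (\<lambda>t. 1 / a)" using a_pos by simp
  ultimately show ?thesis by linarith
qed

lemma perim_minus_C_int:
  assumes "0 \<le> l" "l < b"
  shows "perim - C_int l = l\<^sup>2 * E_int l"
proof -
  have i: "(\<lambda>t. sqrt ((speed t)\<^sup>2 - l\<^sup>2)) integrable_on {0..2 * pi}"
    by (intro integrable_continuous_interval continuous_intros)
  have "perim - C_int l = integral {0..2 * pi} (\<lambda>t. speed t - sqrt ((speed t)\<^sup>2 - l\<^sup>2))"
    unfolding ellipse_perim_def C_int_def
    by (rule integral_diff[symmetric, OF _ i]) (use perim_has_integral in blast)
  also have "(\<lambda>t. speed t - sqrt ((speed t)\<^sup>2 - l\<^sup>2)) = (\<lambda>t. l\<^sup>2 * (1 / (speed t + sqrt ((speed t)\<^sup>2 - l\<^sup>2))))"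
  proof
    fix t
    define q where "q = sqrt ((speed t)\<^sup>2 - l\<^sup>2)"
    have q: "q\<^sup>2 = (speed t)\<^sup>2 - l\<^sup>2" "0 \<le> q" using speed_sq_gt[OF assms, of t] by (auto simp: q_def)
    have "speed t + q \<noteq> 0" using q speed_pos[of t] by linarith
    moreover have "(speed t - q) * (speed t + q) = l\<^sup>2" using q by (simp add: power2_eq_square algebra_simps)
    ultimately show "speed t - sqrt ((speed t)\<^sup>2 - l\<^sup>2) = l\<^sup>2 * (1 / (speed t + sqrt ((speed t)\<^sup>2 - l\<^sup>2)))"
      unfolding q_def[symmetric] by (simp add: field_simps)
  qed
  finally show ?thesis unfolding integral_mult_right E_int_def .
qed

lemma omega_cont: "continuous_on {0..<b} omega"
  unfolding omega_def[abs_def]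
  using P_int_pos a_pos by (intro continuous_intros rho_int_cont P_int_cont) force

text \<open>Write \<open>omega l\<close> as \<open>l\<close> times a continuous function with
  positive value at 0. Both terms of \<open>H (omega l) + perim * omega l\<close> then contain
  \<open>l ^ 3\<close>, which cancels against \<open>omega l ^ 3\<close>.\<close>

lemma beta_asymptotics:
  assumes H: "\<And>l. 0 < l \<Longrightarrow> l < b \<Longrightarrow> 0 < omega l \<and> H (omega l) = beta_val l"
  shows "((\<lambda>w. (H w + perim * w) / w ^ 3) \<longlongrightarrow> (a * b)\<^sup>2 * inv_speed_int ^ 3 / 24) (at_right 0)"
proof (rule tendsto_at_right_reparametrize[where d = "b / 2" and om = omega])
  show "0 < b / 2" using b_pos by simp
  show "continuous_on {0..b / 2} omega"
    by (rule continuous_on_subset[OF omega_cont]) (use b_pos in auto)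
  show "omega 0 = 0" by (simp add: omega_def)
  show "0 < omega l" if "0 < l" "l \<le> b / 2" for l using H[of l] that b_pos by auto
  let ?q = "\<lambda>l. rho_int l / (a * P_int l)"
  have ev: "\<forall>\<^sub>F l in at_right 0. 0 < l \<and> l < b"
    using b_pos by (auto simp: eventually_at_right[of 0 1])
  have lim: "(f \<longlongrightarrow> f 0) (at_right 0)" if "continuous_on {0..<b} f" for f :: "real \<Rightarrow> real"
  proof -
    have "(f \<longlongrightarrow> f 0) (at 0 within {0..<b})" using that b_pos by (simp add: continuous_on_def)
    moreover have "at_right 0 \<le> at 0 within {0..<b}"
      using ev by (auto simp: at_within_def le_inf_iff le_principal eventually_inf_principal) 
    ultimately show ?thesis by (rule tendsto_mono[rotated])
  qed
  have L: "((\<lambda>l. (E_int l * ?q l + M_int l / a) / ?q l ^ 3) \<longlongrightarrow>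
      (E_int 0 * ?q 0 + M_int 0 / a) / ?q 0 ^ 3) (at_right 0)"
    using a_pos P_int_pos[of 0] b_pos rho_int_0
    by (intro tendsto_intros lim E_int_cont M_int_cont rho_int_cont P_int_cont) auto
  \<comment> \<open>With K the integral of 1 / f, the numerator is 1 / (a b) - 2 / (3 a b) = 1 / (3
    a b) and the denominator is 8 / (a b K)^3. This is the origin of 24.\<close>
  have v: "(E_int 0 * ?q 0 + M_int 0 / a) / ?q 0 ^ 3 = (a * b)\<^sup>2 * inv_speed_int ^ 3 / 24"
    unfolding E_int_0 M_int_0 rho_int_0 P_int_0 using a_pos b_pos inv_speed_int_pos
    by (simp add: field_simps power2_eq_square power3_eq_cube)
  have "\<forall>\<^sub>F l in at_right 0. (E_int l * ?q l + M_int l / a) / ?q l ^ 3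
      = (H (omega l) + perim * omega l) / omega l ^ 3"
    using ev
  proof eventually_elim
    case (elim l)
    have om: "omega l = l * ?q l" by (simp add: omega_def)
    have cancel: "l ^ 3 * z / (l * y) ^ 3 = z / y ^ 3" for y z
      using elim by (simp add: power_mult_distrib)
    have "H (omega l) + perim * omega l = (perim - C_int l) * omega l + l ^ 3 / a * M_int l"
      using H[of l] elim by (simp add: beta_val_def algebra_simps)
    also have "\<dots> = l ^ 3 * (E_int l * ?q l + M_int l / a)"
      using elim by (simp add: perim_minus_C_int om power2_eq_square power3_eq_cube algebra_simps)
    finally show ?case unfolding om by (simp only: cancel)
  qed
  from Lim_transform_eventually[OF L this]
  show "((\<lambda>l. (H (omega l) + perim * omega l) / omega l ^ 3) \<longlongrightarrow> (a * b)\<^sup>2 * inv_speed_int ^ 3 / 24) (at_right 0)"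
    unfolding v .
qed

text \<open>Every small positive number is the rotation number of a confocal caustic, so an
  expansion along caustic rotation numbers is a genuine one-sided expansion.\<close>

lemma omega_range:
  assumes "\<And>l. 0 < l \<Longrightarrow> l < b \<Longrightarrow> 0 < omega l"
  shows "\<forall>\<^sub>F w in at_right 0. \<exists>l. 0 < l \<and> l < b \<and> w = omega l"
proof -
  have "\<exists>l. 0 < l \<and> l < b \<and> w = omega l" if "0 < w" "w < omega (b / 2)" for w
  proof -
    have "continuous_on {0..b / 2} omega"
      by (rule continuous_on_subset[OF omega_cont]) (use b_pos in auto)
    moreover have "omega 0 = 0" by (simp add: omega_def)
    ultimately have "\<exists>l\<ge>0. l \<le> b / 2 \<and> omega l = w"
      using IVT'[of omega 0 w "b / 2"] that b_pos by auto
    then obtain l where "0 \<le> l" "l \<le> b / 2" "omega l = w" by blast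
    then have "0 < l" "l < b" "w = omega l"
      using that b_pos \<open>omega 0 = 0\<close> by (cases "l = 0"; auto)+
    then show ?thesis by blast
  qed
  then show ?thesis using assms[of "b / 2"] b_pos by (auto simp: eventually_at_right[of 0 1])
qed

end

section \<open>The constants of the caustic as integrals over fixed intervals\<close>

context ellipse_caustic
begin

lemma C_eq: "C = C_int lam"
proof -
  have "(w has_integral (G (2 * pi) - G 0)) {0..2 * pi}"
    by (rule fundamental_theorem_of_calculus)
       (auto simp: has_real_derivative_iff_has_vector_derivative[symmetric] intro!: has_field_derivative_at_within G_deriv)
  then show ?thesis unfolding C_def C_int_def w_def by (simp add: integral_unique)
qed

lemma P_eq: "P = P_int lam"
proof -
  have "((\<lambda>t. 1 / w t) has_integral (U (2 * pi) - U 0)) {0..2 * pi}"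
    by (rule fundamental_theorem_of_calculus)
       (auto simp: has_real_derivative_iff_has_vector_derivative[symmetric] intro!: has_field_derivative_at_within U_deriv)
  then show ?thesis unfolding P_def P_int_def w_def by (simp add: integral_unique)
qed

text \<open>Integrals over the chord tangent at the vertex of the caustic, in the variable \<open>x\<close> with
  \<open>sin t = lam / a * x\<close>.\<close>

lemma vertex_substitution:
  assumes F: "\<And>t. (F has_real_derivative g t) (at t)"
  shows "((\<lambda>x. lam / a / sqrt (vertex_den lam x) * g (arcsin (lam / a * x))) has_integral (F (d0 0) - F (- d0 0))) {-1..1}"
proof -
  have la: "lam / a < 1" "0 < lam / a" using lam_pos lam_less_b b_le_a by auto
  have bd: "-1 < lam / a * x" "lam / a * x < 1" if "x \<in> {-1..1}" for x
  proof -
    have "\<bar>lam / a * x\<bar> \<le> lam / a * 1"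
      using that la unfolding abs_mult by (intro mult_mono) auto
    then show "-1 < lam / a * x" "lam / a * x < 1" using la by linarith+
  qed
  have "((\<lambda>x. F (arcsin (lam / a * x))) has_real_derivative lam / a / sqrt (vertex_den lam x) * g (arcsin (lam / a * x))) (at x within {-1..1})"
    if "x \<in> {-1..1}" for x
  proof -
    have "vertex_den lam x = 1 - (lam / a * x)\<^sup>2" by (simp add: vertex_den_def power_mult_distrib power_divide)
    then have "(arcsin has_real_derivative inverse (sqrt (vertex_den lam x))) (at (lam / a * x))"
      using DERIV_arcsin[OF bd[OF that]] by simp
    moreover have "((\<lambda>x. lam / a * x) has_real_derivative lam / a) (at x within {-1..1})"
      using DERIV_cmult_Id[of "lam / a"] by (rule has_field_derivative_at_within)
    ultimately have "((\<lambda>x. arcsin (lam / a * x)) has_real_derivative inverse (sqrt (vertex_den lam x)) * (lam / a)) (at x within {-1..1})"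
      by (rule DERIV_chain2)
    from DERIV_chain2[OF F this] show ?thesis by (simp only: divide_inverse mult_ac)
  qed
  then have "((\<lambda>x. lam / a / sqrt (vertex_den lam x) * g (arcsin (lam / a * x))) has_integral
      (F (arcsin (lam / a * 1)) - F (arcsin (lam / a * (- 1))))) {-1..1}"
    by (intro fundamental_theorem_of_calculus) (auto simp: has_real_derivative_iff_has_vector_derivative)
  moreover have "d0 0 = arcsin (lam / a)"
    using b_pos by (simp add: d0_def ellipse_speed_def)
  moreover have "arcsin (lam / a * (- 1)) = - arcsin (lam / a)"
    using la by (simp add: arcsin_minus)
  ultimately show ?thesis by simp
qed

lemma w_arcsin:
  assumes "x \<in> {-1..1}"
  shows "w (arcsin (lam / a * x)) = sqrt (vertex_num lam x)"
proof -
  have la: "lam / a < 1" "0 < lam / a" using lam_pos lam_less_b b_le_a by auto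
  have "\<bar>lam / a * x\<bar> \<le> lam / a * 1"
    using assms la unfolding abs_mult by (intro mult_mono) auto
  then have "-1 \<le> lam / a * x" "lam / a * x \<le> 1" using la by linarith+
  then have s: "sin (arcsin (lam / a * x)) = lam / a * x" by (rule sin_arcsin)
  show ?thesis unfolding w_def speed_sq cos_squared_eq s vertex_num_def
    using a_pos by (simp add: field_simps)
qed

lemma rho_eq: "rho = lam / a * rho_int lam"
proof -
  have "((\<lambda>x. lam / a / sqrt (vertex_den lam x) * (1 / w (arcsin (lam / a * x)))) has_integral rho) {-1..1}"
    unfolding rho_def by (rule vertex_substitution[OF U_deriv])
  then have "((\<lambda>x. lam / a * (1 / (sqrt (vertex_num lam x) * sqrt (vertex_den lam x)))) has_integral rho) {-1..1}"
    by (rule has_integral_eq[rotated]) (simp only: w_arcsin, simp add: mult.commute)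
  from integral_unique[OF this] show ?thesis unfolding integral_mult_right rho_int_def by simp
qed

lemma M_eq: "M = lam ^ 3 / a * M_int lam"
proof -
  have i: "((\<lambda>x. lam / a / sqrt (vertex_den lam x) * w (arcsin (lam / a * x))) has_integral (G (d0 0) - G (- d0 0))) {-1..1}"
    by (rule vertex_substitution[OF G_deriv])
  \<comment> \<open>The chord at \<open>x = 0\<close> has length \<open>2 * (lam / a * b)\<close>;
    written as an integral over the same interval, it can be subtracted under the integral
    sign.\<close>
  have c: "((\<lambda>x::real. lam / a * b) has_integral (2 * (lam / a * b))) {-1..1}"
    using has_integral_const_real[of "lam / a * b" "-1" 1] by simp
  have M: "M = G (d0 0) - G (- d0 0) - 2 * (lam / a * b)"
    unfolding M_def Phi_def sin_d0 using a_pos b_pos by (simp add: ellipse_speed_def)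
  have "((\<lambda>x. lam ^ 3 / a * ((x\<^sup>2 - 1) / (vertex_den lam x * (sqrt (vertex_num lam x / vertex_den lam x) + b)))) has_integral M) {-1..1}"
    unfolding M
  proof (rule has_integral_eq[OF _ has_integral_diff[OF i c]])
    fix x :: real assume x: "x \<in> {-1..1}"
    define N D q where "N = vertex_num lam x" and "D = vertex_den lam x" and "q = sqrt (N / D)"
    have pos: "0 < N" "0 < D" unfolding N_def D_def using vertex_num_pos[of lam x] vertex_den_pos[of lam x] x lam_pos lam_less_b by auto
    have q: "q\<^sup>2 = N / D" "0 \<le> q" using pos by (auto simp: q_def)
    \<comment> \<open>This cancellation supplies \<open>lam\<^sup>2\<close>, which joins the factor
      \<open>lam\<close> of the substitution to give the order \<open>lam ^ 3\<close>.\<close>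
    have "N - b\<^sup>2 * D = lam\<^sup>2 * (x\<^sup>2 - 1)"
      using a_pos unfolding N_def D_def vertex_num_def vertex_den_def by (simp add: field_simps)
    then have "D * (q\<^sup>2 - b\<^sup>2) = lam\<^sup>2 * (x\<^sup>2 - 1)" using q pos by (simp add: field_simps)
    then have "D * (q + b) * (q - b) = lam\<^sup>2 * (x\<^sup>2 - 1)" by (simp add: power2_eq_square algebra_simps)
    moreover have "D * (q + b) \<noteq> 0" using pos q b_pos by auto
    ultimately have "q - b = lam\<^sup>2 * (x\<^sup>2 - 1) / (D * (q + b))" by (simp add: field_simps)
    moreover have "lam / a / sqrt D * sqrt N - lam / a * b = lam / a * (q - b)"
      by (simp add: q_def real_sqrt_divide algebra_simps)
    ultimately have "lam / a / sqrt D * sqrt N - lam / a * b = lam / a * (lam\<^sup>2 * (x\<^sup>2 - 1) / (D * (q + b)))"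
      by simp
    also have "\<dots> = lam ^ 3 / a * ((x\<^sup>2 - 1) / (D * (q + b)))"
      by (simp add: power2_eq_square power3_eq_cube)
    finally show "lam / a / sqrt (vertex_den lam x) * w (arcsin (lam / a * x)) - lam / a * b =
       lam ^ 3 / a * ((x\<^sup>2 - 1) / (vertex_den lam x * (sqrt (vertex_num lam x / vertex_den lam x) + b)))"
      unfolding w_arcsin[OF x] N_def D_def q_def .
  qed
  from integral_unique[OF this] show ?thesis unfolding integral_mult_right M_int_def by simp
qed

lemma omega_eq: "omega lam = rho / P"
  by (simp add: omega_def rho_eq P_eq)

lemma beta_val_eq: "beta_val lam = - C * (rho / P) + M"
  by (simp add: beta_val_def omega_eq C_eq M_eq)

lemma omega_pos: "0 < omega lam"
  unfolding omega_eq using rho_pos rho_less_P by simp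

end

subsection \<open>Ellipses in the plane\<close>

text \<open>The second axis is \<open>u\<close> turned by a positive right angle, so the frame is
  positively oriented and \<open>cross2\<close> is the coordinate determinant.\<close>

definition frame_vec :: "real^2 \<Rightarrow> real \<Rightarrow> real \<Rightarrow> real^2" where
  "frame_vec u x y = x *\<^sub>R u + y *\<^sub>R vector [- u $ 2, u $ 1]"

definition ellipse_point :: "real^2 \<Rightarrow> real^2 \<Rightarrow> real \<Rightarrow> real \<Rightarrow> real \<Rightarrow> real^2" where
  "ellipse_point c u A B t = c + frame_vec u (A * cos t) (B * sin t)"

lemma frame_vec_simps:
  "frame_vec u x y + frame_vec u x' y' = frame_vec u (x + x') (y + y')"
  "frame_vec u x y - frame_vec u x' y' = frame_vec u (x - x') (y - y')"
  "- frame_vec u x y = frame_vec u (- x) (- y)"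
  "k *\<^sub>R frame_vec u x y = frame_vec u (k * x) (k * y)"
  by (simp_all add: frame_vec_def algebra_simps)

lemma norm_sq_2: "(norm (u :: real^2))\<^sup>2 = (u $ 1)\<^sup>2 + (u $ 2)\<^sup>2"
  unfolding power2_norm_eq_inner inner_vec_def sum_2 by (simp add: power2_eq_square)

lemma frame_vec_nth:
  "frame_vec u x y $ 1 = x * u $ 1 - y * u $ 2" "frame_vec u x y $ 2 = x * u $ 2 + y * u $ 1"
  by (simp_all add: frame_vec_def)

lemma frame_vec_inner:
  assumes "norm u = 1"
  shows "frame_vec u x y \<bullet> frame_vec u x' y' = x * x' + y * y'"
proof -
  have "(u $ 1)\<^sup>2 + (u $ 2)\<^sup>2 = 1" using norm_sq_2[of u] assms by simp
  then show ?thesis unfolding inner_vec_def sum_2 frame_vec_nth inner_real_def by algebra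
qed

lemma frame_vec_cross:
  assumes "norm u = 1"
  shows "cross2 (frame_vec u x y) (frame_vec u x' y') = x * y' - y * x'"
proof -
  have "(u $ 1)\<^sup>2 + (u $ 2)\<^sup>2 = 1" using norm_sq_2[of u] assms by simp
  then show ?thesis unfolding cross2_def frame_vec_nth by algebra
qed

lemma frame_vec_norm: "norm u = 1 \<Longrightarrow> norm (frame_vec u x y) = sqrt (x\<^sup>2 + y\<^sup>2)"
  unfolding norm_eq_sqrt_inner[of "frame_vec u x y"] by (simp add: frame_vec_inner power2_eq_square)

lemma frame_vec_eq_iff:
  assumes "norm u = 1"
  shows "frame_vec u x y = frame_vec u x' y' \<longleftrightarrow> x = x' \<and> y = y'"
proof
  assume "frame_vec u x y = frame_vec u x' y'"
  then have "norm (frame_vec u (x - x') (y - y')) = 0" by (simp add: frame_vec_simps(2)[symmetric])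
  then have "(x - x')\<^sup>2 + (y - y')\<^sup>2 = 0" by (simp add: frame_vec_norm[OF assms])
  then show "x = x' \<and> y = y'" by (simp add: sum_power2_eq_zero_iff)
qed simp

lemma frame_vec_deriv:
  assumes "(f has_real_derivative f') (at t)" "(g has_real_derivative g') (at t)"
  shows "((\<lambda>t. c + frame_vec u (f t) (g t)) has_vector_derivative frame_vec u f' g') (at t)"
  unfolding frame_vec_def using assms
  by (auto intro!: derivative_eq_intros simp: has_real_derivative_iff_has_vector_derivative)

lemma frame_vec_linear: "linear (\<lambda>z :: real^2. frame_vec u (A * z $ 1) (B * z $ 2))"
  by (rule linearI) (simp_all add: frame_vec_simps algebra_simps)

text \<open>The region is an injective affine image of the closed unit disc, which transports
  interior, compactness and convexity.\<close>

lemma ellipse_region: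
  fixes c u :: "real^2" and A B :: real
  assumes u: "norm u = 1" and AB: "0 < A" "0 < B"
  defines "D \<equiv> {c + frame_vec u x y | x y. (x / A)\<^sup>2 + (y / B)\<^sup>2 \<le> 1}"
    and "E \<equiv> {c + frame_vec u x y | x y. (x / A)\<^sup>2 + (y / B)\<^sup>2 = 1}"
  shows "E = frontier D" "E = frontier (convex hull E)"
    "inside E = {c + frame_vec u x y | x y. (x / A)\<^sup>2 + (y / B)\<^sup>2 < 1}"
proof -
  define L where "L = (\<lambda>z :: real^2. frame_vec u (A * z $ 1) (B * z $ 2))"
  have lin: "linear L" unfolding L_def by (rule frame_vec_linear)
  have inj: "inj L"
  proof (rule injI)
    fix z z' assume "L z = L z'"
    then have "A * z $ 1 = A * z' $ 1" "B * z $ 2 = B * z' $ 2"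
      by (simp_all add: L_def frame_vec_eq_iff[OF u])
    then show "z = z'" using AB by (simp add: vec_eq_iff forall_2)
  qed
  have im: "{c + frame_vec u x y | x y. Q ((x / A)\<^sup>2 + (y / B)\<^sup>2)} = (+) c ` (L ` {z. Q ((norm z)\<^sup>2)})" for Q
  proof (intro equalityI subsetI)
    fix p assume "p \<in> {c + frame_vec u x y | x y. Q ((x / A)\<^sup>2 + (y / B)\<^sup>2)}"
    then obtain x y where xy: "p = c + frame_vec u x y" "Q ((x / A)\<^sup>2 + (y / B)\<^sup>2)" by blast
    have "p = c + L (vector [x / A, y / B])" using AB by (simp add: L_def xy)
    moreover have "Q ((norm (vector [x / A, y / B] :: real^2))\<^sup>2)" using xy by (simp add: norm_sq_2)
    ultimately show "p \<in> (+) c ` (L ` {z. Q ((norm z)\<^sup>2)})" by blast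
  next
    fix p assume "p \<in> (+) c ` (L ` {z. Q ((norm z)\<^sup>2)})"
    then obtain z where z: "p = c + L z" "Q ((norm z)\<^sup>2)" by blast
    have "p = c + frame_vec u (A * z $ 1) (B * z $ 2)" using z by (simp add: L_def)
    moreover have "Q ((A * z $ 1 / A)\<^sup>2 + (B * z $ 2 / B)\<^sup>2)" using z AB by (simp add: norm_sq_2)
    ultimately show "p \<in> {c + frame_vec u x y | x y. Q ((x / A)\<^sup>2 + (y / B)\<^sup>2)}" by blast
  qed
  have "{z :: real^2. (norm z)\<^sup>2 \<le> 1} = cball 0 1"
    by (auto simp: power_le_one_iff abs_square_le_1)
  then have D: "D = (+) c ` (L ` cball 0 1)" unfolding D_def using im[of "\<lambda>r. r \<le> 1"] by simp
  have "{z :: real^2. (norm z)\<^sup>2 < 1} = ball 0 1"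
    by (auto simp: power_less_one_iff abs_square_less_1)
  then have I: "{c + frame_vec u x y | x y. (x / A)\<^sup>2 + (y / B)\<^sup>2 < 1} = (+) c ` (L ` ball 0 1)"
    using im[of "\<lambda>r. r < 1"] by simp
  have int: "interior D = {c + frame_vec u x y | x y. (x / A)\<^sup>2 + (y / B)\<^sup>2 < 1}"
    unfolding D I interior_translation interior_injective_linear_image[OF lin inj] by simp
  have comp: "compact D" unfolding D
    by (intro compact_translation compact_continuous_image linear_continuous_on compact_cball)
      (use lin in \<open>simp add: linear_conv_bounded_linear\<close>)
  have conv: "convex D" unfolding D by (intro convex_translation convex_linear_image lin convex_cball)
  show fr: "E = frontier D"
  proof -
    have "frontier D = D - interior D"
      using compact_imp_closed[OF comp] by (simp add: frontier_def)
    also have "\<dots> = E"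
    proof (intro equalityI subsetI)
      fix p assume p: "p \<in> D - interior D"
      then obtain x y where xy: "p = c + frame_vec u x y" "(x / A)\<^sup>2 + (y / B)\<^sup>2 \<le> 1" unfolding D_def by blast
      then have "\<not> (x / A)\<^sup>2 + (y / B)\<^sup>2 < 1" using p unfolding int by blast
      then show "p \<in> E" using xy unfolding E_def by force
    next
      fix p assume p: "p \<in> E"
      then obtain x y where xy: "p = c + frame_vec u x y" "(x / A)\<^sup>2 + (y / B)\<^sup>2 = 1" unfolding E_def by blast
      have "p \<in> D" using xy unfolding D_def by force
      moreover have "p \<notin> interior D" using xy unfolding int by (auto simp: frame_vec_eq_iff[OF u])
      ultimately show "p \<in> D - interior D" by blast
    qed
    finally show ?thesis ..
  qed
  \<comment> \<open>A compact convex set is the convex hull of its frontier.\<close>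
  have "D = convex hull E" using Krein_Milman_frontier[OF conv comp] fr by simp
  then show "E = frontier (convex hull E)" using fr by simp
  show "inside E = {c + frame_vec u x y | x y. (x / A)\<^sup>2 + (y / B)\<^sup>2 < 1}"
    unfolding fr inside_frontier_eq_interior[OF compact_imp_bounded[OF comp] conv] int ..
qed

lemma range_ellipse_point:
  assumes "0 < A" "0 < B"
  shows "range (ellipse_point c u A B) = {c + frame_vec u x y | x y. (x / A)\<^sup>2 + (y / B)\<^sup>2 = 1}"
proof (intro equalityI subsetI)
  fix p assume "p \<in> range (ellipse_point c u A B)"
  then obtain t where "p = c + frame_vec u (A * cos t) (B * sin t)" by (auto simp: ellipse_point_def)
  moreover have "(A * cos t / A)\<^sup>2 + (B * sin t / B)\<^sup>2 = 1" using assms by simp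
  ultimately show "p \<in> {c + frame_vec u x y | x y. (x / A)\<^sup>2 + (y / B)\<^sup>2 = 1}" by blast
next
  fix p assume "p \<in> {c + frame_vec u x y | x y. (x / A)\<^sup>2 + (y / B)\<^sup>2 = 1}"
  then obtain x y where xy: "p = c + frame_vec u x y" "(x / A)\<^sup>2 + (y / B)\<^sup>2 = 1" by blast
  obtain t where "x / A = cos t" "y / B = sin t" using sincos_total_2pi[OF xy(2)] by metis
  then have "x = A * cos t" "y = B * sin t" using assms by (auto simp: field_simps)
  then show "p \<in> range (ellipse_point c u A B)" using xy by (auto simp: ellipse_point_def)
qed

text \<open>\<open>v\<close> is \<open>u\<close> turned by a right angle in one sense or the other,
  and \<open>k = cross2 u v\<close> is the corresponding sign. The equation of the ellipse is even
  in \<open>y\<close>, so \<open>is_ellipse_frame\<close> can drop it.\<close>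

lemma orthonormal_frame:
  assumes "norm u = 1" "norm v = 1" "u \<bullet> v = 0"
  obtains k where "k\<^sup>2 = (1::real)" "\<And>x y. x *\<^sub>R u + y *\<^sub>R v = frame_vec u x (k * y)"
proof -
  define k where "k = cross2 u v"
  have u: "(u $ 1)\<^sup>2 + (u $ 2)\<^sup>2 = 1" and v: "(v $ 1)\<^sup>2 + (v $ 2)\<^sup>2 = 1"
    using norm_sq_2[of u] norm_sq_2[of v] assms by auto
  have o: "u $ 1 * v $ 1 + u $ 2 * v $ 2 = 0" using assms(3) by (simp add: inner_vec_def sum_2)
  have "k\<^sup>2 = 1" unfolding k_def cross2_def using u v o by algebra
  moreover have "v $ 1 = - k * u $ 2" "v $ 2 = k * u $ 1"
    unfolding k_def cross2_def using u o by algebra+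
  then have "x *\<^sub>R u + y *\<^sub>R v = frame_vec u x (k * y)" for x y
    by (simp add: vec_eq_iff forall_2 frame_vec_nth)
  ultimately show ?thesis by (rule that)
qed

lemma is_ellipse_frame:
  assumes "is_ellipse a b E"
  obtains c u where "norm u = 1" "E = range (ellipse_point c u a b)"
proof -
  from assms obtain c u v where cuv: "norm u = 1" "norm v = 1" "u \<bullet> v = 0"
    "E = {c + x *\<^sub>R u + y *\<^sub>R v | x y. (x / a)\<^sup>2 + (y / b)\<^sup>2 = 1}" and ab: "0 < b" "b \<le> a"
    unfolding is_ellipse_def by blast
  obtain k where k: "k\<^sup>2 = (1::real)" "\<And>x y. x *\<^sub>R u + y *\<^sub>R v = frame_vec u x (k * y)"
    using orthonormal_frame[OF cuv(1-3)] by blast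
  have sq: "(k * y / b)\<^sup>2 = (y / b)\<^sup>2" for y using k(1) by (simp add: power_mult_distrib power_divide)
  have kk: "k * (k * y) = y" for y using k(1) by (simp add: power2_eq_square mult.assoc[symmetric])
  have "E = {c + frame_vec u x y | x y. (x / a)\<^sup>2 + (y / b)\<^sup>2 = 1}"
    unfolding cuv(4) add.assoc k(2)
  proof (intro equalityI subsetI)
    fix p assume "p \<in> {c + frame_vec u x (k * y) | x y. (x / a)\<^sup>2 + (y / b)\<^sup>2 = 1}"
    then obtain x y where "p = c + frame_vec u x (k * y)" "(x / a)\<^sup>2 + (y / b)\<^sup>2 = 1" by blast
    then show "p \<in> {c + frame_vec u x y | x y. (x / a)\<^sup>2 + (y / b)\<^sup>2 = 1}" using sq[of y] by force
  next
    fix p assume "p \<in> {c + frame_vec u x y | x y. (x / a)\<^sup>2 + (y / b)\<^sup>2 = 1}"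
    then obtain x y where "p = c + frame_vec u x (k * (k * y))" "(x / a)\<^sup>2 + ((k * y) / b)\<^sup>2 = 1"
      using sq kk by auto
    then show "p \<in> {c + frame_vec u x (k * y) | x y. (x / a)\<^sup>2 + (y / b)\<^sup>2 = 1}" by blast
  qed
  then have "E = range (ellipse_point c u a b)" using ab by (subst range_ellipse_point) auto
  then show ?thesis using that cuv(1) by blast
qed

section \<open>The eccentric angle as a function of arc length\<close>

locale ellipse_curve = ellipse_axes +
  fixes \<gamma> :: "real \<Rightarrow> real^2" and l :: real and th :: "real \<Rightarrow> real" and c u :: "real^2"
  assumes u_norm: "norm u = 1"
    and curve_eq: "\<gamma> s = ellipse_point c u a b (th s)"
    and th_deriv: "(th has_real_derivative 1 / speed (th s)) (at s)"
    and th_quasi_periodic: "th (s + l) = th s + 2 * pi"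
    and l_pos: "0 < l"

text \<open>After rescaling the axes the curve runs on the unit circle with positive angular
  velocity \<open>nu\<close>, and the angle is a primitive of \<open>nu\<close>. Unit speed
  identifies \<open>nu\<close> as the reciprocal of the speed; injectivity over a period makes the
  winding number 1.\<close>

lemma (in ellipse_axes) curve_angle:
  fixes X Y X' Y' :: "real \<Rightarrow> real"
  assumes der: "\<And>s. (X has_real_derivative X' s) (at s)" "\<And>s. (Y has_real_derivative Y' s) (at s)"
    and cont: "continuous_on UNIV X'" "continuous_on UNIV Y'"
    and circ: "\<And>s. (X s)\<^sup>2 + (Y s)\<^sup>2 = 1"
    and unit: "\<And>s. (a * X' s)\<^sup>2 + (b * Y' s)\<^sup>2 = 1"
    and orient: "\<And>s. 0 < X s * Y' s - Y s * X' s"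
    and per: "\<And>s. X (s + l) = X s" "\<And>s. Y (s + l) = Y s"
    and inj: "inj_on (\<lambda>s. (X s, Y s)) {0..<l}" and l: "0 < l"
  obtains th where "\<And>s. X s = cos (th s)" "\<And>s. Y s = sin (th s)"
    "\<And>s. (th has_real_derivative 1 / speed (th s)) (at s)" "\<And>s. th (s + l) = th s + 2 * pi"
proof -
  define nu where "nu s = X s * Y' s - Y s * X' s" for s
  have nu_pos: "0 < nu s" for s using orient by (simp add: nu_def)
  have orth: "X s * X' s + Y s * Y' s = 0" for s
  proof -
    have "((\<lambda>s. (X s)\<^sup>2 + (Y s)\<^sup>2) has_real_derivative 2 * (X s * X' s + Y s * Y' s)) (at s)"
      by (auto intro!: derivative_eq_intros der simp: algebra_simps)
    moreover have "((\<lambda>s. (X s)\<^sup>2 + (Y s)\<^sup>2) has_real_derivative 0) (at s)" by (simp add: circ)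
    ultimately show ?thesis using DERIV_unique by fastforce
  qed
  have X': "X' s = - nu s * Y s" and Y': "Y' s = nu s * X s" for s
    using orth[of s] circ[of s] unfolding nu_def by algebra+
  have contXY: "continuous_on UNIV X" "continuous_on UNIV Y"
    using der by (meson DERIV_isCont continuous_at_imp_continuous_on)+
  have cont_nu: "continuous_on UNIV nu"
    unfolding nu_def[abs_def] by (intro continuous_intros cont contXY)
  obtain t0 where t0: "X 0 = cos t0" "Y 0 = sin t0"
    using sincos_total_2pi[OF circ[of 0]] by metis
  define th where "th s = antideriv nu s - antideriv nu 0 + t0" for s
  have th_der: "(th has_real_derivative nu s) (at s)" for s
    unfolding th_def[abs_def] by (auto intro!: derivative_eq_intros antideriv_deriv[OF cont_nu])
  \<comment> \<open>The inner product of the two unit vectors is constant and starts at 1, so the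
    vectors coincide for all \<open>s\<close>.\<close>
  have "((\<lambda>s. X s * cos (th s) + Y s * sin (th s)) has_real_derivative 0) (at s)" for s
  proof -
    have "((\<lambda>s. X s * cos (th s) + Y s * sin (th s)) has_real_derivative
      X' s * cos (th s) + (- sin (th s) * nu s) * X s + (Y' s * sin (th s) + (cos (th s) * nu s) * Y s)) (at s)"
      by (auto intro!: derivative_eq_intros der th_der)
    then show ?thesis unfolding X' Y' by (simp add: algebra_simps)
  qed
  then have "X s * cos (th s) + Y s * sin (th s) = X 0 * cos (th 0) + Y 0 * sin (th 0)" for s
    using DERIV_isconst_all[of "\<lambda>s. X s * cos (th s) + Y s * sin (th s)" s 0] by blast
  then have one: "X s * cos (th s) + Y s * sin (th s) = 1" for s
    using sin_cos_squared_add[of t0] by (simp add: t0 th_def power2_eq_square)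
  have "(X s - cos (th s))\<^sup>2 + (Y s - sin (th s))\<^sup>2 = 0" for s
    using one[of s] circ[of s] sin_cos_squared_add[of "th s"] by algebra
  then have XY: "X s = cos (th s)" "Y s = sin (th s)" for s
    by (simp_all add: sum_power2_eq_zero_iff)
  have nu_speed: "nu s = 1 / speed (th s)" for s
  proof -
    have "(nu s * speed (th s))\<^sup>2 = 1\<^sup>2"
      using unit[of s] unfolding X' Y' power_mult_distrib speed_sq XY by (simp add: algebra_simps)
    then have "nu s * speed (th s) = 1"
      using nu_pos[of s] speed_pos[of "th s"] by (subst (asm) power2_eq_iff_nonneg) auto
    then show ?thesis by (simp add: field_simps)
  qed
  have "nu (s + l) = nu s" for s
    unfolding nu_speed ellipse_speed_def XY[symmetric] per ..
  then have qp: "th (s + l) = th s + (th l - th 0)" for s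
    by (rule quasi_periodic_if_deriv_periodic[OF th_der])
  have mono: "th x < th y" if "x < y" for x y
    using DERIV_pos_imp_increasing[OF that, of th] th_der nu_pos by blast
  have "cos (th l - th 0) = 1"
    using per(1)[of 0] per(2)[of 0] sin_cos_squared_add[of "th 0"]
    unfolding XY cos_diff by (simp add: power2_eq_square)
  then obtain k :: int where k: "th l - th 0 = of_int k * 2 * pi" unfolding cos_one_2pi_int by blast
  have "0 < of_int k * (2 * pi)" using mono[OF l] k by linarith
  then have "0 < k" by (simp add: zero_less_mult_iff)
  \<comment> \<open>With more than one turn, the angle \<open>th 0 + 2 * pi\<close> would be reached
    strictly inside the period, at a point already visited at 0.\<close>
  moreover have "\<not> 1 < k"
  proof
    assume "1 < k"
    then have "2 \<le> k" by simp
    then have "2 * (2 * pi) \<le> of_int k * (2 * pi)" by (intro mult_right_mono) auto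
    then have le: "th 0 + 2 * pi < th l" using k pi_gt_zero by linarith
    have "continuous_on {0..l} th" using th_der by (meson DERIV_isCont continuous_at_imp_continuous_on)
    then have "\<exists>s\<ge>0. s \<le> l \<and> th s = th 0 + 2 * pi"
      using IVT'[of th 0 "th 0 + 2 * pi" l] le l by auto
    then obtain s where s: "0 \<le> s" "s \<le> l" "th s = th 0 + 2 * pi" by blast
    then have "s \<noteq> l" "s \<noteq> 0" using le by auto
    moreover have "(X s, Y s) = (X 0, Y 0)" unfolding XY s by simp
    ultimately show False using inj_onD[OF inj, of s 0] s l by auto
  qed
  ultimately have "k = 1" by simp
  then have "th (s + l) = th s + 2 * pi" for s using qp[of s] k by simp
  then show ?thesis using that[of th] XY th_der nu_speed by metis
qed

lemma ellipse_curve_exists: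
  assumes E: "is_ellipse a b E" and g: "arclength_param \<gamma> l E"
  obtains th c u where "ellipse_curve a b \<gamma> l th c u"
proof -
  interpret ellipse_axes a b using E by unfold_locales (auto simp: is_ellipse_def)
  obtain c u where u: "norm u = 1" and Eeq: "E = range (ellipse_point c u a b)"
    using is_ellipse_frame[OF E] by blast
  have Eset: "E = {c + frame_vec u x y | x y. (x / a)\<^sup>2 + (y / b)\<^sup>2 = 1}"
    unfolding Eeq range_ellipse_point[OF a_pos b_pos] ..
  have cp: "closed_curve_param \<gamma> l E" and unit: "\<And>t. norm (vector_derivative \<gamma> (at t)) = 1"
    and orient: "\<And>t z. z \<in> inside E \<Longrightarrow> 0 < cross2 (vector_derivative \<gamma> (at t)) (z - \<gamma> t)"
    using g unfolding arclength_param_def by auto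
  have l: "0 < l" "\<And>t. \<gamma> (t + l) = \<gamma> t" "inj_on \<gamma> {0..<l}" "range \<gamma> = E"
    using cp unfolding closed_curve_param_def by auto
  obtain Dv where Dv: "Dv 0 = \<gamma>" "\<And>(k::nat) t. (Dv k has_vector_derivative Dv (Suc k) t) (at t)"
    using cp unfolding closed_curve_param_def smooth_curve_def by blast
  have der: "(\<gamma> has_vector_derivative Dv 1 t) (at t)" for t using Dv(2)[of 0 t] Dv(1) by simp
  then have vd: "vector_derivative \<gamma> (at t) = Dv 1 t" for t by (rule vector_derivative_at)
  have contD: "continuous_on UNIV (Dv 1)"
    using Dv(2)[of 1] by (meson has_vector_derivative_continuous continuous_at_imp_continuous_on)
  define u' where "u' = frame_vec u 0 1"
  have fr: "z = frame_vec u (z \<bullet> u) (z \<bullet> u')" for z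
  proof -
    have "(u $ 1)\<^sup>2 + (u $ 2)\<^sup>2 = 1" using norm_sq_2[of u] u by simp
    then have "z $ 1 = (z \<bullet> u) * u $ 1 - (z \<bullet> u') * u $ 2" "z $ 2 = (z \<bullet> u) * u $ 2 + (z \<bullet> u') * u $ 1"
      unfolding u'_def inner_vec_def sum_2 frame_vec_nth inner_real_def by algebra+
    then show ?thesis by (simp add: vec_eq_iff forall_2 frame_vec_nth)
  qed
  define X Y X' Y' where "X s = (\<gamma> s - c) \<bullet> u / a" and "Y s = (\<gamma> s - c) \<bullet> u' / b"
    and "X' s = Dv 1 s \<bullet> u / a" and "Y' s = Dv 1 s \<bullet> u' / b" for s
  have gXY: "\<gamma> s = c + frame_vec u (a * X s) (b * Y s)" for s
  proof -
    have "\<gamma> s - c = frame_vec u (a * X s) (b * Y s)"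
      using fr[of "\<gamma> s - c"] a_pos b_pos unfolding X_def Y_def by simp
    then show ?thesis by (metis add_diff_cancel_left' add.commute diff_add_cancel)
  qed
  have dXY: "Dv 1 s = frame_vec u (a * X' s) (b * Y' s)" for s
    using fr[of "Dv 1 s"] a_pos b_pos by (simp add: X'_def Y'_def)
  have circ: "(X s)\<^sup>2 + (Y s)\<^sup>2 = 1" for s
  proof -
    have "\<gamma> s \<in> E" using l(4) by blast
    then obtain x y where "\<gamma> s = c + frame_vec u x y" "(x / a)\<^sup>2 + (y / b)\<^sup>2 = 1" unfolding Eset by blast
    moreover from this have "x = a * X s" "y = b * Y s"
      using gXY[of s] frame_vec_eq_iff[OF u] by auto
    ultimately show ?thesis using a_pos b_pos by simp
  qed
  \<comment> \<open>Positive orientation is evaluated at the centre, where it says that the angular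
    velocity is positive.\<close>
  have in0: "c \<in> inside E"
    unfolding Eset ellipse_region(3)[OF u a_pos b_pos]
    by (rule CollectI, rule exI[of _ 0], rule exI[of _ 0]) (simp add: frame_vec_def)
  have or: "0 < X s * Y' s - Y s * X' s" for s
  proof -
    have "c - \<gamma> s = frame_vec u (- (a * X s)) (- (b * Y s))"
      unfolding gXY frame_vec_simps(3)[symmetric] by simp
    then have "0 < (a * b) * (X s * Y' s - Y s * X' s)"
      using orient[OF in0, of s] unfolding vd dXY by (simp add: frame_vec_cross[OF u] algebra_simps)
    moreover have "0 < a * b" using a_pos b_pos by simp
    ultimately show ?thesis by (simp only: zero_less_mult_pos)
  qed
  have un: "(a * X' s)\<^sup>2 + (b * Y' s)\<^sup>2 = 1" for s
    using unit[of s] unfolding vd dXY by (simp add: frame_vec_norm[OF u])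
  have dgc: "((\<lambda>s. \<gamma> s - c) has_vector_derivative Dv 1 s) (at s)" for s
    using has_vector_derivative_diff[OF der[of s] has_vector_derivative_const[of c]] by simp
  have dX: "(X has_real_derivative X' s) (at s)" for s
  proof -
    have "((\<lambda>s. (\<gamma> s - c) \<bullet> u) has_vector_derivative Dv 1 s \<bullet> u) (at s)"
      by (rule bounded_linear.has_vector_derivative[OF bounded_linear_inner_left dgc])
    then show ?thesis unfolding X_def[abs_def] X'_def
      by (intro DERIV_cdivide) (simp add: has_real_derivative_iff_has_vector_derivative)
  qed
  have dY: "(Y has_real_derivative Y' s) (at s)" for s
  proof -
    have "((\<lambda>s. (\<gamma> s - c) \<bullet> u') has_vector_derivative Dv 1 s \<bullet> u') (at s)"
      by (rule bounded_linear.has_vector_derivative[OF bounded_linear_inner_left dgc])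
    then show ?thesis unfolding Y_def[abs_def] Y'_def
      by (intro DERIV_cdivide) (simp add: has_real_derivative_iff_has_vector_derivative)
  qed
  have cX: "continuous_on UNIV X'" "continuous_on UNIV Y'"
    unfolding X'_def[abs_def] Y'_def[abs_def] by (intro continuous_intros contD; use a_pos b_pos in simp)+
  have inj: "inj_on (\<lambda>s. (X s, Y s)) {0..<l}"
    using l(3) unfolding inj_on_def gXY by auto
  have per: "X (s + l) = X s" "Y (s + l) = Y s" for s using l(2) by (auto simp: X_def Y_def)
  obtain th where "\<And>s. X s = cos (th s)" "\<And>s. Y s = sin (th s)"
    "\<And>s. (th has_real_derivative 1 / speed (th s)) (at s)" "\<And>s. th (s + l) = th s + 2 * pi"
    using curve_angle[OF dX dY cX circ un or per inj l(1)] by metis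
  then have "ellipse_curve a b \<gamma> l th c u"
    using u l(1) gXY by unfold_locales (auto simp: ellipse_point_def)
  then show ?thesis by (rule that)
qed

subsection \<open>Mather's beta function at the rotation number of a caustic\<close>

lemma sum_telescope_int:
  fixes f :: "int \<Rightarrow> real"
  assumes "m \<le> n"
  shows "(\<Sum>i\<in>{m..<n}. f (i + 1) - f i) = f n - f m"
  using assms
proof (induction n rule: int_ge_induct)
  case (step i)
  then have "{m..<i + 1} = insert i {m..<i}" by auto
  then show ?case using step by simp
qed simp

lemma Lipschitz_if_deriv_bounded:
  fixes F g :: "real \<Rightarrow> real"
  assumes "\<And>x. (F has_real_derivative g x) (at x)" "\<And>x. \<bar>g x\<bar> \<le> K"
  shows "\<bar>F x - F y\<bar> \<le> K * \<bar>x - y\<bar>"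
  using field_differentiable_bound[of UNIV F g K x y] assms by simp

context ellipse_axes
begin

text \<open>The derivative of \<open>chord_len\<close> in its second argument;
  \<open>chord_out\<close> is minus the derivative in the first. Divided by the speed at that end
  they are the cosines of the angles with the boundary
  (\<open>direction_inner_tangent\<close>).\<close>

definition chord_in :: "real \<Rightarrow> real \<Rightarrow> real" where
  "chord_in t t' = cos ((t' - t) / 2) * speed ((t + t') / 2) + sin ((t' - t) / 2) * speed' ((t + t') / 2)"

definition chord_out :: "real \<Rightarrow> real \<Rightarrow> real" where
  "chord_out t t' = cos ((t' - t) / 2) * speed ((t + t') / 2) - sin ((t' - t) / 2) * speed' ((t + t') / 2)"

text \<open>Joachimsthal's first integral: \<open>mu\<close> is preserved by reflection, and equals \<open>lam\<close> on the chords
  tangent to the confocal ellipse of parameter \<open>lam\<close>.\<close>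

definition mu :: "real \<Rightarrow> real \<Rightarrow> real" where
  "mu t t' = a * b * sin ((t' - t) / 2) / speed ((t + t') / 2)"

lemma half_sum_diff: "(t + t') / 2 + (t' - t) / 2 = t'" "(t + t') / 2 - (t' - t) / 2 = (t :: real)"
  by (simp_all add: field_simps)

lemma chord_in_sq: "(chord_in t t')\<^sup>2 = (speed t')\<^sup>2 - (mu t t')\<^sup>2"
  unfolding chord_in_def mu_def chord_deriv_sq half_sum_diff ..

lemma chord_out_sq: "(chord_out t t')\<^sup>2 = (speed t)\<^sup>2 - (mu t t')\<^sup>2"
  unfolding chord_out_def mu_def chord_deriv_sq' half_sum_diff ..

lemma chord_len_deriv: "(chord_len t has_real_derivative chord_in t t') (at t')"
  unfolding chord_len_def[abs_def] chord_in_def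
  by (auto intro!: derivative_eq_intros simp: field_simps)

lemma chord_in_bound: "\<bar>chord_in t t'\<bar> \<le> a"
proof -
  have "(chord_in t t')\<^sup>2 \<le> (speed t')\<^sup>2" unfolding chord_in_sq by simp
  also have "\<dots> \<le> a\<^sup>2" using speed_bounds(2)[of t'] speed_pos[of t'] by (intro power_mono) auto
  finally show ?thesis using a_pos by (simp add: abs_le_square_iff[symmetric])
qed

lemma mu_pos: "t < t' \<Longrightarrow> t' < t + 2 * pi \<Longrightarrow> 0 < mu t t'"
  unfolding mu_def using a_pos b_pos speed_pos
  by (intro divide_pos_pos mult_pos_pos sin_gt_zero) auto

end

section \<open>Chords, reflection and rotation numbers in the eccentric angle\<close>

context ellipse_curve
begin

lemma th_bij: "bij th" and th_strict_mono: "strict_mono th"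
proof -
  have "1 / speed (th s) \<ge> 1 / a" for s
    using speed_bounds(2)[of "th s"] speed_pos[of "th s"] a_pos by (intro divide_left_mono) auto
  from bij_if_deriv_ge_pos[OF th_deriv this] show "bij th" "strict_mono th" using a_pos by auto
qed

lemma th_less_iff: "th x < th y \<longleftrightarrow> x < y" using th_strict_mono by (simp add: strict_mono_less)
lemma th_le_iff: "th x \<le> th y \<longleftrightarrow> x \<le> y" using th_strict_mono by (simp add: strict_mono_less_eq)

lemma th_inv: "th (inv th x) = x" "inv th (th x) = x"
  using th_bij by (auto simp: bij_is_surj surj_f_inv_f bij_is_inj)

lemma th_step_less: "th x < th y + 2 * pi \<longleftrightarrow> x < y + l"
  unfolding th_quasi_periodic[symmetric] th_less_iff ..
lemma th_step_le: "th x \<le> th y + 2 * pi \<longleftrightarrow> x \<le> y + l"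
  unfolding th_quasi_periodic[symmetric] th_le_iff ..

text \<open>Sum-to-product formulas: a chord is parallel to the tangent of the ellipse at the mean
  of the two eccentric angles.\<close>

lemma curve_diff:
  "\<gamma> s' - \<gamma> s = (2 * sin ((th s' - th s) / 2)) *\<^sub>R
     frame_vec u (- a * sin ((th s + th s') / 2)) (b * cos ((th s + th s') / 2))"
proof -
  have "cos (th s') - cos (th s) = 2 * sin ((th s' - th s) / 2) * (- sin ((th s + th s') / 2))"
    using cos_diff_cos[of "th s'" "th s"] sin_minus[of "(th s' - th s) / 2"]
    by (simp add: add.commute minus_divide_left)
  moreover have "sin (th s') - sin (th s) = 2 * sin ((th s' - th s) / 2) * cos ((th s + th s') / 2)"
    using sin_diff_sin[of "th s'" "th s"] by (simp add: add.commute)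
  moreover have "\<gamma> s' - \<gamma> s = frame_vec u (a * (cos (th s') - cos (th s))) (b * (sin (th s') - sin (th s)))"
    unfolding curve_eq ellipse_point_def by (simp add: frame_vec_simps algebra_simps)
  ultimately show ?thesis by (simp add: frame_vec_simps mult_ac)
qed

lemma norm_tangent_dir: "norm (frame_vec u (- a * sin x) (b * cos x)) = speed x"
  by (simp add: frame_vec_norm[OF u_norm] speed_def power_mult_distrib)

lemma gen_fun_eq:
  assumes "s \<le> s'" "s' \<le> s + l"
  shows "gen_fun \<gamma> s s' = - chord_len (th s) (th s')"
proof -
  have "0 \<le> (th s' - th s) / 2" "(th s' - th s) / 2 \<le> pi"
    using assms th_le_iff[of s s'] th_step_le[of s' s] by auto
  then have "0 \<le> sin ((th s' - th s) / 2)" by (rule sin_ge_zero)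
  moreover have "gen_fun \<gamma> s s' = - norm (\<gamma> s' - \<gamma> s)" by (simp add: gen_fun_def norm_minus_commute)
  ultimately show ?thesis unfolding curve_diff norm_scaleR norm_tangent_dir chord_len_def by simp
qed

lemma tangent_vector: "vector_derivative \<gamma> (at s) = (1 / speed (th s)) *\<^sub>R frame_vec u (- a * sin (th s)) (b * cos (th s))"
proof -
  have "\<gamma> = (\<lambda>s. c + frame_vec u (a * cos (th s)) (b * sin (th s)))"
    using curve_eq by (auto simp: ellipse_point_def)
  moreover have "((\<lambda>s. c + frame_vec u (a * cos (th s)) (b * sin (th s))) has_vector_derivative
      frame_vec u (- a * sin (th s) * (1 / speed (th s))) (b * cos (th s) * (1 / speed (th s)))) (at s)"
    by (rule frame_vec_deriv) (auto intro!: derivative_eq_intros th_deriv)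
  ultimately show ?thesis
    by (simp add: vector_derivative_at frame_vec_simps mult.commute)
qed

lemma direction_inner_tangent:
  assumes "s < s'" "s' < s + l"
  shows "sgn (\<gamma> s' - \<gamma> s) \<bullet> vector_derivative \<gamma> (at s') = chord_in (th s) (th s') / speed (th s')"
    and "sgn (\<gamma> s' - \<gamma> s) \<bullet> vector_derivative \<gamma> (at s) = chord_out (th s) (th s') / speed (th s)"
proof -
  let ?d = "(th s' - th s) / 2" and ?x = "(th s + th s') / 2"
  have "0 < ?d" "?d < pi" using assms th_less_iff[of s s'] th_step_less[of s' s] by auto
  then have "0 < sin ?d" by (rule sin_gt_zero)
  then have sg: "sgn (\<gamma> s' - \<gamma> s) = (1 / speed ?x) *\<^sub>R frame_vec u (- a * sin ?x) (b * cos ?x)"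
    unfolding curve_diff sgn_scaleR sgn_div_norm[of "frame_vec u _ _"] norm_tangent_dir
    by (simp add: inverse_eq_divide)
  have "speed ?x * chord_in (th s) (th s') = a\<^sup>2 * sin ?x * sin (th s') + b\<^sup>2 * cos ?x * cos (th s')"
    unfolding chord_in_def speed_chord_in half_sum_diff ..
  then show "sgn (\<gamma> s' - \<gamma> s) \<bullet> vector_derivative \<gamma> (at s') = chord_in (th s) (th s') / speed (th s')"
    unfolding sg tangent_vector using speed_pos[of ?x] speed_pos[of "th s'"]
    by (simp add: frame_vec_inner[OF u_norm] field_simps power2_eq_square)
  have "speed ?x * chord_out (th s) (th s') = a\<^sup>2 * sin ?x * sin (th s) + b\<^sup>2 * cos ?x * cos (th s)"
    using speed_chord_in[of ?x "- ?d"] half_sum_diff[of "th s" "th s'"] unfolding chord_out_def by simp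
  then show "sgn (\<gamma> s' - \<gamma> s) \<bullet> vector_derivative \<gamma> (at s) = chord_out (th s) (th s') / speed (th s)"
    unfolding sg tangent_vector using speed_pos[of ?x] speed_pos[of "th s"]
    by (simp add: frame_vec_inner[OF u_norm] field_simps power2_eq_square)
qed

lemma reflection_law_iff:
  assumes "x < y" "y < x + l" "y < z" "z < y + l"
  shows "reflection_law \<gamma> x y z \<longleftrightarrow> chord_in (th x) (th y) = chord_out (th y) (th z)"
  unfolding reflection_law_def direction_inner_tangent(1)[OF assms(1,2)] direction_inner_tangent(2)[OF assms(3,4)]
  by simp

text \<open>\<open>F\<close> is linear of slope \<open>K / l\<close> up to a bounded error, and the
  error disappears on division by the number of steps. Both ends of the window are treated at once
  through an index \<open>k N\<close> of absolute value \<open>N\<close>.\<close>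

lemma rotation_number_quasi_periodic:
  assumes rot: "has_rotation_number l s \<omega>" and F: "\<And>x. \<bar>F x - K / l * x\<bar> \<le> B"
  shows "(\<lambda>N. (F (s (int N)) - F (s (- int N))) / (2 * real N)) \<longlonglongrightarrow> K * \<omega>"
proof -
  have *: "(\<lambda>N. F (s (k N)) / of_int (k N)) \<longlonglongrightarrow> K * \<omega>"
    if lim: "(\<lambda>N. s (k N) / (of_int (k N) * l)) \<longlonglongrightarrow> \<omega>" and k: "\<And>N. \<bar>k N\<bar> = int N" for k :: "nat \<Rightarrow> int"
  proof -
    have B0: "(\<lambda>N. B / real N) \<longlonglongrightarrow> 0"
      by (intro tendsto_divide_0[OF tendsto_const] filterlim_at_top_imp_at_infinity filterlim_real_sequentially)
    have kr: "\<bar>real_of_int (k N)\<bar> = real N" for N using k[of N] by linarith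
    have "(\<lambda>N. (F (s (k N)) - K / l * s (k N)) / of_int (k N)) \<longlonglongrightarrow> 0"
    proof (rule Lim_null_comparison[OF always_eventually B0], rule allI)
      show "norm ((F (s (k N)) - K / l * s (k N)) / of_int (k N)) \<le> B / real N" for N
        unfolding real_norm_def abs_divide kr by (rule divide_right_mono[OF F]) simp
    qed
    from tendsto_add[OF this tendsto_mult_left[OF lim, of K]]
    have "(\<lambda>N. (F (s (k N)) - K / l * s (k N)) / of_int (k N) + K * (s (k N) / (of_int (k N) * l))) \<longlonglongrightarrow> K * \<omega>" by simp
    moreover have "(F (s i) - K / l * s i) / of_int i + K * (s i / (of_int i * l)) = F (s i) / of_int i" for i
      using l_pos by (cases "i = 0") (simp_all add: field_simps)
    ultimately show ?thesis by simp
  qed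
  have i2: "filterlim (\<lambda>N. - int N) at_bot sequentially"
    unfolding filterlim_at_bot eventually_sequentially
  proof
    fix Z :: int
    show "\<exists>N. \<forall>n\<ge>N. - int n \<le> Z" by (rule exI[of _ "nat (- Z)"]) auto
  qed
  have "(\<lambda>N. F (s (int N)) / of_int (int N)) \<longlonglongrightarrow> K * \<omega>"
    using rot unfolding has_rotation_number_def
    by (intro * filterlim_compose[OF _ filterlim_int_sequentially, of "\<lambda>i. s i / (of_int i * l)"]) auto
  moreover have "(\<lambda>N. F (s (- int N)) / of_int (- int N)) \<longlonglongrightarrow> K * \<omega>"
    using rot unfolding has_rotation_number_def
    by (intro * filterlim_compose[OF _ i2, of "\<lambda>i. s i / (of_int i * l)"]) auto
  ultimately have "(\<lambda>N. (F (s (int N)) / of_int (int N) + F (s (- int N)) / of_int (- int N)) / 2) \<longlonglongrightarrow> (K * \<omega> + K * \<omega>) / 2"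
    by (intro tendsto_intros) auto
  moreover have "(F (s (int N)) / of_int (int N) + F (s (- int N)) / of_int (- int N)) / 2 = (F (s (int N)) - F (s (- int N))) / (2 * real N)" for N
    by (simp add: diff_divide_distrib)
  ultimately show ?thesis by (simp only: field_sum_of_halves add_divide_distrib[of "K * \<omega>" "K * \<omega>" 2])
qed

lemma orbit_steps:
  assumes "billiard_orbit \<gamma> l s"
  shows "s i \<le> s (i + 1)" "s (i + 1) \<le> s i + l"
  using assms l_pos unfolding billiard_orbit_def by (auto simp: less_imp_le)

end

section \<open>Calibrated action and minimal orbits\<close>

locale ellipse_billiard = ellipse_curve a b \<gamma> l th c u + ellipse_caustic a b lam
  for a b \<gamma> l th c u lam
begin

definition average_action :: "(int \<Rightarrow> real) \<Rightarrow> nat \<Rightarrow> real" where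
  "average_action s N = (\<Sum>i\<in>{- int N..int N - 1}. gen_fun \<gamma> (s i) (s (i + 1))) / (2 * real N)"

lemma int_interval: "{- int N..int N - 1} = {- int N..<int N}" by auto

text \<open>Summing the calibration inequality telescopes \<open>G\<close>. The bound depends only
  on the ends and the number of steps, so a sequence attaining it is minimal.\<close>

lemma action_ge:
  assumes "m \<le> n" "\<And>i. i \<in> {m..<n} \<Longrightarrow> t i \<le> t (i + 1) \<and> t (i + 1) \<le> t i + l"
  shows "(\<Sum>i\<in>{m..<n}. gen_fun \<gamma> (t i) (t (i + 1))) \<ge> - (G (th (t n)) - G (th (t m))) + of_int (n - m) * M"
proof -
  have "(\<Sum>i\<in>{m..<n}. gen_fun \<gamma> (t i) (t (i + 1))) \<ge> (\<Sum>i\<in>{m..<n}. - (G (th (t (i + 1))) - G (th (t i))) + M)"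
  proof (rule sum_mono)
    fix i assume "i \<in> {m..<n}"
    then have i: "t i \<le> t (i + 1)" "t (i + 1) \<le> t i + l" using assms by auto
    have "chord_len (th (t i)) (th (t (i + 1))) \<le> G (th (t (i + 1))) - G (th (t i)) - M"
      by (rule chord_len_le) (use i th_le_iff th_step_le in auto)
    then show "- (G (th (t (i + 1))) - G (th (t i))) + M \<le> gen_fun \<gamma> (t i) (t (i + 1))"
      unfolding gen_fun_eq[OF i] by linarith
  qed
  moreover have "(\<Sum>i\<in>{m..<n}. - (G (th (t (i + 1))) - G (th (t i))) + M) = - (G (th (t n)) - G (th (t m))) + of_int (n - m) * M"
    using assms(1) unfolding sum.distrib sum_negf sum_telescope_int[OF assms(1), of "\<lambda>i. G (th (t i))"]
    by simp
  ultimately show ?thesis by simp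
qed

text \<open>\<open>M'\<close> will be \<open>M\<close> for orbits tangent to the caustic, and
  \<open>M\<close> plus a small error for the competitor in
  \<open>minimal_orbit_average\<close>.\<close>

lemma action_le:
  assumes "m \<le> n"
    and steps: "\<And>i. i \<in> {m..<n} \<Longrightarrow> t i \<le> t (i + 1) \<and> t (i + 1) \<le> t i + l"
    and le: "\<And>i. i \<in> {m..<n} \<Longrightarrow> chord_len (th (t i)) (th (t (i + 1))) \<ge> G (th (t (i + 1))) - G (th (t i)) - M'"
  shows "(\<Sum>i\<in>{m..<n}. gen_fun \<gamma> (t i) (t (i + 1))) \<le> - (G (th (t n)) - G (th (t m))) + of_int (n - m) * M'"
proof -
  have "(\<Sum>i\<in>{m..<n}. gen_fun \<gamma> (t i) (t (i + 1))) \<le> (\<Sum>i\<in>{m..<n}. - (G (th (t (i + 1))) - G (th (t i))) + M')"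
  proof (rule sum_mono)
    fix i assume i: "i \<in> {m..<n}"
    then show "gen_fun \<gamma> (t i) (t (i + 1)) \<le> - (G (th (t (i + 1))) - G (th (t i))) + M'"
      using gen_fun_eq[of "t i" "t (i + 1)"] steps[OF i] le[OF i] by linarith
  qed
  moreover have "(\<Sum>i\<in>{m..<n}. - (G (th (t (i + 1))) - G (th (t i))) + M') = - (G (th (t n)) - G (th (t m))) + of_int (n - m) * M'"
    using assms(1) unfolding sum.distrib sum_negf sum_telescope_int[OF assms(1), of "\<lambda>i. G (th (t i))"]
    by simp
  ultimately show ?thesis by simp
qed

lemma G_linear_bound: "\<exists>B. \<forall>x. \<bar>G (th x) - C / l * x\<bar> \<le> B"
  by (rule quasi_periodic_linear_bound)
    (auto simp: th_quasi_periodic G_quasi_periodic l_pos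
      intro!: continuous_at_imp_continuous_on DERIV_isCont[OF DERIV_chain2[OF G_deriv th_deriv]])

lemma U_linear_bound: "\<exists>B. \<forall>x. \<bar>U (th x) - P / l * x\<bar> \<le> B"
  by (rule quasi_periodic_linear_bound)
    (auto simp: th_quasi_periodic U_quasi_periodic l_pos
      intro!: continuous_at_imp_continuous_on DERIV_isCont[OF DERIV_chain2[OF U_deriv th_deriv]])

lemma P_pos: "0 < P" using rho_pos rho_less_P by linarith

lemma U_inv: "U (inv U x) = x"
  using U_bij by (simp add: bij_is_surj surj_f_inv_f)

lemma U_steps:
  assumes "U (th y) - U (th x) = e"
  shows "0 \<le> e \<Longrightarrow> x \<le> y" "e \<le> P \<Longrightarrow> y \<le> x + l" "0 < e \<Longrightarrow> x < y" "e < P \<Longrightarrow> y < x + l"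
proof -
  have le: "U x \<le> U y \<longleftrightarrow> x \<le> y" for x y using U_strict_mono by (simp add: strict_mono_less_eq)
  show "0 \<le> e \<Longrightarrow> x \<le> y" using assms le th_le_iff by fastforce
  show "0 < e \<Longrightarrow> x < y" using assms U_less_iff th_less_iff by fastforce
  show "e \<le> P \<Longrightarrow> y \<le> x + l" using assms U_quasi_periodic[of "th x"] le[of "th y" "th x + 2 * pi"] th_step_le by simp
  show "e < P \<Longrightarrow> y < x + l" using assms U_quasi_periodic[of "th x"] U_less_iff[of "th y" "th x + 2 * pi"] th_step_less by simp
qed

text \<open>\<open>U (th x)\<close> stays within bounded distance of \<open>P / l * x\<close>, hence
  \<open>s i\<close> within bounded distance of \<open>of_int i * l * (rho / P)\<close>.\<close>

lemma U_arith_rotation_number: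
  assumes "\<And>i. U (th (s i)) = U0 + of_int i * rho"
  shows "has_rotation_number l s (rho / P)"
proof -
  obtain B where B: "\<And>x. \<bar>U (th x) - P / l * x\<bar> \<le> B" using U_linear_bound by blast
  define K where "K = l / P * (B + \<bar>U0\<bar>)"
  have bound: "\<bar>s i - of_int i * l * (rho / P)\<bar> \<le> K" for i
  proof -
    have "\<bar>P / l * s i - of_int i * rho\<bar> \<le> B + \<bar>U0\<bar>"
      using B[of "s i"] unfolding assms by linarith
    then have "l / P * \<bar>P / l * s i - of_int i * rho\<bar> \<le> K"
      unfolding K_def using l_pos P_pos by (intro mult_left_mono) auto
    moreover have "l / P * \<bar>P / l * s i - of_int i * rho\<bar> = \<bar>l / P * (P / l * s i - of_int i * rho)\<bar>"
      using l_pos P_pos by (simp add: abs_mult)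
    moreover have "l / P * (P / l * s i - of_int i * rho) = s i - of_int i * l * (rho / P)"
      using l_pos P_pos by (simp add: field_simps)
    ultimately show ?thesis by metis
  qed
  have *: "((\<lambda>i. s i / (of_int i * l)) \<longlongrightarrow> rho / P) A"
    if A: "((\<lambda>i. K / l / \<bar>real_of_int i\<bar>) \<longlongrightarrow> 0) A" "\<forall>\<^sub>F i in A. i \<noteq> 0" for A :: "int filter"
  proof -
    have "\<forall>\<^sub>F i in A. norm (s i / (of_int i * l) - rho / P) \<le> K / l / \<bar>real_of_int i\<bar>"
      using A(2)
    proof eventually_elim
      case (elim i)
      then have "s i / (of_int i * l) - rho / P = (s i - of_int i * l * (rho / P)) / (of_int i * l)"
        using l_pos by (simp add: diff_divide_distrib)
      then have "norm (s i / (of_int i * l) - rho / P) = \<bar>s i - of_int i * l * (rho / P)\<bar> / (\<bar>of_int i\<bar> * l)"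
        using l_pos by (simp add: abs_mult)
      also have "\<dots> \<le> K / (\<bar>of_int i\<bar> * l)"
        using bound[of i] l_pos by (intro divide_right_mono) auto
      finally show ?case by (simp add: mult.commute)
    qed
    from Lim_null_comparison[OF this A(1)] show ?thesis using Lim_null by blast
  qed
  have top: "((\<lambda>i. K / l / \<bar>real_of_int i\<bar>) \<longlongrightarrow> 0) at_top"
    by (intro tendsto_divide_0[OF tendsto_const] filterlim_at_top_imp_at_infinity
        filterlim_compose[OF filterlim_abs_real] filterlim_real_of_int_at_top)
  moreover have bot: "((\<lambda>i. K / l / \<bar>real_of_int i\<bar>) \<longlongrightarrow> 0) at_bot"
  proof -
    have "filterlim uminus at_top (at_bot :: int filter)"
      unfolding filterlim_at_top eventually_at_bot_linorder
    proof
      fix Z :: int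
      show "\<exists>N. \<forall>n\<le>N. Z \<le> - n" by (rule exI[of _ "- Z"]) auto
    qed
    from filterlim_compose[OF top this] show ?thesis by simp
  qed
  ultimately show ?thesis unfolding has_rotation_number_def
    using eventually_mono[OF eventually_ge_at_top[of "1 :: int"], of "\<lambda>i. i \<noteq> 0"]
      eventually_mono[OF eventually_le_at_bot[of "- 1 :: int"], of "\<lambda>i. i \<noteq> 0"]
    by (intro conjI *) auto
qed

text \<open>Compare with the end \<open>r\<close> of the tangent chord from \<open>t\<close>. As
  \<open>U\<close> has slope at least \<open>1 / a\<close>, \<open>t'\<close> is within
  \<open>a * \<bar>e - rho\<bar>\<close> of \<open>r\<close>; \<open>G\<close> and the chord length
  both have Lipschitz constant \<open>a\<close>, whence \<open>2 * a\<^sup>2\<close>.\<close>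

lemma chord_len_near:
  assumes "U t' - U t = e"
  shows "chord_len t t' \<ge> G t' - G t - M - 2 * a\<^sup>2 * \<bar>e - rho\<bar>"
proof -
  define r where "r = inv U (U t + rho)"
  have r: "U r - U t = rho" by (simp add: r_def U_inv)
  have "\<bar>t' - r\<bar> \<le> a * \<bar>e - rho\<bar>"
  proof -
    have "1 / a * \<bar>t' - r\<bar> \<le> \<bar>U t' - U r\<bar>"
      using U_growth[of t' r] U_growth[of r t'] by (cases "t' \<le> r") (auto simp: abs_if)
    also have "U t' - U r = e - rho" using assms r by simp
    finally show ?thesis using a_pos by (simp add: field_simps)
  qed
  then have d: "a * \<bar>t' - r\<bar> \<le> a\<^sup>2 * \<bar>e - rho\<bar>"
    using a_pos by (simp add: power2_eq_square mult.assoc)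
  have "\<bar>G t' - G r\<bar> \<le> a * \<bar>t' - r\<bar>"
    using w_pos w_le_a by (intro Lipschitz_if_deriv_bounded[OF G_deriv]) (simp add: less_imp_le)
  moreover have "\<bar>chord_len t t' - chord_len t r\<bar> \<le> a * \<bar>t' - r\<bar>"
    by (rule Lipschitz_if_deriv_bounded[OF chord_len_deriv chord_in_bound])
  ultimately show ?thesis using chord_len_eq[OF r] d by linarith
qed

text \<open>The incoming and the outgoing tangent chord have the same derivative \<open>w\<close> at
  their common impact point, which is the reflection law.\<close>

lemma caustic_orbit_is_orbit:
  assumes "\<And>i. U (th (s i)) = U0 + of_int i * rho"
  shows "billiard_orbit \<gamma> l s" "\<And>i. s i < s (i + 1)" "\<And>i. s (i + 1) < s i + l"
proof -
  have st: "U (th (s (i + 1))) - U (th (s i)) = rho" for i by (simp add: assms algebra_simps)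
  show 1: "s i < s (i + 1)" "s (i + 1) < s i + l" for i
    using U_steps[OF st[of i]] rho_pos rho_less_P by auto
  have "chord_in (th (s i)) (th (s (i + 1))) = w (th (s (i + 1)))"
    "chord_out (th (s i)) (th (s (i + 1))) = w (th (s i))" for i
  proof -
    obtain x where x: "th (s i) = x - d0 x" "th (s (i + 1)) = x + d0 x"
      using st[of i] U_step_iff by blast
    then show "chord_in (th (s i)) (th (s (i + 1))) = w (th (s (i + 1)))"
      "chord_out (th (s i)) (th (s (i + 1))) = w (th (s i))"
      using w_eq_chord_deriv[of x] unfolding chord_in_def chord_out_def x by simp_all
  qed
  note ch = this
  have "reflection_law \<gamma> (s (i - 1)) (s i) (s (i + 1))" for i
    using 1[of "i - 1"] 1[of i] ch(1)[of "i - 1"] ch(2)[of i] by (subst reflection_law_iff) auto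
  then show "billiard_orbit \<gamma> l s" unfolding billiard_orbit_def using 1 by blast
qed

text \<open>Every chord attains the calibration bound, so the action equals the lower bound that
  \<open>action_ge\<close> imposes on all competitors with the same ends.\<close>

lemma caustic_orbit_minimal:
  assumes "\<And>i. U (th (s i)) = U0 + of_int i * rho"
  shows "minimal_orbit \<gamma> l s"
    and "m \<le> n \<Longrightarrow> (\<Sum>i\<in>{m..<n}. gen_fun \<gamma> (s i) (s (i + 1))) = - (G (th (s n)) - G (th (s m))) + of_int (n - m) * M"
proof -
  note orb = caustic_orbit_is_orbit[OF assms]
  have st: "U (th (s (i + 1))) - U (th (s i)) = rho" for i by (simp add: assms algebra_simps)
  show eq: "(\<Sum>i\<in>{m..<n}. gen_fun \<gamma> (s i) (s (i + 1))) = - (G (th (s n)) - G (th (s m))) + of_int (n - m) * M" if "m \<le> n" for m n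
  proof (rule antisym)
    show "(\<Sum>i\<in>{m..<n}. gen_fun \<gamma> (s i) (s (i + 1))) \<le> - (G (th (s n)) - G (th (s m))) + of_int (n - m) * M"
      by (rule action_le[OF that]) (use orb chord_len_eq[OF st] in \<open>auto simp: less_imp_le\<close>)
    show "- (G (th (s n)) - G (th (s m))) + of_int (n - m) * M \<le> (\<Sum>i\<in>{m..<n}. gen_fun \<gamma> (s i) (s (i + 1)))"
      by (rule action_ge[OF that]) (use orb in \<open>auto simp: less_imp_le\<close>)
  qed
  show "minimal_orbit \<gamma> l s"
    unfolding minimal_orbit_def
  proof (intro conjI allI impI)
    fix m n t
    assume a: "m < n \<and> t m = s m \<and> t n = s n \<and> (\<forall>i\<in>{m..<n}. t i \<le> t (i + 1) \<and> t (i + 1) \<le> t i + l)"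
    then have "(\<Sum>i\<in>{m..<n}. gen_fun \<gamma> (t i) (t (i + 1))) \<ge> - (G (th (t n)) - G (th (t m))) + of_int (n - m) * M"
      by (intro action_ge) auto
    then show "(\<Sum>i\<in>{m..<n}. gen_fun \<gamma> (s i) (s (i + 1))) \<le> (\<Sum>i\<in>{m..<n}. gen_fun \<gamma> (t i) (t (i + 1)))"
      using a eq[of m n] by auto
  qed (rule orb)
qed

text \<open>The upper bound compares with the competitor that joins \<open>s (- N)\<close> to \<open>s N\<close> by \<open>2 N\<close> steps of equal
  size \<open>e N\<close> in \<open>U\<close>. As \<open>e N\<close> tends to \<open>rho\<close>, each of its chords nearly attains the calibration bound.\<close>

lemma minimal_orbit_average:
  assumes min: "minimal_orbit \<gamma> l s" and rot: "has_rotation_number l s (rho / P)"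
  shows "average_action s \<longlonglongrightarrow> - C * (rho / P) + M"
proof -
  define g where "g N = (G (th (s (int N))) - G (th (s (- int N)))) / (2 * real N)" for N
  define e where "e N = (U (th (s (int N))) - U (th (s (- int N)))) / (2 * real N)" for N
  obtain B1 where "\<And>x. \<bar>G (th x) - C / l * x\<bar> \<le> B1" using G_linear_bound by blast
  from rotation_number_quasi_periodic[OF rot this]
  have g: "g \<longlonglongrightarrow> C * (rho / P)" by (simp add: g_def[abs_def])
  obtain B2 where "\<And>x. \<bar>U (th x) - P / l * x\<bar> \<le> B2" using U_linear_bound by blast
  from rotation_number_quasi_periodic[OF rot this]
  have e: "e \<longlonglongrightarrow> rho" using P_pos by (simp add: e_def[abs_def])
  have orb: "billiard_orbit \<gamma> l s" using min by (simp add: minimal_orbit_def)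
  have low: "- g N + M \<le> average_action s N" if "0 < N" for N
  proof -
    have "(\<Sum>i\<in>{- int N..<int N}. gen_fun \<gamma> (s i) (s (i + 1))) \<ge>
        - (G (th (s (int N))) - G (th (s (- int N)))) + of_int (int N - - int N) * M"
      by (rule action_ge) (use orbit_steps[OF orb] in auto)
    then have "(- (G (th (s (int N))) - G (th (s (- int N)))) + of_int (int N - - int N) * M) / (2 * real N) \<le> average_action s N"
      unfolding average_action_def int_interval by (rule divide_right_mono) simp
    then show ?thesis using that unfolding g_def add_divide_distrib minus_divide_left by simp
  qed
  have up: "average_action s N \<le> - g N + M + 2 * a\<^sup>2 * \<bar>e N - rho\<bar>" if N: "0 < N" "0 < e N" "e N < P" for N
  proof -
    define t where "t i = inv th (inv U (U (th (s (- int N))) + of_int (i + int N) * e N))" for i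
    have Ut: "U (th (t i)) = U (th (s (- int N))) + of_int (i + int N) * e N" for i
      by (simp add: t_def th_inv U_inv)
    have st: "U (th (t (i + 1))) - U (th (t i)) = e N" for i by (simp add: Ut algebra_simps)
    have steps: "t i \<le> t (i + 1)" "t (i + 1) \<le> t i + l" for i using U_steps[OF st] N by auto
    have inj: "x = y" if "U (th x) = U (th y)" for x y
      using that U_eq_iff th_inv(2) by metis
    have "U (th (t (- int N))) = U (th (s (- int N)))" by (simp add: Ut)
    moreover have "U (th (t (int N))) = U (th (s (int N)))"
      using N(1) unfolding Ut e_def by simp
    ultimately have ends: "t (- int N) = s (- int N)" "t (int N) = s (int N)" by (auto dest: inj)
    have H: "(\<Sum>i\<in>{m..<n}. gen_fun \<gamma> (s i) (s (i + 1))) \<le> (\<Sum>i\<in>{m..<n}. gen_fun \<gamma> (t i) (t (i + 1)))"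
      if "m < n" "t m = s m" "t n = s n" for m n
      using min steps that unfolding minimal_orbit_def by blast
    have "(\<Sum>i\<in>{- int N..<int N}. gen_fun \<gamma> (s i) (s (i + 1))) \<le> (\<Sum>i\<in>{- int N..<int N}. gen_fun \<gamma> (t i) (t (i + 1)))"
      by (rule H) (use N ends in simp_all)
    also have "\<dots> \<le> - (G (th (t (int N))) - G (th (t (- int N)))) + of_int (int N - - int N) * (M + 2 * a\<^sup>2 * \<bar>e N - rho\<bar>)"
    proof (rule action_le)
      show "chord_len (th (t i)) (th (t (i + 1))) \<ge> G (th (t (i + 1))) - G (th (t i)) - (M + 2 * a\<^sup>2 * \<bar>e N - rho\<bar>)" for i
        using chord_len_near[OF st[of i]] by linarith
    qed (use steps in auto)
    finally have "average_action s N \<le> (- (G (th (s (int N))) - G (th (s (- int N)))) + of_int (int N - - int N) * (M + 2 * a\<^sup>2 * \<bar>e N - rho\<bar>)) / (2 * real N)"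
      unfolding average_action_def int_interval ends by (rule divide_right_mono) simp
    then show ?thesis using N unfolding g_def add_divide_distrib minus_divide_left by simp
  qed
  show ?thesis
  proof (rule tendsto_sandwich)
    \<comment> \<open>The limit \<open>rho\<close> lies strictly between 0 and \<open>P\<close>, so
      the steps of the competitor are eventually admissible.\<close>
    have "\<forall>\<^sub>F N in sequentially. 0 < e N" "\<forall>\<^sub>F N in sequentially. e N < P"
      using order_tendstoD[OF e] rho_pos rho_less_P by auto
    then show "\<forall>\<^sub>F N in sequentially. average_action s N \<le> - g N + M + 2 * a\<^sup>2 * \<bar>e N - rho\<bar>"
      using eventually_gt_at_top[of 0] by eventually_elim (rule up)
    show "\<forall>\<^sub>F N in sequentially. - g N + M \<le> average_action s N"
      using eventually_gt_at_top[of 0] by eventually_elim (rule low)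
    show "(\<lambda>N. - g N + M) \<longlonglongrightarrow> - C * (rho / P) + M"
      using tendsto_add[OF tendsto_minus[OF g] tendsto_const[of M]] by simp
    have "(\<lambda>N. - g N + M + 2 * a\<^sup>2 * \<bar>e N - rho\<bar>) \<longlonglongrightarrow> - (C * (rho / P)) + M + 2 * a\<^sup>2 * \<bar>rho - rho\<bar>"
      by (intro tendsto_intros g e)
    then show "(\<lambda>N. - g N + M + 2 * a\<^sup>2 * \<bar>e N - rho\<bar>) \<longlonglongrightarrow> - C * (rho / P) + M" by simp
  qed
qed

lemma caustic_orbit_exists: "\<exists>s. \<forall>i. U (th (s i)) = U0 + of_int i * rho"
  by (rule exI[of _ "\<lambda>i. inv th (inv U (U0 + of_int i * rho))"]) (simp add: th_inv U_inv)

text \<open>The tangent orbit provides existence for the definite description; uniqueness holds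
  because \<open>minimal_orbit_average\<close> applies to every minimal orbit of this rotation
  number.\<close>

lemma mather_beta_eq: "mather_beta \<gamma> l (rho / P) = - C * (rho / P) + M"
  unfolding mather_beta_def average_action_def[symmetric, abs_def]
proof (rule the_equality)
  obtain s where s: "\<And>i. U (th (s i)) = 0 + of_int i * rho" using caustic_orbit_exists by metis
  note m = caustic_orbit_minimal(1)[OF s] U_arith_rotation_number[OF s]
  show "\<exists>s. minimal_orbit \<gamma> l s \<and> has_rotation_number l s (rho / P) \<and> average_action s \<longlonglongrightarrow> - C * (rho / P) + M"
    using m minimal_orbit_average[OF m] by blast
next
  fix v assume "\<exists>s. minimal_orbit \<gamma> l s \<and> has_rotation_number l s (rho / P) \<and> average_action s \<longlonglongrightarrow> v"
  then show "v = - C * (rho / P) + M" using minimal_orbit_average LIMSEQ_unique by blast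
qed

end

subsection \<open>Confocal ellipses are caustics\<close>

text \<open>Each derivative shifts the argument by a quarter turn; the centre is present only at
  order 0.\<close>

lemma ellipse_point_smooth: "smooth_curve (ellipse_point c u A B)"
proof -
  define D where "D k t = (if k = 0 then c else 0) +
    frame_vec u (A * cos (t + real k * (pi / 2))) (B * sin (t + real k * (pi / 2)))" for k :: nat and t
  have "D 0 = ellipse_point c u A B" by (simp add: D_def ellipse_point_def fun_eq_iff)
  moreover have "(D k has_vector_derivative D (Suc k) t) (at t)" for k t
  proof -
    let ?x = "t + real k * (pi / 2)"
    have x: "t + real (Suc k) * (pi / 2) = ?x + pi / 2" by (simp add: algebra_simps)
    have cs: "cos (?x + pi / 2) = - sin ?x" "sin (?x + pi / 2) = cos ?x"
      by (simp_all add: sin_add cos_add)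
    have "((\<lambda>t. (if k = 0 then c else 0) + frame_vec u (A * cos (t + real k * (pi / 2))) (B * sin (t + real k * (pi / 2))))
      has_vector_derivative frame_vec u (A * - sin ?x) (B * cos ?x)) (at t)"
      by (rule frame_vec_deriv) (auto intro!: derivative_eq_intros)
    then show ?thesis unfolding D_def x cs by simp
  qed
  ultimately show ?thesis unfolding smooth_curve_def by blast
qed

lemma ellipse_point_vector_derivative:
  "vector_derivative (ellipse_point c u A B) (at t) = frame_vec u (- (A * sin t)) (B * cos t)"
proof (rule vector_derivative_at)
  have "((\<lambda>t. c + frame_vec u (A * cos t) (B * sin t)) has_vector_derivative frame_vec u (- (A * sin t)) (B * cos t)) (at t)"
    by (rule frame_vec_deriv) (auto intro!: derivative_eq_intros)
  then show "(ellipse_point c u A B has_vector_derivative frame_vec u (- (A * sin t)) (B * cos t)) (at t)"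
    by (simp add: ellipse_point_def[abs_def])
qed

lemma ellipse_point_closed_curve:
  assumes u: "norm u = 1" and AB: "0 < A" "0 < B"
  shows "closed_curve_param (ellipse_point c u A B) (2 * pi) (range (ellipse_point c u A B))"
  unfolding closed_curve_param_def
proof (intro conjI allI)
  show "inj_on (ellipse_point c u A B) {0..<2 * pi}"
  proof (rule inj_onI)
    fix x y assume xy: "x \<in> {0..<2 * pi}" "y \<in> {0..<2 * pi}" "ellipse_point c u A B x = ellipse_point c u A B y"
    then have "cos x = cos y" "sin x = sin y"
      using AB by (auto simp: ellipse_point_def frame_vec_eq_iff[OF u])
    then have "cos (x - y) = 1" using sin_cos_squared_add[of y] by (simp add: cos_diff power2_eq_square)
    then obtain n :: int where n: "x - y = of_int n * 2 * pi" unfolding cos_one_2pi_int by blast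
    have "\<bar>x - y\<bar> < 2 * pi" using xy by auto
    then have "\<bar>real_of_int n\<bar> * (2 * pi) < 1 * (2 * pi)" unfolding n by (simp add: abs_mult)
    then have "\<bar>real_of_int n\<bar> < 1" by (rule mult_right_less_imp_less) simp
    then have "n = 0" by linarith
    then show "x = y" using n by simp
  qed
  show "vector_derivative (ellipse_point c u A B) (at t) \<noteq> 0" for t
  proof
    assume "vector_derivative (ellipse_point c u A B) (at t) = 0"
    then have "(A * sin t)\<^sup>2 + (B * cos t)\<^sup>2 = 0"
      unfolding ellipse_point_vector_derivative using frame_vec_norm[OF u, of "- (A * sin t)" "B * cos t"] by simp
    then have "sin t = 0" "cos t = 0" using AB by (simp_all add: sum_power2_eq_zero_iff)
    then show False using sin_cos_squared_add[of t] by simp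
  qed
qed (auto simp: ellipse_point_smooth ellipse_point_def)

context ellipse_billiard
begin

definition caustic_a :: real where "caustic_a = sqrt (a\<^sup>2 - lam\<^sup>2)"
definition caustic_b :: real where "caustic_b = sqrt (b\<^sup>2 - lam\<^sup>2)"

abbreviation caustic :: "real \<Rightarrow> real^2" where "caustic \<equiv> ellipse_point c u caustic_a caustic_b"

lemma caustic_axes_sq: "caustic_a\<^sup>2 = a\<^sup>2 - lam\<^sup>2" "caustic_b\<^sup>2 = b\<^sup>2 - lam\<^sup>2" and caustic_axes_pos: "0 < caustic_a" "0 < caustic_b"
proof -
  have "lam\<^sup>2 < b\<^sup>2" using lam_pos lam_less_b by (intro power_strict_mono) auto
  moreover have "lam\<^sup>2 < a\<^sup>2" using lam_pos lam_less_b b_le_a by (intro power_strict_mono) auto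
  ultimately show "caustic_a\<^sup>2 = a\<^sup>2 - lam\<^sup>2" "caustic_b\<^sup>2 = b\<^sup>2 - lam\<^sup>2" "0 < caustic_a" "0 < caustic_b"
    by (auto simp: caustic_a_def caustic_b_def)
qed

lemma caustic_axes_less: "caustic_a < a" "caustic_b < b"
proof -
  have "caustic_a\<^sup>2 < a\<^sup>2" "caustic_b\<^sup>2 < b\<^sup>2" using caustic_axes_sq lam_pos by auto
  then show "caustic_a < a" "caustic_b < b" using a_pos b_pos power_less_imp_less_base less_imp_le by metis+
qed

lemma range_curve: "range \<gamma> = range (ellipse_point c u a b)"
proof -
  have "\<gamma> = ellipse_point c u a b \<circ> th" using curve_eq by auto
  then show ?thesis using th_bij by (metis bij_is_surj fun.set_map image_comp)
qed

lemma caustic_in_inside: "range caustic \<subseteq> inside (range \<gamma>)"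
proof
  fix p assume "p \<in> range caustic"
  then obtain t where p: "p = c + frame_vec u (caustic_a * cos t) (caustic_b * sin t)" by (auto simp: ellipse_point_def)
  have "(caustic_a / a)\<^sup>2 < 1" "(caustic_b / b)\<^sup>2 < 1"
    using caustic_axes_pos caustic_axes_less a_pos b_pos by (auto simp: power_less_one_iff)
  then have *: "(caustic_a / a)\<^sup>2 * (cos t)\<^sup>2 + (caustic_b / b)\<^sup>2 * (sin t)\<^sup>2 < 1"
  proof (cases "cos t = 0")
    case True then show ?thesis using \<open>(caustic_b / b)\<^sup>2 < 1\<close> sin_cos_squared_add[of t] by simp
  next
    case False
    then have "(caustic_a / a)\<^sup>2 * (cos t)\<^sup>2 < 1 * (cos t)\<^sup>2" using \<open>(caustic_a / a)\<^sup>2 < 1\<close> by (intro mult_strict_right_mono) auto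
    moreover have "(caustic_b / b)\<^sup>2 * (sin t)\<^sup>2 \<le> 1 * (sin t)\<^sup>2" using \<open>(caustic_b / b)\<^sup>2 < 1\<close> by (intro mult_right_mono) auto
    ultimately show ?thesis using sin_cos_squared_add[of t] by linarith
  qed
  then have "(caustic_a * cos t / a)\<^sup>2 + (caustic_b * sin t / b)\<^sup>2 < 1" by (simp add: power_mult_distrib power_divide)
  then show "p \<in> inside (range \<gamma>)"
    unfolding range_curve range_ellipse_point[OF a_pos b_pos] ellipse_region(3)[OF u_norm a_pos b_pos] p by blast
qed

lemma caustic_convex: "range caustic = frontier (convex hull (range caustic))"
  unfolding range_ellipse_point[OF caustic_axes_pos]
  by (rule ellipse_region(2)[OF u_norm caustic_axes_pos])

text \<open>In the parameters \<open>x\<close>, \<open>d\<close> of the chord with end points at angles \<open>x - d\<close> and \<open>x + d\<close>, tangency to the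
  caustic means that \<open>(p, q) = (caustic_a / a * cos x, caustic_b / b * sin x)\<close> has norm \<open>|cos d|\<close>.\<close>

lemma mu_eq_lam_iff:
  assumes "t < t'" "t' < t + 2 * pi"
  shows "mu t t' = lam \<longleftrightarrow>
    (caustic_a / a * cos ((t + t') / 2))\<^sup>2 + (caustic_b / b * sin ((t + t') / 2))\<^sup>2 = (cos ((t' - t) / 2))\<^sup>2"
proof -
  let ?x = "(t + t') / 2" and ?d = "(t' - t) / 2"
  have sp: "0 < speed ?x" by (rule speed_pos)
  have "(caustic_a / a * cos ?x)\<^sup>2 + (caustic_b / b * sin ?x)\<^sup>2 = (1 - lam\<^sup>2 / a\<^sup>2) * (cos ?x)\<^sup>2 + (1 - lam\<^sup>2 / b\<^sup>2) * (sin ?x)\<^sup>2"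
    unfolding power_mult_distrib power_divide caustic_axes_sq using a_pos b_pos by (simp add: diff_divide_distrib)
  also have "\<dots> = 1 - lam\<^sup>2 * ((cos ?x)\<^sup>2 / a\<^sup>2 + (sin ?x)\<^sup>2 / b\<^sup>2)"
  proof -
    have "(1 - p) * (cos ?x)\<^sup>2 + (1 - q) * (sin ?x)\<^sup>2
      = ((sin ?x)\<^sup>2 + (cos ?x)\<^sup>2) - (p * (cos ?x)\<^sup>2 + q * (sin ?x)\<^sup>2)" for p q
      by (simp only: left_diff_distrib)
    then show ?thesis by (simp add: distrib_left)
  qed
  also have "(cos ?x)\<^sup>2 / a\<^sup>2 + (sin ?x)\<^sup>2 / b\<^sup>2 = (speed ?x)\<^sup>2 / (a * b)\<^sup>2"
    unfolding speed_sq using a_pos b_pos by (simp add: field_simps)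
  finally have pq: "(caustic_a / a * cos ?x)\<^sup>2 + (caustic_b / b * sin ?x)\<^sup>2 = 1 - lam\<^sup>2 * ((speed ?x)\<^sup>2 / (a * b)\<^sup>2)" .
  have "mu t t' = lam \<longleftrightarrow> (mu t t')\<^sup>2 = lam\<^sup>2"
    using mu_pos[OF assms] lam_pos by (simp add: power2_eq_iff_nonneg)
  also have "\<dots> \<longleftrightarrow> (sin ?d)\<^sup>2 = lam\<^sup>2 * ((speed ?x)\<^sup>2 / (a * b)\<^sup>2)"
    unfolding mu_def using sp a_pos b_pos by (simp add: power_divide power_mult_distrib field_simps)
  finally show ?thesis unfolding pq cos_squared_eq by auto
qed

lemma curve_chord:
  "\<gamma> s = c + frame_vec u (a * (cos d * cos x + sin d * sin x)) (b * (cos d * sin x - sin d * cos x))"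
  "\<gamma> s' = c + frame_vec u (a * (cos d * cos x - sin d * sin x)) (b * (cos d * sin x + sin d * cos x))"
  if "x = (th s + th s') / 2" "d = (th s' - th s) / 2"
proof -
  have "th s = x - d" "th s' = x + d" using that by (auto simp: field_simps)
  then show "\<gamma> s = c + frame_vec u (a * (cos d * cos x + sin d * sin x)) (b * (cos d * sin x - sin d * cos x))"
    "\<gamma> s' = c + frame_vec u (a * (cos d * cos x - sin d * sin x)) (b * (cos d * sin x + sin d * cos x))"
    unfolding curve_eq ellipse_point_def by (simp_all add: cos_diff cos_add sin_diff sin_add mult.commute)
qed

text \<open>In affine coordinates that make the boundary the unit circle, the chord lies on the line
  z . (cos x, sin x) = cos d. The last factor measures on which side of it the point of the caustic
  lies.\<close>

lemma caustic_side:
  assumes "x = (th s + th s') / 2" "d = (th s' - th s) / 2"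
  shows "cross2 (\<gamma> s' - \<gamma> s) (caustic t - \<gamma> s) =
    2 * sin d * (a * b) * (cos d - caustic_a / a * cos x * cos t - caustic_b / b * sin x * sin t)"
proof -
  have "cross2 (\<gamma> s' - \<gamma> s) (caustic t - \<gamma> s) =
     (a * (- 2 * sin d * sin x)) * (caustic_b * sin t - b * (cos d * sin x - sin d * cos x))
     - (b * (2 * sin d * cos x)) * (caustic_a * cos t - a * (cos d * cos x + sin d * sin x))"
    unfolding curve_chord[OF assms] ellipse_point_def
    by (simp add: frame_vec_simps frame_vec_cross[OF u_norm] algebra_simps)
  also have "\<dots> = 2 * sin d * (a * b) * (cos d * ((sin x)\<^sup>2 + (cos x)\<^sup>2) - caustic_a / a * cos x * cos t - caustic_b / b * sin x * sin t)"
    using a_pos b_pos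
    by (simp add: field_simps power2_eq_square del: sin_cos_squared_add sin_cos_squared_add2 sin_cos_squared_add3)
  finally show ?thesis by simp
qed

text \<open>In the same affine coordinates, with (p, q) as in \<open>mu_eq_lam_iff\<close>, contact
  gives p cos t + q sin t = cos d, and tangency gives p sin t = q cos t. Together they say p^2 + q^2
  = (cos d)^2. The converse also has to place the point of contact strictly between the end
  points.\<close>

lemma tangent_chord_iff:
  assumes s: "s < s'" "s' < s + l"
  shows "tangent_chord caustic (\<gamma> s) (\<gamma> s') \<longleftrightarrow> mu (th s) (th s') = lam"
proof -
  define x where "x = (th s + th s') / 2"
  define d where "d = (th s' - th s) / 2"
  define al be where "al = caustic_a / a" and "be = caustic_b / b"
  have al: "0 < al" "al < 1" "caustic_a = a * al" and be: "0 < be" "be < 1" "caustic_b = b * be"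
    using caustic_axes_pos caustic_axes_less a_pos b_pos by (auto simp: al_def be_def)
  have tt: "th s < th s'" "th s' < th s + 2 * pi" using s th_less_iff th_step_less by auto
  have "0 < d" "d < pi" using tt by (auto simp: d_def)
  then have sd: "0 < sin d" by (rule sin_gt_zero)
  note pts = curve_chord[OF x_def d_def]
  note mu = mu_eq_lam_iff[OF tt, folded x_def d_def al_def be_def]
  have diff: "\<gamma> s' - \<gamma> s = frame_vec u (a * (- 2 * sin d * sin x)) (b * (2 * sin d * cos x))"
    unfolding pts by (simp add: frame_vec_simps algebra_simps)
  have dir: "cross2 (vector_derivative caustic (at t)) (\<gamma> s' - \<gamma> s) = 0 \<longleftrightarrow> al * cos x * sin t = be * sin x * cos t" for t
  proof -
    have "cross2 (vector_derivative caustic (at t)) (\<gamma> s' - \<gamma> s)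
       = 2 * sin d * (a * b) * (be * sin x * cos t - al * cos x * sin t)"
      unfolding ellipse_point_vector_derivative diff frame_vec_cross[OF u_norm] al(3) be(3)
      by (simp add: algebra_simps)
    then show ?thesis using sd a_pos b_pos by auto
  qed
  show ?thesis
  proof
    assume "tangent_chord caustic (\<gamma> s) (\<gamma> s')"
    then obtain t k where t: "caustic t = (1 - k) *\<^sub>R \<gamma> s + k *\<^sub>R \<gamma> s'"
      "al * cos x * sin t = be * sin x * cos t"
      unfolding tangent_chord_def dir in_segment by auto
    have "caustic t = \<gamma> s + k *\<^sub>R (\<gamma> s' - \<gamma> s)" unfolding t by (simp add: algebra_simps)
    also have "\<dots> = c + frame_vec u (a * (cos d * cos x - (2 * k - 1) * sin d * sin x)) (b * (cos d * sin x + (2 * k - 1) * sin d * cos x))"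
      unfolding diff unfolding pts by (simp add: frame_vec_simps algebra_simps)
    finally have e: "al * cos t = cos d * cos x - (2 * k - 1) * sin d * sin x"
      "be * sin t = cos d * sin x + (2 * k - 1) * sin d * cos x"
      using a_pos b_pos unfolding ellipse_point_def al be by (auto simp: frame_vec_eq_iff[OF u_norm])
    have "al * cos x * cos t + be * sin x * sin t = cos d * ((cos x)\<^sup>2 + (sin x)\<^sup>2)"
      using e by algebra
    then have "al * cos x * cos t + be * sin x * sin t = cos d" by simp
    moreover have "(p\<^sup>2 + q\<^sup>2) * ((sin t)\<^sup>2 + (cos t)\<^sup>2) = (p * cos t + q * sin t)\<^sup>2 + (p * sin t - q * cos t)\<^sup>2" for p q
      by algebra
    ultimately have "((al * cos x)\<^sup>2 + (be * sin x)\<^sup>2) * ((sin t)\<^sup>2 + (cos t)\<^sup>2) = (cos d)\<^sup>2"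
      using t(2) by (simp del: sin_cos_squared_add)
    then show "mu (th s) (th s') = lam" unfolding mu by simp
  next
    assume "mu (th s) (th s') = lam"
    then have pq: "(al * cos x)\<^sup>2 + (be * sin x)\<^sup>2 = (cos d)\<^sup>2" unfolding mu .
    have cd: "cos d \<noteq> 0"
    proof
      assume "cos d = 0"
      then have "cos x = 0" "sin x = 0" using pq al be by (auto simp: sum_power2_eq_zero_iff)
      then show False using sin_cos_squared_add[of x] by simp
    qed
    have "(al * cos x / cos d)\<^sup>2 + (be * sin x / cos d)\<^sup>2 = 1"
      using pq cd unfolding power_divide add_divide_distrib[symmetric] by simp
    \<comment> \<open>The rescaled vector is a unit vector, and its angle is the parameter of the
      point of contact.\<close>
    then obtain t where "al * cos x / cos d = cos t" "be * sin x / cos d = sin t"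
      using sincos_total_2pi by metis
    then have t: "al * cos x = cos d * cos t" "be * sin x = cos d * sin t" using cd by (auto simp: field_simps)
    \<comment> \<open>Affine coordinate of the point of contact along the chord direction (-sin x,
      cos x); its coordinate along (cos x, sin x) is \<open>cos d\<close>.\<close>
    define v where "v = be * sin t * cos x - al * cos t * sin x"
    have on: "al * cos x * cos t + be * sin x * sin t = cos d"
    proof -
      have "al * cos x * cos t + be * sin x * sin t = cos d * ((cos t)\<^sup>2 + (sin t)\<^sup>2)"
        using t by algebra
      then show ?thesis by simp
    qed
    have x1: "(sin x)\<^sup>2 + (cos x)\<^sup>2 = 1" by simp
    have e1: "al * cos t = cos d * cos x - v * sin x"
      unfolding v_def on[symmetric] using x1 by algebra
    have e2: "be * sin t = cos d * sin x + v * cos x"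
      unfolding v_def on[symmetric] using x1 by algebra
    note e = e1 e2
    \<comment> \<open>The caustic lies strictly inside the unit circle of the affine picture, which
      confines the contact point to the open chord.\<close>
    have "(cos d)\<^sup>2 + v\<^sup>2 = al\<^sup>2 * (cos t)\<^sup>2 + be\<^sup>2 * (sin t)\<^sup>2"
      unfolding v_def on[symmetric] using x1 by algebra
    also have "\<dots> < 1"
    proof -
      have "al\<^sup>2 < 1" "be\<^sup>2 < 1" using al be by (auto simp: power_less_one_iff)
      show ?thesis
      proof (cases "cos t = 0")
        case True
        then show ?thesis using \<open>be\<^sup>2 < 1\<close> sin_cos_squared_add[of t] by simp
      next
        case False
        then have "al\<^sup>2 * (cos t)\<^sup>2 < 1 * (cos t)\<^sup>2"
          using \<open>al\<^sup>2 < 1\<close> by (intro mult_strict_right_mono) auto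
        moreover have "be\<^sup>2 * (sin t)\<^sup>2 \<le> 1 * (sin t)\<^sup>2"
          using \<open>be\<^sup>2 < 1\<close> by (intro mult_right_mono) auto
        ultimately show ?thesis using sin_cos_squared_add[of t] by linarith
      qed
    qed
    finally have "v\<^sup>2 < (sin d)\<^sup>2" using sin_cos_squared_add[of d] by linarith
    then have v: "\<bar>v\<bar> < sin d" using sd by (intro power_less_imp_less_base[of "\<bar>v\<bar>" 2 "sin d"]) auto
    \<comment> \<open>Affine rescaling from \<open>v\<close> between \<open>- sin d\<close> and
      \<open>sin d\<close> to the segment parameter between 0 and 1.\<close>
    define k where "k = (v / sin d + 1) / 2"
    have "-1 < v / sin d" "v / sin d < 1" using v sd by (auto simp: field_simps abs_less_iff)
    then have k: "0 < k" "k < 1" by (auto simp: k_def)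
    have kv: "(2 * k - 1) * sin d = v" using sd by (simp add: k_def field_simps)
    have "(1 - k) *\<^sub>R \<gamma> s + k *\<^sub>R \<gamma> s' = \<gamma> s + k *\<^sub>R (\<gamma> s' - \<gamma> s)" by (simp add: algebra_simps)
    also have "\<dots> = c + frame_vec u (a * (cos d * cos x - ((2 * k - 1) * sin d) * sin x)) (b * (cos d * sin x + ((2 * k - 1) * sin d) * cos x))"
      unfolding diff unfolding pts by (simp add: frame_vec_simps algebra_simps)
    also have "\<dots> = caustic t" unfolding kv e[symmetric] ellipse_point_def al(3) be(3) by (simp add: mult.assoc)
    finally have "caustic t = (1 - k) *\<^sub>R \<gamma> s + k *\<^sub>R \<gamma> s'" ..
    moreover have "\<gamma> s \<noteq> \<gamma> s'"
    proof
      assume "\<gamma> s = \<gamma> s'"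
      then have "frame_vec u (a * (- 2 * sin d * sin x)) (b * (2 * sin d * cos x)) = frame_vec u 0 0"
        using diff by (simp add: frame_vec_def)
      then have "sin x = 0" "cos x = 0" using sd a_pos b_pos by (auto simp: frame_vec_eq_iff[OF u_norm])
      then show False using x1 by simp
    qed
    moreover have "al * cos x * sin t = be * sin x * cos t" unfolding t by simp
    ultimately show "tangent_chord caustic (\<gamma> s) (\<gamma> s')"
      unfolding tangent_chord_def dir in_segment using k by blast
  qed
qed

text \<open>Tangency determines only \<open>sin d\<close>, leaving \<open>d0 x\<close> and its
  supplement to \<open>pi\<close>. Requiring the caustic on the left makes \<open>cos d\<close>
  positive and selects \<open>d0 x\<close>.\<close>

lemma positive_chord_iff:
  assumes s: "s < s'" "s' < s + l"
  shows "tangent_chord caustic (\<gamma> s) (\<gamma> s') \<and> (\<forall>z\<in>range caustic. 0 \<le> cross2 (\<gamma> s' - \<gamma> s) (z - \<gamma> s))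
    \<longleftrightarrow> U (th s') - U (th s) = rho"
proof -
  define x where "x = (th s + th s') / 2"
  define d where "d = (th s' - th s) / 2"
  have xd: "th s = x - d" "th s' = x + d" by (auto simp: x_def d_def field_simps)
  have tt: "th s < th s'" "th s' < th s + 2 * pi" using s th_less_iff th_step_less by auto
  have d: "0 < d" "d < pi" using tt by (auto simp: d_def)
  then have sd: "0 < sin d" by (rule sin_gt_zero)
  note side = caustic_side[OF x_def d_def]
  have mu: "mu (th s) (th s') = a * b * sin d / speed x" unfolding mu_def x_def d_def ..
  show ?thesis
  proof
    assume *: "tangent_chord caustic (\<gamma> s) (\<gamma> s') \<and> (\<forall>z\<in>range caustic. 0 \<le> cross2 (\<gamma> s' - \<gamma> s) (z - \<gamma> s))"
    \<comment> \<open>The side condition is tested at the caustic point with parameter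
      \<open>t = x\<close>, where the subtracted terms have a positive sum.\<close>
    then have "0 \<le> 2 * sin d * (a * b) * (cos d - caustic_a / a * cos x * cos x - caustic_b / b * sin x * sin x)"
      unfolding side[symmetric] by blast
    moreover have "0 < 2 * sin d * (a * b)" using sd a_pos b_pos by simp
    ultimately have "0 \<le> cos d - caustic_a / a * cos x * cos x - caustic_b / b * sin x * sin x"
      by (meson linorder_not_le mult_pos_neg)
    moreover have "0 < caustic_a / a * cos x * cos x + caustic_b / b * sin x * sin x"
    proof -
      have "0 < caustic_a / a" "0 < caustic_b / b" using caustic_axes_pos a_pos b_pos by auto
      moreover have "cos x \<noteq> 0 \<or> sin x \<noteq> 0" using sin_cos_squared_add[of x] by force
      ultimately have "0 < caustic_a / a * (cos x)\<^sup>2 + caustic_b / b * (sin x)\<^sup>2"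
        by (cases "cos x = 0") (auto intro!: add_pos_nonneg mult_pos_pos mult_nonneg_nonneg
            simp del: times_divide_eq_left)
      then show ?thesis by (simp add: power2_eq_square mult.assoc)
    qed
    ultimately have "0 < cos d" by linarith
    then have "d < pi / 2"
      using d cos_monotone_0_pi_le[of "pi / 2" d] by force
    moreover have "sin d = lam * speed x / (a * b)"
      using * tangent_chord_iff[OF s] unfolding mu using a_pos b_pos speed_pos[of x] by (auto simp: field_simps)
    ultimately have "d = d0 x" unfolding d0_def using d arcsin_sin[of d] by simp
    then show "U (th s') - U (th s) = rho" using U_d0[of x] xd by simp
  next
    assume *: "U (th s') - U (th s) = rho"
    then obtain y where "th s = y - d0 y" "th s' = y + d0 y" using U_step_iff by blast
    then have "d = d0 x" unfolding x_def d_def by simp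
    then have m: "mu (th s) (th s') = lam" and cd: "0 < cos d" unfolding mu using lam_eq_if_sin cos_d0_pos by auto
    have pq: "(caustic_a / a * cos x)\<^sup>2 + (caustic_b / b * sin x)\<^sup>2 = (cos d)\<^sup>2"
      using m mu_eq_lam_iff[OF tt] unfolding x_def d_def by blast
    have "0 \<le> cross2 (\<gamma> s' - \<gamma> s) (caustic t - \<gamma> s)" for t
    proof -
      \<comment> \<open>Lagrange's identity again, giving the Cauchy-Schwarz bound for all points of
        the caustic.\<close>
      have "(caustic_a / a * cos x * cos t + caustic_b / b * sin x * sin t)\<^sup>2 + (caustic_a / a * cos x * sin t - caustic_b / b * sin x * cos t)\<^sup>2
        = ((caustic_a / a * cos x)\<^sup>2 + (caustic_b / b * sin x)\<^sup>2) * ((sin t)\<^sup>2 + (cos t)\<^sup>2)"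
        by algebra
      then have "(caustic_a / a * cos x * cos t + caustic_b / b * sin x * sin t)\<^sup>2 \<le> (cos d)\<^sup>2"
        unfolding pq by (simp add: le_iff_add) (metis le_add_same_cancel1 zero_le_power2)
      then have "caustic_a / a * cos x * cos t + caustic_b / b * sin x * sin t \<le> cos d"
        using cd by (meson less_imp_le power2_le_imp_le)
      then show ?thesis unfolding side using sd a_pos b_pos by (intro mult_nonneg_nonneg) auto
    qed
    then show "tangent_chord caustic (\<gamma> s) (\<gamma> s') \<and> (\<forall>z\<in>range caustic. 0 \<le> cross2 (\<gamma> s' - \<gamma> s) (z - \<gamma> s))"
      using m tangent_chord_iff[OF s] by blast
  qed
qed

text \<open>The orbits on the boundary of phase space have coinciding consecutive impact points,
  hence an empty open segment, and cannot be tangent to anything.\<close>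

lemma tangent_orbit_steps:
  assumes orb: "billiard_orbit \<gamma> l s" and tan: "tangent_chord caustic (\<gamma> (s 0)) (\<gamma> (s 1))"
  shows "s i < s (i + 1)" "s (i + 1) < s i + l" "reflection_law \<gamma> (s (i - 1)) (s i) (s (i + 1))"
proof -
  have ne: "\<gamma> (s 0) \<noteq> \<gamma> (s 1)" using tan by (auto simp: tangent_chord_def)
  have "\<gamma> (x + l) = \<gamma> x" for x unfolding curve_eq ellipse_point_def th_quasi_periodic by simp
  then have "\<not> (\<forall>i. s (i + 1) = s i + l)" "\<not> (\<forall>i. s (i + 1) = s i)"
    using ne by (metis add_0)+
  then show "s i < s (i + 1)" "s (i + 1) < s i + l" "reflection_law \<gamma> (s (i - 1)) (s i) (s (i + 1))"
    using orb unfolding billiard_orbit_def by blast+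
qed

text \<open>Reflection equates \<open>chord_in\<close> and \<open>chord_out\<close> at an impact.
  Their squares involve the same speed, so the positive quantity \<open>mu\<close> is conserved and
  remains equal to \<open>lam\<close>.\<close>

lemma is_caustic_confocal: "is_caustic \<gamma> l caustic"
  unfolding is_caustic_def
proof (intro conjI allI impI)
  show "\<exists>L. closed_curve_param caustic L (range caustic)"
    using ellipse_point_closed_curve[OF u_norm caustic_axes_pos] by blast
  fix s i assume *: "billiard_orbit \<gamma> l s \<and> tangent_chord caustic (\<gamma> (s 0)) (\<gamma> (s 1))" and i: "(0::int) \<le> i"
  note st = tangent_orbit_steps[OF conjunct1[OF *] conjunct2[OF *]]
  have "mu (th (s i)) (th (s (i + 1))) = lam"
    using i
  proof (induction i rule: int_ge_induct)
    case base
    then show ?case using * tangent_chord_iff[OF st(1,2)[of 0]] by simp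
  next
    case (step i)
    have m: "0 < mu (th (s i)) (th (s (i + 1)))" for i
      using st(1,2)[of i] by (intro mu_pos) (auto simp: th_less_iff th_step_less)
    have "chord_in (th (s i)) (th (s (i + 1))) = chord_out (th (s (i + 1))) (th (s (i + 1 + 1)))"
      using st(3)[of "i + 1"] st(1,2)[of i] st(1,2)[of "i + 1"] by (simp add: reflection_law_iff)
    then have "(mu (th (s i)) (th (s (i + 1))))\<^sup>2 = (mu (th (s (i + 1))) (th (s (i + 1 + 1))))\<^sup>2"
      using chord_in_sq[of "th (s i)" "th (s (i + 1))"] chord_out_sq[of "th (s (i + 1))" "th (s (i + 1 + 1))"] by simp
    then show ?case using m[of i] m[of "i + 1"] step.IH by (simp add: power2_eq_iff_nonneg)
  qed
  then show "tangent_chord caustic (\<gamma> (s i)) (\<gamma> (s (i + 1)))"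
    using tangent_chord_iff[OF st(1,2)[of i]] by simp
qed (rule caustic_convex caustic_in_inside)+

lemma positive_tangent_orbit_iff:
  "positive_tangent_orbit \<gamma> l caustic s \<longleftrightarrow> (\<forall>i. U (th (s (i + 1))) - U (th (s i)) = rho)"
proof
  assume *: "positive_tangent_orbit \<gamma> l caustic s"
  then have "billiard_orbit \<gamma> l s" "tangent_chord caustic (\<gamma> (s 0)) (\<gamma> (s (0 + 1)))"
    unfolding positive_tangent_orbit_def by blast+
  note st = tangent_orbit_steps[OF this[simplified]]
  show "\<forall>i. U (th (s (i + 1))) - U (th (s i)) = rho"
    using * positive_chord_iff[OF st(1,2)] unfolding positive_tangent_orbit_def by blast
next
  assume *: "\<forall>i. U (th (s (i + 1))) - U (th (s i)) = rho"
  have U: "U (th (s i)) = U (th (s 0)) + of_int i * rho" for i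
    using sum_telescope_int[of 0 i "\<lambda>i. U (th (s i))"] sum_telescope_int[of i 0 "\<lambda>i. U (th (s i))"] *
    by (cases "0 \<le> i") auto
  note orb = caustic_orbit_is_orbit[OF U]
  show "positive_tangent_orbit \<gamma> l caustic s"
    unfolding positive_tangent_orbit_def using orb * positive_chord_iff[OF orb(2,3)] by blast
qed

lemma caustic_rotation: "caustic_rotation_number \<gamma> l caustic (rho / P)"
  unfolding caustic_rotation_number_def positive_tangent_orbit_iff
proof (intro conjI allI impI)
  obtain s where "\<forall>i :: int. U (th (s i)) = 0 + of_int i * rho" using caustic_orbit_exists by blast
  then have "\<forall>i :: int. U (th (s (i + 1))) - U (th (s i)) = rho" by (simp add: algebra_simps)
  then show "\<exists>s. \<forall>i :: int. U (th (s (i + 1))) - U (th (s i)) = rho" by blast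
next
  fix s assume *: "\<forall>i :: int. U (th (s (i + 1))) - U (th (s i)) = rho"
  have "U (th (s i)) = U (th (s 0)) + of_int i * rho" for i
    using sum_telescope_int[of 0 i "\<lambda>i. U (th (s i))"] sum_telescope_int[of i 0 "\<lambda>i. U (th (s i))"] *
    by (cases "0 \<le> i") auto
  then show "has_rotation_number l s (rho / P)" by (rule U_arith_rotation_number)
qed

end

subsection \<open>Taylor coefficients\<close>

lemma mather_beta_asymptotics:
  assumes "ellipse_curve a b \<gamma> l th c u"
  shows "((\<lambda>w. (mather_beta \<gamma> l w + ellipse_perim a b * w) / w ^ 3) \<longlongrightarrow>
      (a * b)\<^sup>2 * ellipse_inv_speed a b ^ 3 / 24) (at_right 0)"
    and "\<forall>\<^sub>F w in at_right 0. 0 < w \<and> (\<exists>c. is_caustic \<gamma> l c \<and> caustic_rotation_number \<gamma> l c w)"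
proof -
  interpret ellipse_curve a b \<gamma> l th c u by fact
  have *: "0 < omega lam \<and> mather_beta \<gamma> l (omega lam) = beta_val lam
      \<and> (\<exists>c. is_caustic \<gamma> l c \<and> caustic_rotation_number \<gamma> l c (omega lam))"
    if "0 < lam" "lam < b" for lam
  proof -
    interpret ellipse_billiard a b \<gamma> l th c u lam by unfold_locales (use that in auto)
    show ?thesis
      using omega_pos mather_beta_eq is_caustic_confocal caustic_rotation
      unfolding omega_eq beta_val_eq by blast
  qed
  show "((\<lambda>w. (mather_beta \<gamma> l w + perim * w) / w ^ 3) \<longlongrightarrow> (a * b)\<^sup>2 * inv_speed_int ^ 3 / 24) (at_right 0)"
    by (rule beta_asymptotics) (use * in blast)
  show "\<forall>\<^sub>F w in at_right 0. 0 < w \<and> (\<exists>c. is_caustic \<gamma> l c \<and> caustic_rotation_number \<gamma> l c w)"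
    by (rule eventually_mono[OF omega_range]) (use * in auto)
qed

text \<open>Multiplying by the power of \<open>w\<close> shows that the numerator tends to 0, so its
  constant term vanishes; one factor \<open>w\<close> is cancelled and the argument
  repeated.\<close>

lemma cubic_limit_coefficients:
  fixes c0 c1 c2 c3 k :: real
  assumes "((\<lambda>w. (c0 + c1 * w + c2 * w\<^sup>2 + c3 * w ^ 3) / w ^ 3) \<longlongrightarrow> k) (at_right 0)"
  shows "c0 = 0" "c1 = 0" "c2 = 0" "c3 = k"
proof -
  let ?R = "at_right (0 :: real)"
  have zero: "p 0 = 0" if p: "continuous_on UNIV p" and lim: "((\<lambda>w. p w / w ^ Suc n) \<longlongrightarrow> k) ?R"
    for p :: "real \<Rightarrow> real" and n
  proof -
    have "((\<lambda>w. p w / w ^ Suc n * w ^ Suc n) \<longlongrightarrow> k * 0 ^ Suc n) ?R"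
      by (intro tendsto_mult lim tendsto_power tendsto_ident_at)
    then have "((\<lambda>w. p w / w ^ Suc n * w ^ Suc n) \<longlongrightarrow> 0) ?R" by simp
    moreover have "\<forall>\<^sub>F w in ?R. p w / w ^ Suc n * w ^ Suc n = p w"
      using eventually_at_right_less[of 0] by eventually_elim simp
    ultimately have "(p \<longlongrightarrow> 0) ?R" by (rule Lim_transform_eventually)
    moreover have "(p \<longlongrightarrow> p 0) ?R"
      using p by (simp add: continuous_on_eq_continuous_at isCont_def filterlim_at_split)
    ultimately show ?thesis using tendsto_unique by force
  qed
  have red: "((\<lambda>w. q w / w ^ n) \<longlongrightarrow> k) ?R"
    if "((\<lambda>w. p w / w ^ Suc n) \<longlongrightarrow> k) ?R" "\<And>w. p w = w * q w" for p q :: "real \<Rightarrow> real" and n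
    by (rule Lim_transform_eventually[OF that(1)])
      (use eventually_at_right_less[of "0 :: real"] in \<open>eventually_elim, simp add: that(2)\<close>)
  have 3: "((\<lambda>w. (c0 + c1 * w + c2 * w\<^sup>2 + c3 * w ^ 3) / w ^ Suc 2) \<longlongrightarrow> k) ?R"
    using assms by (simp add: eval_nat_numeral)
  have "continuous_on UNIV (\<lambda>w. c0 + c1 * w + c2 * w\<^sup>2 + c3 * w ^ 3)" by (intro continuous_intros)
  from zero[OF this 3] show c0: "c0 = 0" by simp
  have 2: "((\<lambda>w. (c1 + c2 * w + c3 * w\<^sup>2) / w ^ Suc 1) \<longlongrightarrow> k) ?R"
    by (rule red[where n = "Suc 1" and q = "\<lambda>w. c1 + c2 * w + c3 * w\<^sup>2"])
      (use 3 in \<open>simp add: numeral_2_eq_2\<close>, simp add: c0 algebra_simps power2_eq_square power3_eq_cube)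
  have "continuous_on UNIV (\<lambda>w. c1 + c2 * w + c3 * w\<^sup>2)" by (intro continuous_intros)
  from zero[OF this 2] show c1: "c1 = 0" by simp
  have 1: "((\<lambda>w. (c2 + c3 * w) / w ^ Suc 0) \<longlongrightarrow> k) ?R"
    by (rule red[where n = "Suc 0" and q = "\<lambda>w. c2 + c3 * w"])
      (use 2 in simp, simp add: c1 algebra_simps power2_eq_square)
  have "continuous_on UNIV (\<lambda>w. c2 + c3 * w)" by (intro continuous_intros)
  from zero[OF this 1] show c2: "c2 = 0" by simp
  have "((\<lambda>w. c3 / w ^ 0) \<longlongrightarrow> k) ?R"
    by (rule red[OF 1]) (simp add: c2)
  then have "((\<lambda>w. c3) \<longlongrightarrow> k) ?R" by simp
  from tendsto_unique[OF _ tendsto_const this] show "c3 = k" by simp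
qed

text \<open>The expansion to order 3 has a remainder that is \<open>o(w ^ 3)\<close>, so the Taylor
  polynomial inherits the limit of \<open>mather_beta_asymptotics\<close>. The factor
  \<open>fact 3 = 6\<close> turns 24 into 4.\<close>

lemma taylor_coefficients:
  assumes "ellipse_curve a b \<gamma> l th c u" and B: "beta_taylor_expansion \<gamma> l B"
  shows "B 1 = - ellipse_perim a b" "B 3 = (a * b)\<^sup>2 * ellipse_inv_speed a b ^ 3 / 4"
proof -
  let ?S = "{\<omega>. 0 < \<omega> \<and> (\<exists>c. is_caustic \<gamma> l c \<and> caustic_rotation_number \<gamma> l c \<omega>)}"
  let ?R = "at_right (0 :: real)" and ?k = "(a * b)\<^sup>2 * ellipse_inv_speed a b ^ 3 / 24"
  note asym = mather_beta_asymptotics[OF assms(1)]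
  define r where "r w = mather_beta \<gamma> l w - (\<Sum>k\<le>3. B k * w ^ k / fact k)" for w
  \<comment> \<open>Caustic rotation numbers fill a right neighbourhood of 0, so estimates along
    them hold as \<open>w\<close> decreases to 0 through all reals.\<close>
  have "at_right 0 \<le> at 0 within ?S"
    using asym(2) by (auto simp: at_within_def le_inf_iff le_principal eventually_inf_principal elim: eventually_mono)
  moreover have "r \<in> O[at 0 within ?S](\<lambda>w. w ^ (3 + 1))"
    using B unfolding beta_taylor_expansion_def r_def[abs_def] by blast
  ultimately have "r \<in> O[?R](\<lambda>w. w ^ (3 + 1))"
    by (rule landau_o.big.filter_mono)
  then have "r \<in> O[?R](\<lambda>w. w ^ 4)" by simp
  moreover have "(\<lambda>w :: real. w ^ 4) \<in> o[?R](\<lambda>w. w ^ 3)"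
  proof (rule smalloI_tendsto)
    have "((\<lambda>w :: real. w) \<longlongrightarrow> 0) ?R" by (rule tendsto_ident_at)
    moreover have "\<forall>\<^sub>F w in ?R. w = w ^ 4 / w ^ 3"
      using eventually_at_right_less[of 0] by eventually_elim (simp add: eval_nat_numeral)
    ultimately show "((\<lambda>w :: real. w ^ 4 / w ^ 3) \<longlongrightarrow> 0) ?R" by (rule Lim_transform_eventually)
    show "\<forall>\<^sub>F w in ?R. w ^ 3 \<noteq> (0 :: real)" using eventually_at_right_less[of 0] by eventually_elim simp
  qed
  ultimately have "r \<in> o[?R](\<lambda>w. w ^ 3)" by (rule landau_o.big_small_trans)
  then have "((\<lambda>w. r w / w ^ 3) \<longlongrightarrow> 0) ?R" by (rule smalloD_tendsto)
  from tendsto_diff[OF asym(1) this]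
  have "((\<lambda>w. (mather_beta \<gamma> l w + ellipse_perim a b * w) / w ^ 3 - r w / w ^ 3) \<longlongrightarrow> ?k) ?R" by simp
  moreover have "(mather_beta \<gamma> l w + ellipse_perim a b * w) / w ^ 3 - r w / w ^ 3
      = (B 0 + (B 1 + ellipse_perim a b) * w + B 2 / 2 * w\<^sup>2 + B 3 / 6 * w ^ 3) / w ^ 3" for w
    unfolding diff_divide_distrib[symmetric] r_def
    by (rule arg_cong2[where f = "(/)"]) (simp_all add: eval_nat_numeral algebra_simps)
  ultimately have "((\<lambda>w. (B 0 + (B 1 + ellipse_perim a b) * w + B 2 / 2 * w\<^sup>2 + B 3 / 6 * w ^ 3) / w ^ 3) \<longlongrightarrow> ?k) ?R"
    by simp
  from cubic_limit_coefficients(2,4)[OF this]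
  show "B 1 = - ellipse_perim a b" "B 3 = (a * b)\<^sup>2 * ellipse_inv_speed a b ^ 3 / 4" by auto
qed

theorem proposition1:
  fixes E1 E2 :: "(real^2) set" and a1 b1 a2 b2 l1 l2 :: real
    and \<gamma>1 \<gamma>2 :: "real \<Rightarrow> real^2"
  assumes "is_ellipse a1 b1 E1" and "is_ellipse a2 b2 E2"
    and "arclength_param \<gamma>1 l1 E1" and "arclength_param \<gamma>2 l2 E2"
  shows "((\<forall>\<omega>\<in>{0..1}. mather_beta \<gamma>1 l1 \<omega> = mather_beta \<gamma>2 l2 \<omega>) \<longrightarrow> a1 = a2 \<and> b1 = b2) \<and>
         (\<forall>B1 B2. beta_taylor_expansion \<gamma>1 l1 B1 \<and> beta_taylor_expansion \<gamma>2 l2 B2 \<and>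
            B1 1 = B2 1 \<and> B1 3 = B2 3 \<longrightarrow> a1 = a2 \<and> b1 = b2)"
proof -
  obtain th1 c1 u1 where e1: "ellipse_curve a1 b1 \<gamma>1 l1 th1 c1 u1"
    using ellipse_curve_exists[OF assms(1,3)] by blast
  obtain th2 c2 u2 where e2: "ellipse_curve a2 b2 \<gamma>2 l2 th2 c2 u2"
    using ellipse_curve_exists[OF assms(2,4)] by blast
  have ax: "ellipse_axes a1 b1" "ellipse_axes a2 b2"
    using e1 e2 by (auto simp: ellipse_curve_def)
  show ?thesis
  proof (intro conjI impI allI)
    assume eq: "\<forall>\<omega>\<in>{0..1}. mather_beta \<gamma>1 l1 \<omega> = mather_beta \<gamma>2 l2 \<omega>"
    let ?f1 = "\<lambda>w. (mather_beta \<gamma>1 l1 w + ellipse_perim a1 b1 * w) / w ^ 3"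
    let ?f2 = "\<lambda>w. (mather_beta \<gamma>2 l2 w + ellipse_perim a2 b2 * w) / w ^ 3"
    have "\<forall>\<^sub>F w :: real in at_right 0. 0 < w \<and> w < 1"
      unfolding eventually_at_right[of 0 "1 :: real", OF zero_less_one] by (rule exI[of _ 1]) auto
    \<comment> \<open>Where the beta functions agree, only the perimeters survive in the difference.
      Its limit is finite, so the perimeters are equal; the cubic coefficient is 0, so the two
      limits are equal.\<close>
    then have "\<forall>\<^sub>F w in at_right 0. ?f1 w - ?f2 w
        = (0 + (ellipse_perim a1 b1 - ellipse_perim a2 b2) * w + 0 * w\<^sup>2 + 0 * w ^ 3) / w ^ 3"
    proof eventually_elim
      case (elim w)
      then have "mather_beta \<gamma>1 l1 w = mather_beta \<gamma>2 l2 w" using eq by simp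
      then show ?case by (simp add: diff_divide_distrib[symmetric] left_diff_distrib)
    qed
    from cubic_limit_coefficients(2,4)[OF Lim_transform_eventually[OF
        tendsto_diff[OF mather_beta_asymptotics(1)[OF e1] mather_beta_asymptotics(1)[OF e2]] this]]
    have "a1 = a2 \<and> b1 = b2" by (intro ellipse_determined ax) auto
    then show "a1 = a2" "b1 = b2" by auto
  next
    fix B1 B2
    assume *: "beta_taylor_expansion \<gamma>1 l1 B1 \<and> beta_taylor_expansion \<gamma>2 l2 B2 \<and> B1 1 = B2 1 \<and> B1 3 = B2 3"
    then have "a1 = a2 \<and> b1 = b2"
      using taylor_coefficients[OF e1, of B1] taylor_coefficients[OF e2, of B2]
      by (intro ellipse_determined ax) auto
    then show "a1 = a2" "b1 = b2" by auto
  qed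
qed

end
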